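(* The operad $\mathcal{BG}^!$, Koszul dual of $\mathcal{BG}$, is the quadratic operad $\mathcal{P}(E,R)$, where $E$ is concentrated in degree (arity) $2$, with $E(2)$ the free $S_2$-module $\mathbb{K}m\oplus\mathbb{K}\succ\oplus\,\mathbb{K}\prec$ (i.e. freely generated by $m,\succ,\prec$), and $R$ is concentrated in degree $3$, with $R(3)\subseteq\mathcal{P}_E(3)$ the sub-$S_3$-module generated by $$\begin{array}{ll} r_1=\succ\circ(m,I)-\succ\circ(I,\succ), & r_7=\succ\circ(\succ,I),\\ r_2=m\circ(\succ,I)-\succ\circ(I,m), & r_8=\succ\circ(\prec,I),\\ r_3=\prec\circ(\prec,I)-\prec\circ(I,m), & r_9=m\circ(\prec,I),\\ r_4=\prec\circ(m,I)-m\circ(I,\prec), & r_{10}=\prec\circ(I,\prec),\\ r_5=\prec\circ(\succ,I)-\succ\circ(I,\prec), & r_{11}=\prec\circ(I,\succ),\\ r_6=m\circ(m,I)-m\circ(I,m), & r_{12}=m\circ(I,\succ). \end{array}$$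
   Context: $\mathbb{K}$ is a commutative field of any characteristic. $\mathcal{P}_E$ denotes the free operad on $E$, $I$ its unit, and $\mathcal{P}(E,R)=\mathcal{P}_E/(R)$. The bigraft operad $\mathcal{BG}$ is the binary quadratic operad $\mathcal{P}(E,R')$ with $E(2)$ the free $S_2$-module generated by three operations $m,\succ,\prec$, and $R'(3)$ the sub-$S_3$-module of $\mathcal{P}_E(3)$ generated by $\succ\circ(m,I)-\succ\circ(I,\succ)$, $m\circ(\succ,I)-\succ\circ(I,m)$, $\prec\circ(\prec,I)-\prec\circ(I,m)$, $\prec\circ(m,I)-m\circ(I,\prec)$, $\prec\circ(\succ,I)-\succ\circ(I,\prec)$, $m\circ(m,I)-m\circ(I,m)$. The Koszul dual (in the sense of Ginzburg and Kapranov) of a binary quadratic operad $\mathcal{P}(E,R')$ is $\mathcal{P}(E^!,R'^{\perp})$, where $V^!=V^*\otimes(\text{signature})$ for a right $S_n$-module $V$, and $R'^\perp$ is the annihilator of $R'$ for the induced pairing between $\mathcal{P}_{E^!}(3)=\mathcal{P}_E(3)^!$ and $\mathcal{P}_E(3)$. *)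

theory Defs
  imports "HOL-Library.Poly_Mapping" "HOL-Combinatorics.Permutations"
begin

section \<open>Right modules over symmetric groups\<close>

text \<open>
  The symmetric group \<open>S\<^sub>n\<close> is the set of \<open>\<sigma>\<close> with \<open>\<sigma> permutes {..<n}\<close>; the product is composition, and
  all actions are right actions. Inputs of operations are numbered from \<open>0\<close>.
\<close>

record ('k, 'v) sn_mod =
  carr :: "'v set"
  vzero :: 'v
  vadd :: "'v \<Rightarrow> 'v \<Rightarrow> 'v"
  vscale :: "'k \<Rightarrow> 'v \<Rightarrow> 'v"
  vact :: "(nat \<Rightarrow> nat) \<Rightarrow> 'v \<Rightarrow> 'v"

locale sn_module =
  fixes n :: nat and V :: "('k::field, 'v) sn_mod"
  assumes zero_closed: "vzero V \<in> carr V"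
    and add_closed: "\<lbrakk>x \<in> carr V; y \<in> carr V\<rbrakk> \<Longrightarrow> vadd V x y \<in> carr V"
    and scale_closed: "x \<in> carr V \<Longrightarrow> vscale V c x \<in> carr V"
    and act_closed: "\<lbrakk>\<sigma> permutes {..<n}; x \<in> carr V\<rbrakk> \<Longrightarrow> vact V \<sigma> x \<in> carr V"
    and add_assoc: "\<lbrakk>x \<in> carr V; y \<in> carr V; z \<in> carr V\<rbrakk>
          \<Longrightarrow> vadd V (vadd V x y) z = vadd V x (vadd V y z)"
    and add_commute: "\<lbrakk>x \<in> carr V; y \<in> carr V\<rbrakk> \<Longrightarrow> vadd V x y = vadd V y x"
    and add_zero: "x \<in> carr V \<Longrightarrow> vadd V (vzero V) x = x"
    and add_uminus: "x \<in> carr V \<Longrightarrow> vadd V x (vscale V (- 1) x) = vzero V"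
    and scale_add: "\<lbrakk>x \<in> carr V; y \<in> carr V\<rbrakk>
          \<Longrightarrow> vscale V c (vadd V x y) = vadd V (vscale V c x) (vscale V c y)"
    and add_scale: "x \<in> carr V \<Longrightarrow> vscale V (c + d) x = vadd V (vscale V c x) (vscale V d x)"
    and scale_scale: "x \<in> carr V \<Longrightarrow> vscale V c (vscale V d x) = vscale V (c * d) x"
    and scale_one: "x \<in> carr V \<Longrightarrow> vscale V 1 x = x"
    and act_add: "\<lbrakk>\<sigma> permutes {..<n}; x \<in> carr V; y \<in> carr V\<rbrakk>
          \<Longrightarrow> vact V \<sigma> (vadd V x y) = vadd V (vact V \<sigma> x) (vact V \<sigma> y)"
    and act_scale: "\<lbrakk>\<sigma> permutes {..<n}; x \<in> carr V\<rbrakk>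
          \<Longrightarrow> vact V \<sigma> (vscale V c x) = vscale V c (vact V \<sigma> x)"
    and act_id: "x \<in> carr V \<Longrightarrow> vact V id x = x"
    and act_comp: "\<lbrakk>\<sigma> permutes {..<n}; \<tau> permutes {..<n}; x \<in> carr V\<rbrakk>
          \<Longrightarrow> vact V (\<sigma> \<circ> \<tau>) x = vact V \<tau> (vact V \<sigma> x)"

definition vminus :: "('k::field, 'v) sn_mod \<Rightarrow> 'v \<Rightarrow> 'v \<Rightarrow> 'v" where
  "vminus V x y = vadd V x (vscale V (- 1) y)"

text \<open>The sub-\<open>S\<^sub>n\<close>-module generated by \<open>S\<close>.\<close>

inductive_set sn_span :: "nat \<Rightarrow> ('k::field, 'v) sn_mod \<Rightarrow> 'v set \<Rightarrow> 'v set"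
  for n :: nat and V :: "('k, 'v) sn_mod" and S :: "'v set" where
  base: "x \<in> S \<Longrightarrow> x \<in> sn_span n V S"
| zero: "vzero V \<in> sn_span n V S"
| add: "\<lbrakk>x \<in> sn_span n V S; y \<in> sn_span n V S\<rbrakk> \<Longrightarrow> vadd V x y \<in> sn_span n V S"
| scale: "x \<in> sn_span n V S \<Longrightarrow> vscale V c x \<in> sn_span n V S"
| act: "\<lbrakk>\<sigma> permutes {..<n}; x \<in> sn_span n V S\<rbrakk> \<Longrightarrow> vact V \<sigma> x \<in> sn_span n V S"

text \<open>\<open>V\<^sup>! = V\<^sup>* \<otimes> (signature)\<close>. A functional is represented by a function on the ambient type that is
  \<open>undefined\<close> outside the carrier of \<open>V\<close>.\<close>

definition sn_dual :: "nat \<Rightarrow> ('k::field, 'v) sn_mod \<Rightarrow> ('k, 'v \<Rightarrow> 'k) sn_mod" where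
  "sn_dual n V =
    \<lparr>carr = {f \<in> extensional (carr V).
        (\<forall>x\<in>carr V. \<forall>y\<in>carr V. f (vadd V x y) = f x + f y) \<and>
        (\<forall>c. \<forall>x\<in>carr V. f (vscale V c x) = c * f x)},
     vzero = (\<lambda>x\<in>carr V. 0),
     vadd = (\<lambda>f g. \<lambda>x\<in>carr V. f x + g x),
     vscale = (\<lambda>c f. \<lambda>x\<in>carr V. c * f x),
     vact = (\<lambda>\<sigma> f. \<lambda>x\<in>carr V. of_int (sign \<sigma>) * f (vact V (inv \<sigma>) x))\<rparr>"

section \<open>Formal linear combinations\<close>

definition pm_scale :: "'k::field \<Rightarrow> ('a \<Rightarrow>\<^sub>0 'k) \<Rightarrow> ('a \<Rightarrow>\<^sub>0 'k)" where
  "pm_scale c p = Poly_Mapping.map ((*) c) p"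

definition pm_extend :: "('a \<Rightarrow> ('b \<Rightarrow>\<^sub>0 'k)) \<Rightarrow> ('a \<Rightarrow>\<^sub>0 'k) \<Rightarrow> ('b \<Rightarrow>\<^sub>0 'k::field)" where
  "pm_extend f p = (\<Sum>a\<in>Poly_Mapping.keys p. pm_scale (Poly_Mapping.lookup p a) (f a))"

text \<open>The free \<open>S\<^sub>n\<close>-module on the set of all elements of \<open>'g\<close>; the basis vector \<open>(g, \<sigma>)\<close> is \<open>g \<cdot> \<sigma>\<close>.\<close>

definition free_sn :: "nat \<Rightarrow> ('k::field, 'g \<times> (nat \<Rightarrow> nat) \<Rightarrow>\<^sub>0 'k) sn_mod" where
  "free_sn n =
    \<lparr>carr = {p. Poly_Mapping.keys p \<subseteq> UNIV \<times> {\<sigma>. \<sigma> permutes {..<n}}},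
     vzero = 0,
     vadd = (+),
     vscale = pm_scale,
     vact = (\<lambda>\<tau>. pm_extend (\<lambda>(g, \<sigma>). Poly_Mapping.single (g, \<sigma> \<circ> \<tau>) 1))\<rparr>"

definition free_gen :: "'g \<Rightarrow> ('g \<times> (nat \<Rightarrow> nat) \<Rightarrow>\<^sub>0 'k::field)" where
  "free_gen g = Poly_Mapping.single (g, id) 1"

section \<open>Operads\<close>

text \<open>
  \<open>pcomp P m n i p q\<close> is the partial composite of \<open>p \<in> P(m)\<close> and \<open>q \<in> P(n)\<close> at input \<open>i < m\<close> of \<open>p\<close>.
\<close>

record ('k, 'v) operad_struct =
  ops :: "nat \<Rightarrow> ('k, 'v) sn_mod"
  unit :: 'v
  pcomp :: "nat \<Rightarrow> nat \<Rightarrow> nat \<Rightarrow> 'v \<Rightarrow> 'v \<Rightarrow> 'v"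

text \<open>
  The permutations \<open>\<sigma> \<circ>\<^sub>i id\<close> and \<open>id \<circ>\<^sub>i \<tau>\<close> of \<open>m + n - 1\<close> inputs occurring in
  \<open>(p \<cdot> \<sigma>) \<circ>\<^sub>i q = (p \<circ>\<^sub>\<sigma>\<^sub>(\<^sub>i\<^sub>) q) \<cdot> (\<sigma> \<circ>\<^sub>i id)\<close> and \<open>p \<circ>\<^sub>i (q \<cdot> \<tau>) = (p \<circ>\<^sub>i q) \<cdot> (id \<circ>\<^sub>i \<tau>)\<close>.
  Input \<open>j \<noteq> i\<close> of \<open>p\<close> becomes input \<open>shift n i j\<close> of \<open>p \<circ>\<^sub>i q\<close>, and input \<open>r\<close> of \<open>q\<close> becomes input
  \<open>i + r\<close>.
\<close>

definition shift :: "nat \<Rightarrow> nat \<Rightarrow> nat \<Rightarrow> nat" where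
  "shift n i j = (if j < i then j else j + n - 1)"

definition outer_perm :: "nat \<Rightarrow> nat \<Rightarrow> nat \<Rightarrow> (nat \<Rightarrow> nat) \<Rightarrow> nat \<Rightarrow> nat" where
  "outer_perm m n i \<sigma> l =
    (if l < i then shift n (\<sigma> i) (\<sigma> l)
     else if l < i + n then \<sigma> i + (l - i)
     else if l < m + n - 1 then shift n (\<sigma> i) (\<sigma> (l + 1 - n))
     else l)"

definition inner_perm :: "nat \<Rightarrow> nat \<Rightarrow> (nat \<Rightarrow> nat) \<Rightarrow> nat \<Rightarrow> nat" where
  "inner_perm n i \<tau> l = (if i \<le> l \<and> l < i + n then i + \<tau> (l - i) else l)"

locale operad =
  fixes P :: "('k::field, 'v) operad_struct"
  assumes module: "sn_module n (ops P n)"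
    and unit_closed: "unit P \<in> carr (ops P 1)"
    and pcomp_closed: "\<lbrakk>i < m; p \<in> carr (ops P m); q \<in> carr (ops P n)\<rbrakk>
          \<Longrightarrow> pcomp P m n i p q \<in> carr (ops P (m + n - 1))"
    and pcomp_add_left: "\<lbrakk>i < m; p \<in> carr (ops P m); p' \<in> carr (ops P m); q \<in> carr (ops P n)\<rbrakk>
          \<Longrightarrow> pcomp P m n i (vadd (ops P m) p p') q =
              vadd (ops P (m + n - 1)) (pcomp P m n i p q) (pcomp P m n i p' q)"
    and pcomp_scale_left: "\<lbrakk>i < m; p \<in> carr (ops P m); q \<in> carr (ops P n)\<rbrakk>
          \<Longrightarrow> pcomp P m n i (vscale (ops P m) c p) q =
              vscale (ops P (m + n - 1)) c (pcomp P m n i p q)"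
    and pcomp_add_right: "\<lbrakk>i < m; p \<in> carr (ops P m); q \<in> carr (ops P n); q' \<in> carr (ops P n)\<rbrakk>
          \<Longrightarrow> pcomp P m n i p (vadd (ops P n) q q') =
              vadd (ops P (m + n - 1)) (pcomp P m n i p q) (pcomp P m n i p q')"
    and pcomp_scale_right: "\<lbrakk>i < m; p \<in> carr (ops P m); q \<in> carr (ops P n)\<rbrakk>
          \<Longrightarrow> pcomp P m n i p (vscale (ops P n) c q) =
              vscale (ops P (m + n - 1)) c (pcomp P m n i p q)"
    and pcomp_unit_right: "\<lbrakk>i < m; p \<in> carr (ops P m)\<rbrakk> \<Longrightarrow> pcomp P m 1 i p (unit P) = p"
    and pcomp_unit_left: "p \<in> carr (ops P m) \<Longrightarrow> pcomp P 1 m 0 (unit P) p = p"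
    and pcomp_sequential:
      "\<lbrakk>i < m; j < n; p \<in> carr (ops P m); q \<in> carr (ops P n); r \<in> carr (ops P k)\<rbrakk>
          \<Longrightarrow> pcomp P (m + n - 1) k (i + j) (pcomp P m n i p q) r =
              pcomp P m (n + k - 1) i p (pcomp P n k j q r)"
    and pcomp_parallel:
      "\<lbrakk>i < j; j < m; p \<in> carr (ops P m); q \<in> carr (ops P n); r \<in> carr (ops P k)\<rbrakk>
          \<Longrightarrow> pcomp P (m + n - 1) k (j + n - 1) (pcomp P m n i p q) r =
              pcomp P (m + k - 1) n i (pcomp P m k j p r) q"
    and pcomp_act_left:
      "\<lbrakk>i < m; \<sigma> permutes {..<m}; p \<in> carr (ops P m); q \<in> carr (ops P n)\<rbrakk>
          \<Longrightarrow> pcomp P m n i (vact (ops P m) \<sigma> p) q =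
              vact (ops P (m + n - 1)) (outer_perm m n i \<sigma>) (pcomp P m n (\<sigma> i) p q)"
    and pcomp_act_right:
      "\<lbrakk>i < m; \<tau> permutes {..<n}; p \<in> carr (ops P m); q \<in> carr (ops P n)\<rbrakk>
          \<Longrightarrow> pcomp P m n i p (vact (ops P n) \<tau> q) =
              vact (ops P (m + n - 1)) (inner_perm n i \<tau>) (pcomp P m n i p q)"

definition operad_iso ::
  "('k::field, 'v) operad_struct \<Rightarrow> ('k, 'w) operad_struct \<Rightarrow> (nat \<Rightarrow> 'v \<Rightarrow> 'w) \<Rightarrow> bool" where
  "operad_iso P Q \<phi> \<longleftrightarrow> operad P \<and> operad Q \<and>
    (\<forall>n. bij_betw (\<phi> n) (carr (ops P n)) (carr (ops Q n))) \<and>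
    (\<forall>n. \<forall>x\<in>carr (ops P n). \<forall>y\<in>carr (ops P n).
      \<phi> n (vadd (ops P n) x y) = vadd (ops Q n) (\<phi> n x) (\<phi> n y)) \<and>
    (\<forall>n c. \<forall>x\<in>carr (ops P n). \<phi> n (vscale (ops P n) c x) = vscale (ops Q n) c (\<phi> n x)) \<and>
    (\<forall>n \<sigma>. \<forall>x\<in>carr (ops P n). \<sigma> permutes {..<n} \<longrightarrow>
      \<phi> n (vact (ops P n) \<sigma> x) = vact (ops Q n) \<sigma> (\<phi> n x)) \<and>
    \<phi> 1 (unit P) = unit Q \<and>
    (\<forall>m n i. \<forall>p\<in>carr (ops P m). \<forall>q\<in>carr (ops P n). i < m \<longrightarrow>
      \<phi> (m + n - 1) (pcomp P m n i p q) = pcomp Q m n i (\<phi> m p) (\<phi> n q))"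

text \<open>The composite \<open>p \<circ> (q, r)\<close> for \<open>p \<in> P(2)\<close>, \<open>q \<in> P(a)\<close>, \<open>r \<in> P(b)\<close>.\<close>

definition bicomp :: "('k, 'v) operad_struct \<Rightarrow> nat \<Rightarrow> nat \<Rightarrow> 'v \<Rightarrow> 'v \<Rightarrow> 'v \<Rightarrow> 'v" where
  "bicomp P a b p q r = pcomp P (b + 1) a 0 (pcomp P 2 b 1 p r) q"

subsection \<open>Ideals and quotients\<close>

inductive operad_ideal :: "('k::field, 'v) operad_struct \<Rightarrow> (nat \<Rightarrow> 'v set) \<Rightarrow> nat \<Rightarrow> 'v \<Rightarrow> bool"
  for P :: "('k, 'v) operad_struct" and R :: "nat \<Rightarrow> 'v set" where
  base: "x \<in> R n \<Longrightarrow> operad_ideal P R n x"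
| zero: "operad_ideal P R n (vzero (ops P n))"
| add: "\<lbrakk>operad_ideal P R n x; operad_ideal P R n y\<rbrakk> \<Longrightarrow> operad_ideal P R n (vadd (ops P n) x y)"
| scale: "operad_ideal P R n x \<Longrightarrow> operad_ideal P R n (vscale (ops P n) c x)"
| act: "\<lbrakk>\<sigma> permutes {..<n}; operad_ideal P R n x\<rbrakk> \<Longrightarrow> operad_ideal P R n (vact (ops P n) \<sigma> x)"
| left: "\<lbrakk>i < m; operad_ideal P R m x; q \<in> carr (ops P n)\<rbrakk>
    \<Longrightarrow> operad_ideal P R (m + n - 1) (pcomp P m n i x q)"
| right: "\<lbrakk>i < m; p \<in> carr (ops P m); operad_ideal P R n x\<rbrakk>
    \<Longrightarrow> operad_ideal P R (m + n - 1) (pcomp P m n i p x)"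

definition coset :: "('k::field, 'v) operad_struct \<Rightarrow> (nat \<Rightarrow> 'v \<Rightarrow> bool) \<Rightarrow> nat \<Rightarrow> 'v \<Rightarrow> 'v set" where
  "coset P J n x = {y \<in> carr (ops P n). J n (vminus (ops P n) y x)}"

definition rep :: "'v set \<Rightarrow> 'v" where
  "rep X = (SOME x. x \<in> X)"

definition quotient_operad ::
  "('k::field, 'v) operad_struct \<Rightarrow> (nat \<Rightarrow> 'v \<Rightarrow> bool) \<Rightarrow> ('k, 'v set) operad_struct" where
  "quotient_operad P J =
    \<lparr>ops = (\<lambda>n.
      \<lparr>carr = coset P J n ` carr (ops P n),
       vzero = coset P J n (vzero (ops P n)),
       vadd = (\<lambda>X Y. coset P J n (vadd (ops P n) (rep X) (rep Y))),
       vscale = (\<lambda>c X. coset P J n (vscale (ops P n) c (rep X))),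
       vact = (\<lambda>\<sigma> X. coset P J n (vact (ops P n) \<sigma> (rep X)))\<rparr>),
     unit = coset P J 1 (unit P),
     pcomp = (\<lambda>m n i X Y. coset P J (m + n - 1) (pcomp P m n i (rep X) (rep Y)))\<rparr>"

section \<open>The free operad on an \<open>S\<^sub>2\<close>-module\<close>

text \<open>
  Binary trees whose vertices carry operations of arity 2 and whose leaves carry the inputs. The tree
  \<open>Vertex \<mu> s t\<close> stands for \<open>\<mu>(s, t)\<close>, and \<open>Leaf 0\<close> is the unit.
\<close>

datatype 'v tree = Leaf nat | Vertex 'v "'v tree" "'v tree"

primrec leaves :: "'v tree \<Rightarrow> nat list" where
  "leaves (Leaf j) = [j]"
| "leaves (Vertex \<mu> s t) = leaves s @ leaves t"

primrec labels :: "'v tree \<Rightarrow> 'v set" where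
  "labels (Leaf j) = {}"
| "labels (Vertex \<mu> s t) = insert \<mu> (labels s \<union> labels t)"

definition trees :: "'v set \<Rightarrow> nat \<Rightarrow> 'v tree set" where
  "trees A n = {t. distinct (leaves t) \<and> set (leaves t) = {..<n} \<and> labels t \<subseteq> A}"

primrec subst :: "(nat \<Rightarrow> 'v tree) \<Rightarrow> 'v tree \<Rightarrow> 'v tree" where
  "subst f (Leaf j) = f j"
| "subst f (Vertex \<mu> s t) = Vertex \<mu> (subst f s) (subst f t)"

definition relabel :: "(nat \<Rightarrow> nat) \<Rightarrow> 'v tree \<Rightarrow> 'v tree" where
  "relabel h = subst (\<lambda>j. Leaf (h j))"

definition graft :: "nat \<Rightarrow> nat \<Rightarrow> 'v tree \<Rightarrow> 'v tree \<Rightarrow> 'v tree" where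
  "graft n i s t = subst (\<lambda>j. if j = i then relabel ((+) i) t else Leaf (shift n i j)) s"

text \<open>
  The operad freely generated by the set \<open>A\<close> of binary operations. The right action is
  \<open>(p \<cdot> \<sigma>)(x\<^sub>0, \<dots>) = p(x\<^bsub>\<sigma>\<inverse>(0)\<^esub>, \<dots>)\<close>.
\<close>

definition tree_operad :: "'v set \<Rightarrow> ('k::field, 'v tree \<Rightarrow>\<^sub>0 'k) operad_struct" where
  "tree_operad A =
    \<lparr>ops = (\<lambda>n.
      \<lparr>carr = {p. Poly_Mapping.keys p \<subseteq> trees A n},
       vzero = 0,
       vadd = (+),
       vscale = pm_scale,
       vact = (\<lambda>\<sigma>. pm_extend (\<lambda>t. Poly_Mapping.single (relabel (inv \<sigma>) t) 1))\<rparr>),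
     unit = Poly_Mapping.single (Leaf 0) 1,
     pcomp = (\<lambda>m n i p q.
       pm_extend (\<lambda>s. pm_extend (\<lambda>t. Poly_Mapping.single (graft n i s t) 1) q) p)\<rparr>"

definition corolla :: "'v \<Rightarrow> ('v tree \<Rightarrow>\<^sub>0 'k::field)" where
  "corolla \<mu> = Poly_Mapping.single (Vertex \<mu> (Leaf 0) (Leaf 1)) 1"

text \<open>
  The free operad on the \<open>S\<^sub>2\<close>-module \<open>E\<close> (regarded as an \<open>S\<close>-module concentrated in arity 2) is the
  quotient of the operad freely generated by the underlying set of \<open>E\<close> by the ideal that makes
  \<open>corolla : E \<rightarrow> P(2)\<close> linear and \<open>S\<^sub>2\<close>-equivariant.
\<close>

definition free_relations :: "('k::field, 'v) sn_mod \<Rightarrow> nat \<Rightarrow> ('v tree \<Rightarrow>\<^sub>0 'k) set" where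
  "free_relations E n = (if n = 2 then
      {corolla (vadd E \<mu> \<nu>) - (corolla \<mu> + corolla \<nu>) | \<mu> \<nu>. \<mu> \<in> carr E \<and> \<nu> \<in> carr E}
    \<union> {corolla (vscale E c \<mu>) - pm_scale c (corolla \<mu>) | c \<mu>. \<mu> \<in> carr E}
    \<union> {corolla (vact E \<sigma> \<mu>) - vact (ops (tree_operad (carr E)) 2) \<sigma> (corolla \<mu>) | \<sigma> \<mu>.
         \<sigma> permutes {..<2} \<and> \<mu> \<in> carr E}
    else {})"

definition free_ideal :: "('k::field, 'v) sn_mod \<Rightarrow> nat \<Rightarrow> ('v tree \<Rightarrow>\<^sub>0 'k) \<Rightarrow> bool" where
  "free_ideal E = operad_ideal (tree_operad (carr E)) (free_relations E)"

definition free_operad :: "('k::field, 'v) sn_mod \<Rightarrow> ('k, ('v tree \<Rightarrow>\<^sub>0 'k) set) operad_struct" where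
  "free_operad E = quotient_operad (tree_operad (carr E)) (free_ideal E)"

definition free_incl :: "('k::field, 'v) sn_mod \<Rightarrow> 'v \<Rightarrow> ('v tree \<Rightarrow>\<^sub>0 'k) set" where
  "free_incl E \<mu> = coset (tree_operad (carr E)) (free_ideal E) 2 (corolla \<mu>)"

section \<open>Binary quadratic operads and Koszul duals\<close>

definition quadratic_ideal ::
  "('k::field, 'v) sn_mod \<Rightarrow> ('v tree \<Rightarrow>\<^sub>0 'k) set set \<Rightarrow> nat \<Rightarrow> ('v tree \<Rightarrow>\<^sub>0 'k) set \<Rightarrow> bool" where
  "quadratic_ideal E R = operad_ideal (free_operad E) (\<lambda>n. if n = 3 then R else {})"

definition quadratic_operad ::
  "('k::field, 'v) sn_mod \<Rightarrow> ('v tree \<Rightarrow>\<^sub>0 'k) set set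
    \<Rightarrow> ('k, ('v tree \<Rightarrow>\<^sub>0 'k) set set) operad_struct" where
  "quadratic_operad E R = quotient_operad (free_operad E) (quadratic_ideal E R)"

text \<open>The image of \<open>\<mu> \<in> E\<close> in the quadratic operad.\<close>

definition quadratic_incl ::
  "('k::field, 'v) sn_mod \<Rightarrow> ('v tree \<Rightarrow>\<^sub>0 'k) set set \<Rightarrow> 'v \<Rightarrow> ('v tree \<Rightarrow>\<^sub>0 'k) set set" where
  "quadratic_incl E R \<mu> = coset (free_operad E) (quadratic_ideal E R) 2 (free_incl E \<mu>)"

text \<open>
  The pairing between \<open>P\<^bsub>E\<^sup>!\<^esub>(3) = P\<^sub>E(3)\<^sup>!\<close> and \<open>P\<^sub>E(3)\<close>. As an \<open>S\<^sub>3\<close>-module, \<open>P\<^sub>E(3)\<close> is induced from the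
  \<open>S\<^sub>2\<close>-module \<open>E \<otimes> E = {\<mu> \<circ> (\<nu>, I)}\<close>, where \<open>S\<^sub>2\<close> acts through \<open>\<nu>\<close>. The pairing is the bilinear form
  with \<open>\<langle>x \<cdot> \<sigma>, y \<cdot> \<sigma>\<rangle> = sign \<sigma> \<langle>x, y\<rangle>\<close> and \<open>\<langle>f \<circ> (g, I), \<mu> \<circ> (\<nu>, I)\<rangle> = f(\<mu>) g(\<nu>)\<close>, which vanishes on
  elements lying in distinct summands of \<open>P\<^sub>E(3) = \<Oplus> (E \<otimes> E) \<cdot> \<sigma>\<close>, the sum being over \<open>S\<^sub>2\<backslash>S\<^sub>3\<close>.
  In particular \<open>\<langle>f \<circ> (I, g), \<mu> \<circ> (I, \<nu>)\<rangle> = - f(\<mu>) g(\<nu>)\<close>.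

  To evaluate it, a tree with three leaves is first written as \<open>\<mu>(\<nu>(x\<^sub>a, x\<^sub>b), x\<^sub>c)\<close>, using
  \<open>\<mu>(x\<^sub>c, \<nu>(x\<^sub>a, x\<^sub>b)) = (\<mu> \<cdot> (0 1))(\<nu>(x\<^sub>a, x\<^sub>b), x\<^sub>c)\<close>.
\<close>

fun left_comb :: "('k::field, 'v) sn_mod \<Rightarrow> 'v tree \<Rightarrow> 'v \<times> 'v \<times> nat \<times> nat \<times> nat" where
  "left_comb E (Vertex \<mu> (Vertex \<nu> (Leaf a) (Leaf b)) (Leaf c)) = (\<mu>, \<nu>, a, b, c)"
| "left_comb E (Vertex \<mu> (Leaf c) (Vertex \<nu> (Leaf a) (Leaf b))) =
     (vact E (transpose 0 1) \<mu>, \<nu>, a, b, c)"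
| "left_comb E _ = undefined"

definition tree_pairing ::
  "('k::field, 'v) sn_mod \<Rightarrow> ('v \<Rightarrow> 'k) tree \<Rightarrow> 'v tree \<Rightarrow> 'k" where
  "tree_pairing E s t =
    (let (f, g, a, b, c) = left_comb (sn_dual 2 E) s;
         (\<mu>, \<nu>, a', b', c') = left_comb E t
     in if c \<noteq> c' then 0
        else of_int (sign (\<lambda>i. if i < 3 then [a, b, c] ! i else i)) * f \<mu> *
             g (if a = a' then \<nu> else vact E (transpose 0 1) \<nu>))"

definition pairing ::
  "('k::field, 'v) sn_mod \<Rightarrow> (('v \<Rightarrow> 'k) tree \<Rightarrow>\<^sub>0 'k) set \<Rightarrow> ('v tree \<Rightarrow>\<^sub>0 'k) set \<Rightarrow> 'k" where
  "pairing E X Y =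
    (\<Sum>s\<in>Poly_Mapping.keys (rep X). \<Sum>t\<in>Poly_Mapping.keys (rep Y).
      Poly_Mapping.lookup (rep X) s * Poly_Mapping.lookup (rep Y) t * tree_pairing E s t)"

definition annihilator ::
  "('k::field, 'v) sn_mod \<Rightarrow> ('v tree \<Rightarrow>\<^sub>0 'k) set set \<Rightarrow> (('v \<Rightarrow> 'k) tree \<Rightarrow>\<^sub>0 'k) set set" where
  "annihilator E R =
    {X \<in> carr (ops (free_operad (sn_dual 2 E)) 3). \<forall>Y\<in>R. pairing E X Y = 0}"

text \<open>The Koszul dual of \<open>quadratic_operad E R\<close>.\<close>

definition koszul_dual ::
  "('k::field, 'v) sn_mod \<Rightarrow> ('v tree \<Rightarrow>\<^sub>0 'k) set set
    \<Rightarrow> ('k, (('v \<Rightarrow> 'k) tree \<Rightarrow>\<^sub>0 'k) set set) operad_struct" where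
  "koszul_dual E R = quadratic_operad (sn_dual 2 E) (annihilator E R)"

section \<open>The bigraft operad\<close>

datatype gen = M | Succ | Prec

type_synonym 'k gen_vec = "gen \<times> (nat \<Rightarrow> nat) \<Rightarrow>\<^sub>0 'k"

definition bg_E :: "('k::field, 'k gen_vec) sn_mod" where
  "bg_E = free_sn 2"

definition gen_op :: "gen \<Rightarrow> ('k::field gen_vec tree \<Rightarrow>\<^sub>0 'k) set" where
  "gen_op g = free_incl bg_E (free_gen g)"

definition compL :: "gen \<Rightarrow> gen \<Rightarrow> ('k::field gen_vec tree \<Rightarrow>\<^sub>0 'k) set" where
  "compL g h = bicomp (free_operad bg_E) 2 1 (gen_op g) (gen_op h) (unit (free_operad bg_E))"

definition compR :: "gen \<Rightarrow> gen \<Rightarrow> ('k::field gen_vec tree \<Rightarrow>\<^sub>0 'k) set" where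
  "compR g h = bicomp (free_operad bg_E) 1 2 (gen_op g) (unit (free_operad bg_E)) (gen_op h)"

text \<open>\<open>g\<^sub>1 \<circ> (h\<^sub>1, I) - g\<^sub>2 \<circ> (I, h\<^sub>2)\<close>\<close>

definition comp_diff :: "gen \<Rightarrow> gen \<Rightarrow> gen \<Rightarrow> gen \<Rightarrow> ('k::field gen_vec tree \<Rightarrow>\<^sub>0 'k) set" where
  "comp_diff g\<^sub>1 h\<^sub>1 g\<^sub>2 h\<^sub>2 = vminus (ops (free_operad bg_E) 3) (compL g\<^sub>1 h\<^sub>1) (compR g\<^sub>2 h\<^sub>2)"

definition bg_relations :: "('k::field gen_vec tree \<Rightarrow>\<^sub>0 'k) set set" where
  "bg_relations = sn_span 3 (ops (free_operad bg_E) 3)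
    {comp_diff Succ M Succ Succ,
     comp_diff M Succ Succ M,
     comp_diff Prec Prec Prec M,
     comp_diff Prec M M Prec,
     comp_diff Prec Succ Succ Prec,
     comp_diff M M M M}"

definition bigraft :: "('k::field, ('k gen_vec tree \<Rightarrow>\<^sub>0 'k) set set) operad_struct" where
  "bigraft = quadratic_operad bg_E bg_relations"

definition bigraft_dual ::
  "('k::field, (('k gen_vec \<Rightarrow> 'k) tree \<Rightarrow>\<^sub>0 'k) set set) operad_struct" where
  "bigraft_dual = koszul_dual bg_E bg_relations"

definition dual_relations :: "('k::field gen_vec tree \<Rightarrow>\<^sub>0 'k) set set" where
  "dual_relations = sn_span 3 (ops (free_operad bg_E) 3)
    {comp_diff Succ M Succ Succ,        compL Succ Succ,
     comp_diff M Succ Succ M,           compL Succ Prec,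
     comp_diff Prec Prec Prec M,        compL M Prec,
     comp_diff Prec M M Prec,           compR Prec Prec,
     comp_diff Prec Succ Succ Prec,     compR Prec Succ,
     comp_diff M M M M,                 compR M Succ}"

text \<open>The linear form on \<open>E\<close> dual to the generator \<open>g\<close> in the basis \<open>g \<cdot> \<sigma>\<close> of \<open>E\<close>.\<close>

definition dual_gen :: "gen \<Rightarrow> ('k::field gen_vec \<Rightarrow> 'k)" where
  "dual_gen g = (\<lambda>x\<in>carr bg_E. Poly_Mapping.lookup x (g, id))"

section \<open>Quadratic operads are operads\<close>

subsection \<open>Formal linear combinations\<close>

lemma lookup_pm_scale [simp]:
  "Poly_Mapping.lookup (pm_scale c p) a = c * Poly_Mapping.lookup p a"
  unfolding pm_scale_def by (transfer) (simp add: when_def)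

lemma pm_scale_simps [simp]:
  "pm_scale c 0 = 0" "pm_scale 0 p = 0" "pm_scale 1 p = p"
  "pm_scale c (pm_scale d p) = pm_scale (c * d) p"
  "pm_scale c (Poly_Mapping.single a d) = Poly_Mapping.single a (c * d)"
  by (rule poly_mapping_eqI; simp add: lookup_single when_def)+

lemma pm_scale_add: "pm_scale c (p + q) = pm_scale c p + pm_scale c q"
  "pm_scale (c + d) p = pm_scale c p + pm_scale d p"
  by (rule poly_mapping_eqI; simp add: lookup_add algebra_simps)+

lemma pm_scale_uminus: "pm_scale (- 1) p = - p"
  by (rule poly_mapping_eqI) simp

lemma pm_scale_sum: "pm_scale c (sum f A) = (\<Sum>a\<in>A. pm_scale c (f a))"
  by (induction A rule: infinite_finite_induct) (auto simp: pm_scale_add)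

lemma keys_pm_scale: "Poly_Mapping.keys (pm_scale c p) \<subseteq> Poly_Mapping.keys p"
  by (auto simp: in_keys_iff)

lemma pm_extend_superset:
  assumes "finite A" "Poly_Mapping.keys p \<subseteq> A"
  shows "pm_extend f p = (\<Sum>a\<in>A. pm_scale (Poly_Mapping.lookup p a) (f a))"
  unfolding pm_extend_def by (rule sum.mono_neutral_left) (use assms in \<open>auto simp: in_keys_iff\<close>)

lemma pm_extend_zero [simp]: "pm_extend f 0 = 0"
  by (simp add: pm_extend_def)

lemma pm_extend_add: "pm_extend f (p + q) = pm_extend f p + pm_extend f q"
proof -
  let ?A = "Poly_Mapping.keys p \<union> Poly_Mapping.keys q"
  have "Poly_Mapping.keys (p + q) \<subseteq> ?A" by (rule keys_add)
  then show ?thesis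
    by (simp add: pm_extend_superset[of ?A] lookup_add pm_scale_add sum.distrib)
qed

lemma pm_extend_scale: "pm_extend f (pm_scale c p) = pm_scale c (pm_extend f p)"
  using keys_pm_scale[of c p]
  by (simp add: pm_extend_superset[of "Poly_Mapping.keys p"] pm_scale_sum)

lemma pm_extend_sum: "pm_extend f (sum g A) = (\<Sum>a\<in>A. pm_extend f (g a))"
  by (induction A rule: infinite_finite_induct) (auto simp: pm_extend_add)

lemma pm_extend_single [simp]: "pm_extend f (Poly_Mapping.single a c) = pm_scale c (f a)"
  by (simp add: pm_extend_superset[of "{a}"])

lemma pm_extend_extend: "pm_extend f (pm_extend g p) = pm_extend (\<lambda>a. pm_extend f (g a)) p"
  by (simp add: pm_extend_def[of g] pm_extend_def[of "\<lambda>a. pm_extend f (g a)"]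
      pm_extend_sum pm_extend_scale)

lemma pm_extend_cong:
  "p = q \<Longrightarrow> (\<And>a. a \<in> Poly_Mapping.keys q \<Longrightarrow> f a = g a) \<Longrightarrow> pm_extend f p = pm_extend g q"
  unfolding pm_extend_def by (auto intro: sum.cong)

lemma pm_extend_fun_add:
  "pm_extend (\<lambda>a. f a + g a) p = pm_extend f p + pm_extend g p"
  by (simp add: pm_extend_def pm_scale_add sum.distrib)

lemma pm_extend_fun_scale: "pm_extend (\<lambda>a. pm_scale c (f a)) p = pm_scale c (pm_extend f p)"
  by (simp add: pm_extend_def pm_scale_sum mult.commute)

lemma pm_extend_swap:
  "pm_extend (\<lambda>s. pm_extend (f s) q) p = pm_extend (\<lambda>t. pm_extend (\<lambda>s. f s t) p) q"
  by (simp add: pm_extend_def pm_scale_sum mult.commute) (rule sum.swap)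

lemma pm_extend_id: "pm_extend (\<lambda>a. Poly_Mapping.single a 1) p = p"
  by (rule poly_mapping_eqI)
     (simp add: pm_extend_def lookup_sum lookup_single when_def in_keys_iff)

lemma keys_pm_extend:
  "Poly_Mapping.keys (pm_extend f p) \<subseteq> (\<Union>a\<in>Poly_Mapping.keys p. Poly_Mapping.keys (f a))"
proof
  fix b assume "b \<in> Poly_Mapping.keys (pm_extend f p)"
  then have "(\<Sum>a\<in>Poly_Mapping.keys p. Poly_Mapping.lookup p a * Poly_Mapping.lookup (f a) b) \<noteq> 0"
    by (simp add: pm_extend_def in_keys_iff lookup_sum)
  then obtain a where "a \<in> Poly_Mapping.keys p" "Poly_Mapping.lookup (f a) b \<noteq> 0"
    by (metis (no_types, lifting) mult_zero_right sum.neutral)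
  then show "b \<in> (\<Union>a\<in>Poly_Mapping.keys p. Poly_Mapping.keys (f a))"
    by (auto simp: in_keys_iff)
qed

lemma keys_pm_extend_singles:
  "(\<And>a. a \<in> Poly_Mapping.keys p \<Longrightarrow> h a \<in> B) \<Longrightarrow>
   Poly_Mapping.keys (pm_extend (\<lambda>a. Poly_Mapping.single (h a) 1) p) \<subseteq> B"
  using keys_pm_extend[of "\<lambda>a. Poly_Mapping.single (h a) 1" p] by fastforce

subsection \<open>Trees\<close>

lemma subst_subst: "subst f (subst g t) = subst (\<lambda>j. subst f (g j)) t"
  by (induction t) auto

lemma subst_cong: "(\<And>j. j \<in> set (leaves t) \<Longrightarrow> f j = g j) \<Longrightarrow> subst f t = subst g t"
  by (induction t) auto

lemma subst_Leaf [simp]: "subst Leaf t = t"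
  by (induction t) auto

lemma leaves_subst: "leaves (subst f t) = concat (map (\<lambda>j. leaves (f j)) (leaves t))"
  by (induction t) auto

lemma labels_subst: "labels (subst f t) = labels t \<union> (\<Union>j\<in>set (leaves t). labels (f j))"
  by (induction t) auto

lemma relabel_trees: "t \<in> trees A n \<Longrightarrow> h permutes {..<n} \<Longrightarrow> relabel h t \<in> trees A n"
proof -
  assume t: "t \<in> trees A n" and h: "h permutes {..<n}"
  have l: "leaves (relabel h t) = map h (leaves t)"
    by (simp add: relabel_def leaves_subst concat_map_singleton)
  then show ?thesis
    using t h permutes_inj[OF h] permutes_image[OF h]
    by (auto simp: trees_def distinct_map relabel_def labels_subst intro: inj_on_subset)
qed

lemma distinct_concat_map:
  assumes "distinct xs" "\<And>x. x \<in> set xs \<Longrightarrow> distinct (f x)"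
    "\<And>x y. x \<in> set xs \<Longrightarrow> y \<in> set xs \<Longrightarrow> x \<noteq> y \<Longrightarrow> set (f x) \<inter> set (f y) = {}"
  shows "distinct (concat (map f xs))"
  using assms by (induction xs) (auto; blast)+

lemma graft_trees:
  assumes "i < m" "s \<in> trees A m" "t \<in> trees A n"
  shows "graft n i s t \<in> trees A (m + n - 1)"
proof -
  let ?f = "\<lambda>j. if j = i then relabel ((+) i) t else Leaf (shift n i j)"
  have lt: "leaves (relabel ((+) i) t) = map ((+) i) (leaves t)"
    by (simp add: relabel_def leaves_subst concat_map_singleton)
  have sets: "set (leaves (?f j)) = (if j = i then {i..<i + n} else {shift n i j})" for j
    using assms(3) image_add_atLeastLessThan[of i 0 n]
    by (auto simp: lt trees_def lessThan_atLeast0 add.commute simp del: image_add_atLeastLessThan)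
  have "distinct (leaves (graft n i s t))"
    unfolding graft_def leaves_subst
  proof (rule distinct_concat_map)
    show "distinct (leaves s)" using assms by (simp add: trees_def)
    show "distinct (leaves (?f x))" for x
      using assms(3) by (auto simp: lt trees_def distinct_map)
    show "set (leaves (?f x)) \<inter> set (leaves (?f y)) = {}" if "x \<noteq> y" for x y
      unfolding sets using that by (auto simp: shift_def split: if_splits)
  qed
  moreover have "set (leaves (graft n i s t)) = {..<m + n - 1}"
  proof -
    have "set (leaves (graft n i s t)) = (\<Union>j<m. set (leaves (?f j)))"
      using assms(2) by (simp add: graft_def leaves_subst trees_def)
    also have "\<dots> = {..<m + n - 1}"
      unfolding sets
    proof (intro equalityI subsetI)
      fix l assume l: "l \<in> {..<m + n - 1}"
      have "l < i \<or> (i \<le> l \<and> l < i + n) \<or> i + n \<le> l" by auto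
      then show "l \<in> (\<Union>j<m. if j = i then {i..<i + n} else {shift n i j})"
      proof (elim disjE)
        assume "l < i" then show ?thesis using assms(1) by (auto simp: shift_def intro!: bexI[of _ l])
      next
        assume "i \<le> l \<and> l < i + n" then show ?thesis using assms(1) by (auto intro!: bexI[of _ i])
      next
        assume "i + n \<le> l" then show ?thesis using assms(1) l
          by (auto simp: shift_def intro!: bexI[of _ "l + 1 - n"])
      qed
    qed (use assms(1) in \<open>auto simp: shift_def split: if_splits\<close>)
    finally show ?thesis .
  qed
  moreover have "labels (graft n i s t) \<subseteq> A"
    using assms by (auto simp: graft_def labels_subst trees_def relabel_def split: if_splits)
  ultimately show ?thesis by (simp add: trees_def)
qed

lemma relabel_Leaf [simp]: "relabel h (Leaf j) = Leaf (h j)"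
  by (simp add: relabel_def)

lemma relabel_relabel: "relabel h (relabel k t) = relabel (h \<circ> k) t"
  by (simp add: relabel_def subst_subst)

lemma relabel_subst: "relabel h (subst f t) = subst (\<lambda>j. relabel h (f j)) t"
  by (simp add: relabel_def subst_subst)

lemma subst_relabel: "subst f (relabel h t) = subst (\<lambda>j. f (h j)) t"
  by (simp add: relabel_def subst_subst)

lemma relabel_cong: "(\<And>j. j \<in> set (leaves t) \<Longrightarrow> f j = g j) \<Longrightarrow> relabel f t = relabel g t"
  unfolding relabel_def by (rule subst_cong) auto

lemma relabel_ident: "(\<And>j. j \<in> set (leaves t) \<Longrightarrow> f j = j) \<Longrightarrow> relabel f t = t"
  using relabel_cong[of t f id] by (simp add: relabel_def)

lemma leaves_trees: "t \<in> trees A n \<Longrightarrow> j \<in> set (leaves t) \<longleftrightarrow> j < n"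
  by (auto simp: trees_def)

lemma graft_unit_right: "graft (Suc 0) i s (Leaf 0) = s"
proof -
  have "graft 1 i s (Leaf 0) = subst Leaf s"
    unfolding graft_def by (rule subst_cong) (auto simp: shift_def)
  then show ?thesis by simp
qed

lemma graft_unit_left: "graft m 0 (Leaf 0) t = t"
  by (simp add: graft_def relabel_ident)

lemma graft_sequential:
  assumes "i < m" "j < n" "s \<in> trees A m" "t \<in> trees A n"
  shows "graft k (i + j) (graft n i s t) u = graft (n + k - 1) i s (graft k j t u)"
proof -
  have "subst (\<lambda>l. if l = i + j then relabel ((+) (i + j)) u else Leaf (shift k (i + j) l))
          (relabel ((+) i) t) =
        relabel ((+) i) (subst (\<lambda>l. if l = j then relabel ((+) j) u else Leaf (shift k j l)) t)"
    unfolding subst_relabel relabel_subst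
    by (rule subst_cong)
       (auto simp: relabel_relabel shift_def comp_def add.assoc[symmetric] intro!: relabel_cong)
  then show ?thesis
    unfolding graft_def subst_subst
    by (intro subst_cong) (use assms in \<open>auto simp: shift_def\<close>)
qed

lemma graft_parallel:
  assumes "i < j" "j < m" "s \<in> trees A m" "t \<in> trees A n"
  shows "graft k (j + n - 1) (graft n i s t) u = graft n i (graft k j s u) t"
proof -
  have 1: "subst (\<lambda>l. if l = j + n - 1 then relabel ((+) (j + n - 1)) u
                 else Leaf (shift k (j + n - 1) l)) (relabel ((+) i) t) = relabel ((+) i) t"
    unfolding subst_relabel unfolding relabel_def
    by (rule subst_cong) (use assms in \<open>auto simp: shift_def leaves_trees\<close>)
  have 2: "subst (\<lambda>l. if l = i then relabel ((+) i) t else Leaf (shift n i l))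
             (relabel ((+) j) u) = relabel ((+) (j + n - 1)) u"
    unfolding subst_relabel unfolding relabel_def
    by (rule subst_cong) (use assms in \<open>auto simp: shift_def\<close>)
  show ?thesis
    unfolding graft_def subst_subst
    apply (intro subst_cong)
    using assms 1 2 by (auto simp: shift_def)
qed

lemma inv_permutes_eq: "\<sigma> permutes S \<Longrightarrow> inv \<sigma> x = y \<longleftrightarrow> x = \<sigma> y"
  by (metis permutes_inverses)

lemma outer_perm_bij:
  assumes "i < m" "\<sigma> permutes {..<m}"
  shows "outer_perm m n i \<sigma> permutes {..<m + n - 1}"
    and "j \<noteq> \<sigma> i \<Longrightarrow> j < m \<Longrightarrow>
      outer_perm m n i \<sigma> (shift n i (inv \<sigma> j)) = shift n (\<sigma> i) j"
    and "r < n \<Longrightarrow> outer_perm m n i \<sigma> (i + r) = \<sigma> i + r"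
proof -
  have lt: "\<sigma> x < m \<longleftrightarrow> x < m" for x
    using permutes_in_image[OF assms(2)] by simp
  have inj: "\<sigma> x = \<sigma> y \<longleftrightarrow> x = y" for x y
    using permutes_inj[OF assms(2)] by (simp add: inj_eq)
  have A: "outer_perm m n i \<sigma> (shift n i x) = shift n (\<sigma> i) (\<sigma> x)" if "x \<noteq> i" "x < m" for x
    using that assms(1) by (auto simp: outer_perm_def shift_def)
  show B: "r < n \<Longrightarrow> outer_perm m n i \<sigma> (i + r) = \<sigma> i + r" for r
    by (auto simp: outer_perm_def)
  show "outer_perm m n i \<sigma> (shift n i (inv \<sigma> j)) = shift n (\<sigma> i) j" if "j \<noteq> \<sigma> i" "j < m"
    using A[of "inv \<sigma> j"] that permutes_inverses[OF assms(2)] lt by (metis)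
  have cov: "(\<exists>x. x \<noteq> k \<and> x < m \<and> l = shift n k x) \<or> (\<exists>r<n. l = k + r)"
    if "l < m + n - 1" "k < m" for k l
  proof -
    have "l < k \<or> (k \<le> l \<and> l < k + n) \<or> k + n \<le> l" by auto
    then show ?thesis
    proof (elim disjE)
      assume "l < k" then show ?thesis using that by (auto simp: shift_def intro!: exI[of _ l])
    next
      assume "k \<le> l \<and> l < k + n"
      then have "l - k < n" "l = k + (l - k)" by auto
      then show ?thesis by blast
    next
      assume "k + n \<le> l" then show ?thesis using that
        by (intro disjI1 exI[of _ "l + 1 - n"]) (auto simp: shift_def)
    qed
  qed
  have sur: "{..<m + n - 1} \<subseteq> outer_perm m n i \<sigma> ` {..<m + n - 1}"
  proof
    fix l assume "l \<in> {..<m + n - 1}"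
    with cov[of l "\<sigma> i"] assms(1) lt
    consider x where "x \<noteq> \<sigma> i" "x < m" "l = shift n (\<sigma> i) x" | r where "r < n" "l = \<sigma> i + r"
      by fastforce
    then show "l \<in> outer_perm m n i \<sigma> ` {..<m + n - 1}"
    proof cases
      case 1
      define y where "y = inv \<sigma> x"
      have y: "x = \<sigma> y" "y < m" "y \<noteq> i"
        using 1 permutes_inverses[OF assms(2)] lt y_def by metis+
      moreover have "shift n i y < m + n - 1" using y assms(1) by (auto simp: shift_def)
      ultimately show ?thesis using A[of y] 1 by (metis imageI lessThan_iff)
    next
      case 2
      then show ?thesis using B[of r] assms(1) 
        by (intro image_eqI[of _ _ "i + r"]) auto
    qed
  qed
  have sub: "outer_perm m n i \<sigma> ` {..<m + n - 1} \<subseteq> {..<m + n - 1}"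
  proof (clarsimp)
    fix l assume "l < m + n - Suc 0"
    with cov[of l i] assms(1)
    consider x where "x \<noteq> i" "x < m" "l = shift n i x" | r where "r < n" "l = i + r"
      by fastforce
    then show "outer_perm m n i \<sigma> l < m + n - Suc 0"
    proof cases
      case 1
      then have "\<sigma> x \<noteq> \<sigma> i" "\<sigma> x < m" "\<sigma> i < m" using lt inj assms(1) by auto
      then show ?thesis using A[of x] 1 by (auto simp: shift_def)
    next
      case 2
      moreover have "\<sigma> i < m" using lt assms(1) by auto
      ultimately show ?thesis using B[of r] by auto
    qed
  qed
  show "outer_perm m n i \<sigma> permutes {..<m + n - 1}"
  proof (rule bij_imp_permutes)
    show "bij_betw (outer_perm m n i \<sigma>) {..<m + n - 1} {..<m + n - 1}"
      using sur sub by (simp add: bij_betw_def finite_surj_inj subset_antisym)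
    show "outer_perm m n i \<sigma> l = l" if "l \<notin> {..<m + n - 1}" for l
      using that assms(1) by (auto simp: outer_perm_def)
  qed
qed

lemma inner_perm_permutes:
  assumes "i < m" "\<tau> permutes {..<n}"
  shows "inner_perm n i \<tau> permutes {..<m + n - 1}"
proof (rule bij_imp_permutes)
  have lt: "\<tau> x < n \<longleftrightarrow> x < n" for x
    using permutes_in_image[OF assms(2)] by simp
  have inj: "\<tau> x = \<tau> y \<longleftrightarrow> x = y" for x y
    using permutes_inj[OF assms(2)] by (simp add: inj_eq)
  have sub: "inner_perm n i \<tau> ` {..<m + n - 1} \<subseteq> {..<m + n - 1}"
  proof (clarsimp)
    fix l assume "l < m + n - Suc 0"
    moreover have "\<tau> (l - i) < n" if "i \<le> l" "l < i + n" using that lt by auto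
    ultimately show "inner_perm n i \<tau> l < m + n - Suc 0"
      using assms(1) by (auto simp: inner_perm_def split: if_splits)
  qed
  moreover have "inj_on (inner_perm n i \<tau>) {..<m + n - 1}"
  proof (rule inj_onI)
    fix x y assume "inner_perm n i \<tau> x = inner_perm n i \<tau> y"
    moreover have "\<tau> (l - i) < n" if "i \<le> l" "l < i + n" for l using that lt by auto
    ultimately show "x = y"
      using inj[of "x - i" "y - i"] by (fastforce simp: inner_perm_def split: if_splits)
  qed
  ultimately show "bij_betw (inner_perm n i \<tau>) {..<m + n - 1} {..<m + n - 1}"
    by (simp add: bij_betw_def endo_inj_surj)
  show "inner_perm n i \<tau> l = l" if "l \<notin> {..<m + n - 1}" for l
    using that assms(1) by (auto simp: inner_perm_def)
qed

lemma graft_act_left: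
  assumes "i < m" "\<sigma> permutes {..<m}" "s \<in> trees A m" "t \<in> trees A n"
  shows "graft n i (relabel (inv \<sigma>) s) t =
    relabel (inv (outer_perm m n i \<sigma>)) (graft n (\<sigma> i) s t)"
  unfolding graft_def subst_relabel relabel_subst
proof (rule subst_cong)
  fix j assume "j \<in> set (leaves s)"
  then have j: "j < m" using assms by (simp add: leaves_trees)
  note P = outer_perm_bij[OF assms(1,2), where n = n]
  show "(if inv \<sigma> j = i then relabel ((+) i) t else Leaf (shift n i (inv \<sigma> j))) =
     relabel (inv (outer_perm m n i \<sigma>))
       (if j = \<sigma> i then relabel ((+) (\<sigma> i)) t else Leaf (shift n (\<sigma> i) j))"
  proof (cases "j = \<sigma> i")
    case True
    then show ?thesis using P(3) assms(4)
      by (auto simp: inv_permutes_eq[OF assms(2)] relabel_relabel leaves_trees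
          inv_permutes_eq[OF P(1)] intro!: relabel_cong sym[of "inv _ _"])
  next
    case False
    then show ?thesis using P(2)[OF False j]
      by (simp add: inv_permutes_eq[OF assms(2)] eq_commute[of "shift n i _"]
          inv_permutes_eq[OF P(1)])
  qed
qed

lemma graft_act_right:
  assumes "i < m" "\<tau> permutes {..<n}" "s \<in> trees A m" "t \<in> trees A n"
  shows "graft n i s (relabel (inv \<tau>) t) = relabel (inv (inner_perm n i \<tau>)) (graft n i s t)"
  unfolding graft_def relabel_subst
proof (rule subst_cong)
  fix j assume "j \<in> set (leaves s)"
  then have j: "j < m" using assms by (simp add: leaves_trees)
  have inv: "inv \<tau> x < n \<longleftrightarrow> x < n" for x
    using permutes_in_image[OF permutes_inv[OF assms(2)]] by simp
  note I = inv_permutes_eq[OF inner_perm_permutes[OF assms(1,2)]]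
  have "relabel ((+) i) (relabel (inv \<tau>) t) =
        relabel (inv (inner_perm n i \<tau>)) (relabel ((+) i) t)"
    unfolding relabel_relabel
    by (rule relabel_cong)
       (use assms(4) inv permutes_inverses[OF assms(2)] in
        \<open>auto simp: leaves_trees inner_perm_def I intro!: sym[of "inv _ _"]\<close>)
  then show "(if j = i then relabel ((+) i) (relabel (inv \<tau>) t) else Leaf (shift n i j)) =
    relabel (inv (inner_perm n i \<tau>)) (if j = i then relabel ((+) i) t else Leaf (shift n i j))"
    by (auto simp: inner_perm_def shift_def I intro!: sym[of "inv _ _"])
qed


subsection \<open>The tree operad\<close>

lemma relabel_trees_inv: "t \<in> trees A n \<Longrightarrow> \<sigma> permutes {..<n} \<Longrightarrow> relabel (inv \<sigma>) t \<in> trees A n"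
  by (simp add: relabel_trees permutes_inv)

lemma tree_operad_sel [simp]:
  "carr (ops (tree_operad A) n) = {p. Poly_Mapping.keys p \<subseteq> trees A n}"
  "vzero (ops (tree_operad A) n) = 0"
  "vadd (ops (tree_operad A) n) = (+)"
  "vscale (ops (tree_operad A) n) = pm_scale"
  "vact (ops (tree_operad A) n) \<sigma> =
     pm_extend (\<lambda>t. Poly_Mapping.single (relabel (inv \<sigma>) t) 1)"
  "unit (tree_operad A) = Poly_Mapping.single (Leaf 0) 1"
  "pcomp (tree_operad A) m n i p q =
     pm_extend (\<lambda>s. pm_extend (\<lambda>t. Poly_Mapping.single (graft n i s t) 1) q) p"
  by (simp_all add: tree_operad_def)

lemma operad_tree_operad: "operad (tree_operad A :: ('k::field, _) operad_struct)"
proof (rule operad.intro)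
  fix n
  show "sn_module n (ops (tree_operad A :: ('k, _) operad_struct) n)"
  proof
    fix x y :: "'a tree \<Rightarrow>\<^sub>0 'k" and c and \<sigma> :: "nat \<Rightarrow> nat"
    assume x: "x \<in> carr (ops (tree_operad A) n)"
    { assume y: "y \<in> carr (ops (tree_operad A) n)"
      show "vadd (ops (tree_operad A) n) x y \<in> carr (ops (tree_operad A) n)"
        using x y keys_add[of x y] by auto }
    show "vscale (ops (tree_operad A) n) c x \<in> carr (ops (tree_operad A) n)"
      using x keys_pm_scale[of c x] by auto
    { assume s: "\<sigma> permutes {..<n}"
      have "Poly_Mapping.keys (pm_extend (\<lambda>t. Poly_Mapping.single (relabel (inv \<sigma>) t) 1) x)
          \<subseteq> trees A n"
        by (rule keys_pm_extend_singles) (use x in \<open>auto intro: relabel_trees_inv[OF _ s]\<close>)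
      then show "vact (ops (tree_operad A) n) \<sigma> x \<in> carr (ops (tree_operad A) n)"
        by simp }
    show "vact (ops (tree_operad A) n) id x = x"
      by (simp add: relabel_ident pm_extend_id)
    fix \<tau> :: "nat \<Rightarrow> nat"
    assume "\<sigma> permutes {..<n}" "\<tau> permutes {..<n}"
    then show "vact (ops (tree_operad A) n) (\<sigma> \<circ> \<tau>) x =
        vact (ops (tree_operad A) n) \<tau> (vact (ops (tree_operad A) n) \<sigma> x)"
      by (simp add: pm_extend_extend relabel_relabel o_inv_distrib permutes_bij)
  qed (simp_all add: pm_scale_add pm_scale_uminus pm_extend_add pm_extend_scale add.assoc add.commute)
next
  show "unit (tree_operad A :: ('k, _) operad_struct) \<in> carr (ops (tree_operad A) 1)"
    by (simp add: trees_def lessThan_Suc)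
next
  fix m n i and p q :: "'a tree \<Rightarrow>\<^sub>0 'k"
  assume "i < m" "p \<in> carr (ops (tree_operad A) m)" "q \<in> carr (ops (tree_operad A) n)"
  then have "Poly_Mapping.keys (pm_extend (\<lambda>t. Poly_Mapping.single (graft n i s t) 1) q)
      \<subseteq> trees A (m + n - 1)" if "s \<in> Poly_Mapping.keys p" for s
    by (intro keys_pm_extend_singles graft_trees) (use that in auto)
  then have "Poly_Mapping.keys (pm_extend (\<lambda>s. pm_extend (\<lambda>t. Poly_Mapping.single (graft n i s t) 1) q) p)
      \<subseteq> trees A (m + n - 1)"
    by (rule subset_trans[OF keys_pm_extend UN_least])
  then show "pcomp (tree_operad A) m n i p q \<in> carr (ops (tree_operad A) (m + n - 1))"
    by simp
next
  fix m n i j k and p q r :: "'a tree \<Rightarrow>\<^sub>0 'k"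
  assume A: "i < m" "j < n" "p \<in> carr (ops (tree_operad A) m)" "q \<in> carr (ops (tree_operad A) n)"
  show "pcomp (tree_operad A) (m + n - 1) k (i + j) (pcomp (tree_operad A) m n i p q) r =
       pcomp (tree_operad A) m (n + k - 1) i p (pcomp (tree_operad A) n k j q r)"
    unfolding tree_operad_sel pm_extend_extend pm_extend_single pm_scale_simps
    by (intro pm_extend_cong refl arg_cong2[where f = Poly_Mapping.single] graft_sequential[OF A(1,2)])
       (use A in auto)
next
  fix m n i j k and p q r :: "'a tree \<Rightarrow>\<^sub>0 'k"
  assume A: "i < j" "j < m" "p \<in> carr (ops (tree_operad A) m)" "q \<in> carr (ops (tree_operad A) n)"
  show "pcomp (tree_operad A) (m + n - 1) k (j + n - 1) (pcomp (tree_operad A) m n i p q) r =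
       pcomp (tree_operad A) (m + k - 1) n i (pcomp (tree_operad A) m k j p r) q"
    unfolding tree_operad_sel pm_extend_extend pm_extend_single pm_scale_simps
    by (subst (2) pm_extend_swap,
        intro pm_extend_cong refl arg_cong2[where f = Poly_Mapping.single] graft_parallel[OF A(1,2)])
       (use A in auto)
next
  fix m n i \<sigma> and p q :: "'a tree \<Rightarrow>\<^sub>0 'k"
  assume A: "i < m" "\<sigma> permutes {..<m}"
    "p \<in> carr (ops (tree_operad A) m)" "q \<in> carr (ops (tree_operad A) n)"
  show "pcomp (tree_operad A) m n i (vact (ops (tree_operad A) m) \<sigma> p) q =
     vact (ops (tree_operad A) (m + n - 1)) (outer_perm m n i \<sigma>) (pcomp (tree_operad A) m n (\<sigma> i) p q)"
    unfolding tree_operad_sel pm_extend_extend pm_extend_single pm_scale_simps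
    by (intro pm_extend_cong refl arg_cong2[where f = Poly_Mapping.single] graft_act_left[OF A(1,2)])
       (use A in auto)
next
  fix m n i \<tau> and p q :: "'a tree \<Rightarrow>\<^sub>0 'k"
  assume A: "i < m" "\<tau> permutes {..<n}"
    "p \<in> carr (ops (tree_operad A) m)" "q \<in> carr (ops (tree_operad A) n)"
  show "pcomp (tree_operad A) m n i p (vact (ops (tree_operad A) n) \<tau> q) =
     vact (ops (tree_operad A) (m + n - 1)) (inner_perm n i \<tau>) (pcomp (tree_operad A) m n i p q)"
    unfolding tree_operad_sel pm_extend_extend pm_extend_single pm_scale_simps
    by (intro pm_extend_cong refl arg_cong2[where f = Poly_Mapping.single] graft_act_right[OF A(1,2)])
       (use A in auto)
qed (simp_all add: pm_extend_add pm_extend_scale pm_extend_fun_add pm_extend_fun_scale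
      graft_unit_left graft_unit_right pm_extend_id)

subsection \<open>Quotients and presentations\<close>

context sn_module
begin

lemma minus_closed: "\<lbrakk>x \<in> carr V; y \<in> carr V\<rbrakk> \<Longrightarrow> vminus V x y \<in> carr V"
  by (simp add: vminus_def add_closed scale_closed)

lemmas closed = zero_closed add_closed scale_closed act_closed minus_closed

lemma add_left_commute:
  "\<lbrakk>x \<in> carr V; y \<in> carr V; z \<in> carr V\<rbrakk> \<Longrightarrow> vadd V x (vadd V y z) = vadd V y (vadd V x z)"
  by (metis add_assoc add_commute)

lemma add_zero_right: "x \<in> carr V \<Longrightarrow> vadd V x (vzero V) = x"
  by (metis add_commute add_zero zero_closed)

lemma minus_self: "x \<in> carr V \<Longrightarrow> vminus V x x = vzero V"
  by (simp add: vminus_def add_uminus)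

lemma minus_add_add:
  "\<lbrakk>x \<in> carr V; y \<in> carr V; x' \<in> carr V; y' \<in> carr V\<rbrakk> \<Longrightarrow>
    vminus V (vadd V x y) (vadd V x' y') = vadd V (vminus V x x') (vminus V y y')"
  by (simp add: vminus_def scale_add add_assoc add_left_commute closed)

lemma minus_scale: "\<lbrakk>x \<in> carr V; y \<in> carr V\<rbrakk> \<Longrightarrow>
    vminus V (vscale V c x) (vscale V c y) = vscale V c (vminus V x y)"
  by (simp add: vminus_def scale_add scale_scale closed)

lemma minus_act: "\<lbrakk>\<sigma> permutes {..<n}; x \<in> carr V; y \<in> carr V\<rbrakk> \<Longrightarrow>
    vminus V (vact V \<sigma> x) (vact V \<sigma> y) = vact V \<sigma> (vminus V x y)"
  by (simp add: vminus_def act_add act_scale closed)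

lemma uminus_add_cancel:
  "\<lbrakk>x \<in> carr V; y \<in> carr V\<rbrakk> \<Longrightarrow> vadd V (vscale V (- 1) x) (vadd V x y) = y"
  by (metis add_assoc add_commute add_uminus add_zero scale_closed)

lemma minus_swap: "\<lbrakk>x \<in> carr V; y \<in> carr V\<rbrakk> \<Longrightarrow>
    vscale V (- 1) (vminus V x y) = vminus V y x"
  by (simp add: vminus_def scale_add scale_scale scale_one closed add_commute)

lemma minus_trans: "\<lbrakk>x \<in> carr V; y \<in> carr V; z \<in> carr V\<rbrakk> \<Longrightarrow>
    vadd V (vminus V x y) (vminus V y z) = vminus V x z"
  by (simp add: vminus_def add_assoc uminus_add_cancel closed)

end

locale operad_with_ideal = operad P for P :: "('k::field, 'v) operad_struct" +
  fixes J :: "nat \<Rightarrow> 'v \<Rightarrow> bool"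
  assumes J_carr: "J n x \<Longrightarrow> x \<in> carr (ops P n)"
    and J_zero: "J n (vzero (ops P n))"
    and J_add: "\<lbrakk>J n x; J n y\<rbrakk> \<Longrightarrow> J n (vadd (ops P n) x y)"
    and J_scale: "J n x \<Longrightarrow> J n (vscale (ops P n) c x)"
    and J_act: "\<lbrakk>\<sigma> permutes {..<n}; J n x\<rbrakk> \<Longrightarrow> J n (vact (ops P n) \<sigma> x)"
    and J_left: "\<lbrakk>i < m; J m x; q \<in> carr (ops P n)\<rbrakk> \<Longrightarrow> J (m + n - 1) (pcomp P m n i x q)"
    and J_right: "\<lbrakk>i < m; p \<in> carr (ops P m); J n x\<rbrakk> \<Longrightarrow> J (m + n - 1) (pcomp P m n i p x)"
begin

abbreviation "Q \<equiv> quotient_operad P J"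
abbreviation "cl \<equiv> coset P J"

lemma cl_eq_iff:
  assumes "x \<in> carr (ops P n)" "y \<in> carr (ops P n)"
  shows "cl n x = cl n y \<longleftrightarrow> J n (vminus (ops P n) x y)"
proof
  interpret M: sn_module n "ops P n" by (rule module)
  assume "cl n x = cl n y"
  moreover have "x \<in> cl n x" using assms J_zero by (simp add: coset_def M.minus_self)
  ultimately show "J n (vminus (ops P n) x y)" by (simp add: coset_def)
next
  interpret M: sn_module n "ops P n" by (rule module)
  assume J: "J n (vminus (ops P n) x y)"
  then have J': "J n (vminus (ops P n) y x)" using J_scale M.minus_swap assms by metis
  show "cl n x = cl n y"
    unfolding coset_def using J_add[OF _ J] J_add[OF _ J'] M.minus_trans assms by fastforce
qed

lemma rep_cl:
  assumes "x \<in> carr (ops P n)"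
  shows "rep (cl n x) \<in> carr (ops P n)" "cl n (rep (cl n x)) = cl n x"
    "J n (vminus (ops P n) (rep (cl n x)) x)"
proof -
  interpret M: sn_module n "ops P n" by (rule module)
  have "x \<in> cl n x" using assms J_zero by (simp add: coset_def M.minus_self)
  then have "rep (cl n x) \<in> cl n x" unfolding rep_def by (rule someI)
  then show "rep (cl n x) \<in> carr (ops P n)" "J n (vminus (ops P n) (rep (cl n x)) x)"
    by (auto simp: coset_def)
  then show "cl n (rep (cl n x)) = cl n x" using cl_eq_iff assms by blast
qed

lemma quotient_carr: "carr (ops Q n) = cl n ` carr (ops P n)"
  and quotient_zero: "vzero (ops Q n) = cl n (vzero (ops P n))"
  and quotient_unit: "unit Q = cl 1 (unit P)"
  by (simp_all add: quotient_operad_def)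

lemma quotient_add:
  assumes "x \<in> carr (ops P n)" "y \<in> carr (ops P n)"
  shows "vadd (ops Q n) (cl n x) (cl n y) = cl n (vadd (ops P n) x y)"
proof -
  interpret M: sn_module n "ops P n" by (rule module)
  show ?thesis using rep_cl[of x n] rep_cl[of y n] assms
    by (simp add: quotient_operad_def cl_eq_iff M.closed M.minus_add_add J_add)
qed

lemma quotient_scale:
  assumes "x \<in> carr (ops P n)"
  shows "vscale (ops Q n) c (cl n x) = cl n (vscale (ops P n) c x)"
proof -
  interpret M: sn_module n "ops P n" by (rule module)
  show ?thesis using rep_cl[of x n] assms
    by (simp add: quotient_operad_def cl_eq_iff M.closed M.minus_scale J_scale)
qed

lemma quotient_act:
  assumes "x \<in> carr (ops P n)" "\<sigma> permutes {..<n}"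
  shows "vact (ops Q n) \<sigma> (cl n x) = cl n (vact (ops P n) \<sigma> x)"
proof -
  interpret M: sn_module n "ops P n" by (rule module)
  show ?thesis using rep_cl[of x n] assms
    by (simp add: quotient_operad_def cl_eq_iff M.closed M.minus_act J_act)
qed

lemma quotient_pcomp:
  assumes "i < m" "x \<in> carr (ops P m)" "y \<in> carr (ops P n)"
  shows "pcomp Q m n i (cl m x) (cl n y) = cl (m + n - 1) (pcomp P m n i x y)"
proof -
  interpret Mm: sn_module m "ops P m" by (rule module)
  interpret Mn: sn_module n "ops P n" by (rule module)
  interpret M: sn_module "m + n - 1" "ops P (m + n - 1)" by (rule module)
  note x = rep_cl[OF assms(2)] and y = rep_cl[OF assms(3)]
  have "J (m + n - 1) (vminus (ops P (m + n - 1))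
          (pcomp P m n i (rep (cl m x)) (rep (cl n y))) (pcomp P m n i x (rep (cl n y))))"
    using J_left[OF assms(1) x(3) y(1)] x y assms
    by (simp add: vminus_def pcomp_add_left pcomp_scale_left Mm.closed)
  moreover have "J (m + n - 1) (vminus (ops P (m + n - 1))
          (pcomp P m n i x (rep (cl n y))) (pcomp P m n i x y))"
    using J_right[OF assms(1,2) y(3)] x y assms
    by (simp add: vminus_def pcomp_add_right pcomp_scale_right Mn.closed)
  moreover note M.minus_trans[OF pcomp_closed[OF assms(1) x(1) y(1)]
      pcomp_closed[OF assms(1,2) y(1)] pcomp_closed[OF assms]]
  ultimately have "J (m + n - 1) (vminus (ops P (m + n - 1))
          (pcomp P m n i (rep (cl m x)) (rep (cl n y))) (pcomp P m n i x y))"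
    using J_add by metis
  then show ?thesis
    using cl_eq_iff[OF pcomp_closed[OF assms(1) x(1) y(1)] pcomp_closed[OF assms]]
    by (simp add: quotient_operad_def)
qed

lemma operad_quotient: "operad Q"
proof (rule operad.intro)
  fix n
  interpret M: sn_module n "ops P n" by (rule module)
  have c: "cl n (vadd (ops P n) x y) = cl n (vadd (ops P n) y x)"
    if "x \<in> carr (ops P n)" "y \<in> carr (ops P n)" for x y
    using M.add_commute[OF that] by simp
  show "sn_module n (ops Q n)"
    by standard
       (auto simp: quotient_carr quotient_zero quotient_add quotient_scale quotient_act M.closed
          M.add_assoc M.add_zero M.add_uminus M.scale_add M.add_scale M.scale_scale M.scale_one
          M.act_add M.act_scale M.act_id M.act_comp permutes_compose c)
next
  show "unit Q \<in> carr (ops Q 1)" using unit_closed by (simp add: quotient_unit quotient_carr)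
next
  fix m n i \<sigma> p q
  assume A: "i < m" "\<sigma> permutes {..<m}" "p \<in> carr (ops Q m)" "q \<in> carr (ops Q n)"
  moreover have "\<sigma> i < m" using permutes_in_image[OF A(2)] A(1) by simp
  ultimately show "pcomp Q m n i (vact (ops Q m) \<sigma> p) q =
    vact (ops Q (m + n - 1)) (outer_perm m n i \<sigma>) (pcomp Q m n (\<sigma> i) p q)"
    by (auto simp: quotient_carr quotient_act quotient_pcomp sn_module.closed[OF module]
        pcomp_closed pcomp_act_left outer_perm_bij(1) simp del: One_nat_def)
next
  fix m n i \<tau> p q
  assume A: "i < m" "\<tau> permutes {..<n}" "p \<in> carr (ops Q m)" "q \<in> carr (ops Q n)"
  then show "pcomp Q m n i p (vact (ops Q n) \<tau> q) =
    vact (ops Q (m + n - 1)) (inner_perm n i \<tau>) (pcomp Q m n i p q)"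
    by (auto simp: quotient_carr quotient_act quotient_pcomp sn_module.closed[OF module]
        pcomp_closed pcomp_act_right inner_perm_permutes simp del: One_nat_def)
next
  fix m n i p
  assume "i < m" "p \<in> carr (ops Q m)"
  then show "pcomp Q m 1 i p (unit Q) = p"
    using unit_closed quotient_pcomp[of i m _ "unit P" 1] pcomp_unit_right
    by (auto simp: quotient_carr quotient_unit)
next
  fix m p
  assume "p \<in> carr (ops Q m)"
  then show "pcomp Q 1 m 0 (unit Q) p = p"
    using unit_closed quotient_pcomp[of 0 1 "unit P" _ m] pcomp_unit_left
    by (auto simp: quotient_carr quotient_unit)
next
  fix m n i j k p q r
  assume A: "i < m" "j < n" "p \<in> carr (ops Q m)" "q \<in> carr (ops Q n)" "r \<in> carr (ops Q k)"
  then have l: "i + j < m + n - 1" and e: "m + (n + k - 1) - 1 = m + n - 1 + k - 1" by auto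
  obtain x y z where xyz: "x \<in> carr (ops P m)" "y \<in> carr (ops P n)" "z \<in> carr (ops P k)"
    "p = cl m x" "q = cl n y" "r = cl k z"
    using A by (auto simp: quotient_carr)
  show "pcomp Q (m + n - 1) k (i + j) (pcomp Q m n i p q) r =
    pcomp Q m (n + k - 1) i p (pcomp Q n k j q r)"
    unfolding xyz quotient_pcomp[OF A(1) xyz(1,2)] quotient_pcomp[OF A(2) xyz(2,3)]
      quotient_pcomp[OF l pcomp_closed[OF A(1) xyz(1,2)] xyz(3)]
      quotient_pcomp[OF A(1) xyz(1) pcomp_closed[OF A(2) xyz(2,3)]]
      pcomp_sequential[OF A(1,2) xyz(1-3)] e ..
next
  fix m n i j k p q r
  assume A: "i < j" "j < m" "p \<in> carr (ops Q m)" "q \<in> carr (ops Q n)" "r \<in> carr (ops Q k)"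
  then have l: "i < m" "j + n - 1 < m + n - 1" "i < m + k - 1"
    and e: "m + k - 1 + n - 1 = m + n - 1 + k - 1" by auto
  obtain x y z where xyz: "x \<in> carr (ops P m)" "y \<in> carr (ops P n)" "z \<in> carr (ops P k)"
    "p = cl m x" "q = cl n y" "r = cl k z"
    using A by (auto simp: quotient_carr)
  show "pcomp Q (m + n - 1) k (j + n - 1) (pcomp Q m n i p q) r =
    pcomp Q (m + k - 1) n i (pcomp Q m k j p r) q"
    unfolding xyz quotient_pcomp[OF l(1) xyz(1,2)] quotient_pcomp[OF A(2) xyz(1,3)]
      quotient_pcomp[OF l(2) pcomp_closed[OF l(1) xyz(1,2)] xyz(3)]
      quotient_pcomp[OF l(3) pcomp_closed[OF A(2) xyz(1,3)] xyz(2)]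
      pcomp_parallel[OF A(1,2) xyz(1-3)] e ..
qed (auto simp: quotient_carr quotient_add quotient_scale quotient_pcomp pcomp_closed
      sn_module.closed[OF module] pcomp_add_left pcomp_add_right pcomp_scale_left pcomp_scale_right
      simp del: One_nat_def)

end

lemma operad_ideal_ideal:
  assumes "operad P" "\<And>n. R n \<subseteq> carr (ops P n)"
  shows "operad_with_ideal P (operad_ideal P R)"
proof -
  interpret operad P by fact
  have carr: "x \<in> carr (ops P n)" if "operad_ideal P R n x" for n x
    using that assms(2)
    by induction (auto intro: sn_module.closed[OF module] pcomp_closed simp del: One_nat_def)
  show ?thesis
    by unfold_locales (auto intro: operad_ideal.intros carr simp del: One_nat_def)
qed

lemma sn_span_subset: "sn_module n V \<Longrightarrow> S \<subseteq> carr V \<Longrightarrow> sn_span n V S \<subseteq> carr V"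
proof
  fix x assume "sn_module n V" "S \<subseteq> carr V" "x \<in> sn_span n V S"
  from this(3,1,2) show "x \<in> carr V" by induction (auto intro: sn_module.closed)
qed

lemma sn_module_dual:
  assumes "sn_module n V"
  shows "sn_module n (sn_dual n V)"
proof -
  interpret sn_module n V by fact
  have i: "inv \<sigma> permutes {..<n}" if "\<sigma> permutes {..<n}" for \<sigma> :: "nat \<Rightarrow> nat"
    using that by (rule permutes_inv)
  have ext: "f = (\<lambda>x\<in>carr V. g x)" if "f \<in> carr (sn_dual n V)" "\<And>x. x \<in> carr V \<Longrightarrow> f x = g x" for f g
    by (rule extensionalityI[of _ "carr V"]) (use that in \<open>auto simp: sn_dual_def\<close>)
  show ?thesis
  proof
    fix \<sigma> \<tau> :: "nat \<Rightarrow> nat" and f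
    assume A: "\<sigma> permutes {..<n}" "\<tau> permutes {..<n}"
    have "sign (\<sigma> \<circ> \<tau>) = sign \<sigma> * sign \<tau>"
      using A by (intro sign_compose) (auto simp: permutation_permutes)
    moreover have "inv (\<sigma> \<circ> \<tau>) = inv \<tau> \<circ> inv \<sigma>"
      using A by (intro o_inv_distrib permutes_bij)
    ultimately show "vact (sn_dual n V) (\<sigma> \<circ> \<tau>) f = vact (sn_dual n V) \<tau> (vact (sn_dual n V) \<sigma> f)"
      by (auto simp: sn_dual_def act_comp[OF i[OF A(2)] i[OF A(1)]] act_closed[OF i[OF A(2)]]
          intro!: restrict_ext)
  next
    fix \<sigma> :: "nat \<Rightarrow> nat" and f assume "\<sigma> permutes {..<n}" "f \<in> carr (sn_dual n V)"
    then show "vact (sn_dual n V) \<sigma> f \<in> carr (sn_dual n V)"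
      by (simp add: sn_dual_def closed i act_add act_scale distrib_left mult.left_commute)
  next
    fix f assume f: "f \<in> carr (sn_dual n V)"
    have f': "restrict f (carr V) = f" using ext[OF f refl] by simp
    have "vact (sn_dual n V) id f = restrict f (carr V)"
      by (auto simp: sn_dual_def act_id inv_id intro!: restrict_ext)
    then show "vact (sn_dual n V) id f = f" by (simp only: f')
    have "vadd (sn_dual n V) (vzero (sn_dual n V)) f = restrict f (carr V)"
      by (auto simp: sn_dual_def intro!: restrict_ext)
    then show "vadd (sn_dual n V) (vzero (sn_dual n V)) f = f" by (simp only: f')
    have "vscale (sn_dual n V) 1 f = restrict f (carr V)"
      by (auto simp: sn_dual_def intro!: restrict_ext)
    then show "vscale (sn_dual n V) 1 f = f" by (simp only: f')
  qed (auto simp: sn_dual_def closed i algebra_simps intro!: restrict_ext)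
qed

lemma sn_module_free: "sn_module n (free_sn n :: ('k::field, 'g \<times> (nat \<Rightarrow> nat) \<Rightarrow>\<^sub>0 'k) sn_mod)"
proof
  fix x y :: "'g \<times> (nat \<Rightarrow> nat) \<Rightarrow>\<^sub>0 'k" and c and \<sigma> \<tau> :: "nat \<Rightarrow> nat"
  assume x: "x \<in> carr (free_sn n)"
  { assume "y \<in> carr (free_sn n)"
    then show "vadd (free_sn n) x y \<in> carr (free_sn n)"
      using x keys_add[of x y] by (auto simp: free_sn_def) }
  show "vscale (free_sn n) c x \<in> carr (free_sn n)"
    using x keys_pm_scale[of c x] by (auto simp: free_sn_def)
  have act: "vact (free_sn n) \<rho> =
      pm_extend (\<lambda>a. Poly_Mapping.single (fst a, snd a \<circ> \<rho>) (1 :: 'k))" for \<rho>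
    by (simp add: free_sn_def case_prod_unfold)
  show "vact (free_sn n) id x = x"
    unfolding act by (simp add: pm_extend_id)
  { assume s: "\<sigma> permutes {..<n}"
    have "Poly_Mapping.keys (vact (free_sn n) \<sigma> x) \<subseteq> UNIV \<times> {\<sigma>. \<sigma> permutes {..<n}}"
      unfolding act
      by (rule keys_pm_extend_singles)
         (use x in \<open>auto simp: free_sn_def intro!: permutes_compose[OF s]\<close>)
    then show "vact (free_sn n) \<sigma> x \<in> carr (free_sn n)"
      by (simp add: free_sn_def) }
  show "vact (free_sn n) (\<sigma> \<circ> \<tau>) x = vact (free_sn n) \<tau> (vact (free_sn n) \<sigma> x)"
    unfolding act by (simp add: pm_extend_extend comp_assoc)
qed (simp_all add: free_sn_def pm_scale_add pm_scale_uminus pm_extend_add pm_extend_scale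
      add.assoc add.commute)

lemma corolla_carr: "\<mu> \<in> carr E \<Longrightarrow> corolla \<mu> \<in> carr (ops (tree_operad (carr E)) 2)"
  by (auto simp: corolla_def trees_def)

context
  fixes E :: "('k::field, 'v) sn_mod"
  assumes E: "sn_module 2 E"
begin

interpretation E: sn_module 2 E by (rule E)

lemma operad_free_ideal: "operad_with_ideal (tree_operad (carr E)) (free_ideal E)"
  unfolding free_ideal_def
proof (rule operad_ideal_ideal[OF operad_tree_operad])
  fix n
  interpret T: operad "tree_operad (carr E) :: ('k, _) operad_struct" by (rule operad_tree_operad)
  interpret M: sn_module 2 "ops (tree_operad (carr E)) 2 :: ('k, 'v tree \<Rightarrow>\<^sub>0 'k) sn_mod"
    by (rule T.module)
  have diff: "p - q \<in> carr (ops (tree_operad (carr E)) 2)"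
    if "p \<in> carr (ops (tree_operad (carr E)) 2)" "q \<in> carr (ops (tree_operad (carr E)) 2)"
    for p q :: "'v tree \<Rightarrow>\<^sub>0 'k"
    using M.minus_closed[OF that] by (simp add: vminus_def pm_scale_uminus)
  have "(corolla \<mu> + corolla \<nu> :: 'v tree \<Rightarrow>\<^sub>0 'k) \<in> carr (ops (tree_operad (carr E)) 2)"
    "pm_scale c (corolla \<mu>) \<in> carr (ops (tree_operad (carr E)) 2)"
    if "\<mu> \<in> carr E" "\<nu> \<in> carr E" for \<mu> \<nu> and c :: 'k
    using M.add_closed[OF that[THEN corolla_carr]] M.scale_closed[OF that(1)[THEN corolla_carr], of c]
    by simp_all
  then show "free_relations E n \<subseteq> carr (ops (tree_operad (carr E)) n)"
    unfolding free_relations_def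
    by (auto intro!: diff corolla_carr E.closed M.act_closed simp del: tree_operad_sel(1,5))
qed

lemma operad_free_operad: "operad (free_operad E)"
  unfolding free_operad_def
  by (rule operad_with_ideal.operad_quotient[OF operad_free_ideal])

lemma free_incl_carr: "\<mu> \<in> carr E \<Longrightarrow> free_incl E \<mu> \<in> carr (ops (free_operad E) 2)"
  unfolding free_incl_def free_operad_def
    operad_with_ideal.quotient_carr[OF operad_free_ideal]
  by (intro imageI corolla_carr)

lemma operad_quadratic_ideal:
  "R \<subseteq> carr (ops (free_operad E) 3) \<Longrightarrow> operad_with_ideal (free_operad E) (quadratic_ideal E R)"
  unfolding quadratic_ideal_def by (rule operad_ideal_ideal[OF operad_free_operad]) simp

theorem operad_quadratic_operad:
  "R \<subseteq> carr (ops (free_operad E) 3) \<Longrightarrow> operad (quadratic_operad E R)"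
  unfolding quadratic_operad_def
  by (rule operad_with_ideal.operad_quotient[OF operad_quadratic_ideal])

end

theorem operad_koszul_dual: "sn_module 2 E \<Longrightarrow> operad (koszul_dual E R)"
  unfolding koszul_dual_def
  by (rule operad_quadratic_operad[OF sn_module_dual]) (auto simp: annihilator_def)

lemma bicomp_carr:
  fixes P :: "('k::field, 'v) operad_struct"
  assumes "operad P" "p \<in> carr (ops P 2)" "q \<in> carr (ops P a)" "r \<in> carr (ops P b)"
  shows "bicomp P a b p q r \<in> carr (ops P (a + b))"
  using operad.pcomp_closed[OF assms(1), of 1 2 p r b]
    operad.pcomp_closed[OF assms(1), of 0 "b + 1" "pcomp P 2 b 1 p r" q a] assms
  by (simp add: bicomp_def add.commute)

lemma bg_carr:
  "compL g h \<in> carr (ops (free_operad (bg_E :: ('k::field, _) sn_mod)) 3)"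
  "compR g h \<in> carr (ops (free_operad (bg_E :: ('k::field, _) sn_mod)) 3)"
  "comp_diff g h g' h' \<in> carr (ops (free_operad (bg_E :: ('k::field, _) sn_mod)) 3)"
proof -
  have E: "sn_module 2 (bg_E :: ('k, _) sn_mod)" unfolding bg_E_def by (rule sn_module_free)
  interpret operad "free_operad (bg_E :: ('k, _) sn_mod)" by (rule operad_free_operad[OF E])
  have g: "(gen_op g :: ('k gen_vec tree \<Rightarrow>\<^sub>0 'k) set) \<in> carr (ops (free_operad bg_E) 2)" for g
    unfolding gen_op_def
    by (rule free_incl_carr[OF E]) (simp add: free_gen_def bg_E_def free_sn_def permutes_id)
  have L: "compL g h \<in> carr (ops (free_operad (bg_E :: ('k::field, _) sn_mod)) 3)" for g h
    using bicomp_carr[OF operad_axioms g g unit_closed] by (simp add: compL_def numeral_3_eq_3)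
  have R: "compR g h \<in> carr (ops (free_operad (bg_E :: ('k::field, _) sn_mod)) 3)" for g h
    using bicomp_carr[OF operad_axioms g unit_closed g] by (simp add: compR_def numeral_3_eq_3)
  show "compL g h \<in> carr (ops (free_operad (bg_E :: ('k::field, _) sn_mod)) 3)" by (rule L)
  show "compR g h \<in> carr (ops (free_operad (bg_E :: ('k::field, _) sn_mod)) 3)" by (rule R)
  show "comp_diff g h g' h' \<in> carr (ops (free_operad (bg_E :: ('k::field, _) sn_mod)) 3)"
    unfolding comp_diff_def by (rule sn_module.minus_closed[OF module L R])
qed

end

theory Submission
  imports Defs
begin

text \<open>
  Both operads of the statement are quotients of one and the same concrete operad. Let \<open>T\<close> be the operad
  of formal linear combinations of binary trees whose vertices are labelled by the bare symbols \<open>M\<close>,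
  \<open>Succ\<close>, \<open>Prec\<close>. An \<open>S\<^sub>2\<close>-module that is free on these symbols has \<open>T\<close> as its free operad
  (\<open>gen_iso\<close>): a tree labelled by vectors expands multilinearly into trees labelled by symbols, where a
  basis vector \<open>g \<cdot> (0 1)\<close> at a vertex becomes the symbol \<open>g\<close> with the two subtrees exchanged. This
  applies to \<open>E\<close>, and also to \<open>E\<^sup>!\<close>, which is free on the dual basis (\<open>dual_free\<close>); the sign
  representation only changes the sign of the coordinate along \<open>g \<cdot> (0 1)\<close>.

  Through these two identifications the pairing between the arity 3 parts becomes a bilinear form on
  \<open>T(3)\<close> (\<open>pairing_eq_comb_form\<close>). It is diagonal in the basis of trees: with \<open>w\<close> the word read off
  the leaves, a left comb \<open>g(h(x\<^sub>a, x\<^sub>b), x\<^sub>c)\<close> has square \<open>sign w\<close> and a right comb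
  \<open>g(x\<^sub>a, h(x\<^sub>b, x\<^sub>c))\<close> has square \<open>- sign w\<close>. The six bigraft relations are differences of a left comb and
  a right comb, and no comb occurs in two of them: they are a partial matching between the nine left
  combs and the nine right combs. Because of the opposite signs, orthogonality to such a difference says
  that the coefficients of the two combs add up to zero. The orthogonal complement is therefore spanned
  by the same six differences together with all unmatched combs
  (\<open>annihilator_match_relations\<close>), that is, the six monomial relations of the dual. So the two ideals have the same
  image in \<open>T\<close>, and each side of the statement is isomorphic to the quotient of \<open>T\<close> by the ideal which
  that image generates. The isomorphism matches the basis vectors because both identifications send them
  to the same corolla.
\<close>

section \<open>Homomorphisms of operads\<close>

definition operad_hom ::
  "('k::field, 'v) operad_struct \<Rightarrow> ('k, 'w) operad_struct \<Rightarrow> (nat \<Rightarrow> 'v \<Rightarrow> 'w) \<Rightarrow> bool" where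
  "operad_hom P Q \<phi> \<longleftrightarrow>
    (\<forall>n. \<forall>x\<in>carr (ops P n). \<phi> n x \<in> carr (ops Q n)) \<and>
    (\<forall>n. \<forall>x\<in>carr (ops P n). \<forall>y\<in>carr (ops P n).
      \<phi> n (vadd (ops P n) x y) = vadd (ops Q n) (\<phi> n x) (\<phi> n y)) \<and>
    (\<forall>n c. \<forall>x\<in>carr (ops P n). \<phi> n (vscale (ops P n) c x) = vscale (ops Q n) c (\<phi> n x)) \<and>
    (\<forall>n \<sigma>. \<forall>x\<in>carr (ops P n). \<sigma> permutes {..<n} \<longrightarrow>
      \<phi> n (vact (ops P n) \<sigma> x) = vact (ops Q n) \<sigma> (\<phi> n x)) \<and>
    \<phi> 1 (unit P) = unit Q \<and>
    (\<forall>m n i. \<forall>p\<in>carr (ops P m). \<forall>q\<in>carr (ops P n). i < m \<longrightarrow>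
      \<phi> (m + n - 1) (pcomp P m n i p q) = pcomp Q m n i (\<phi> m p) (\<phi> n q))"

lemma operad_homD:
  assumes "operad_hom P Q \<phi>"
  shows "x \<in> carr (ops P n) \<Longrightarrow> \<phi> n x \<in> carr (ops Q n)"
    and "\<lbrakk>x \<in> carr (ops P n); y \<in> carr (ops P n)\<rbrakk> \<Longrightarrow>
      \<phi> n (vadd (ops P n) x y) = vadd (ops Q n) (\<phi> n x) (\<phi> n y)"
    and "x \<in> carr (ops P n) \<Longrightarrow> \<phi> n (vscale (ops P n) c x) = vscale (ops Q n) c (\<phi> n x)"
    and "\<lbrakk>\<sigma> permutes {..<n}; x \<in> carr (ops P n)\<rbrakk> \<Longrightarrow>
      \<phi> n (vact (ops P n) \<sigma> x) = vact (ops Q n) \<sigma> (\<phi> n x)"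
    and "\<phi> 1 (unit P) = unit Q"
    and "\<lbrakk>i < m; p \<in> carr (ops P m); q \<in> carr (ops P n)\<rbrakk> \<Longrightarrow>
      \<phi> (m + n - 1) (pcomp P m n i p q) = pcomp Q m n i (\<phi> m p) (\<phi> n q)"
  using assms by (simp_all add: operad_hom_def del: One_nat_def)

lemma operad_iso_iff_hom:
  "operad_iso P Q \<phi> \<longleftrightarrow> operad P \<and> operad Q \<and> operad_hom P Q \<phi> \<and>
    (\<forall>n. bij_betw (\<phi> n) (carr (ops P n)) (carr (ops Q n)))"
  unfolding operad_iso_def operad_hom_def by (auto dest: bij_betwE)

lemma operad_hom_comp:
  assumes "operad_hom P Q \<phi>" "operad_hom Q S \<psi>"
  shows "operad_hom P S (\<lambda>n x. \<psi> n (\<phi> n x))"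
  unfolding operad_hom_def
  by (simp add: operad_homD[OF assms(1)] operad_homD[OF assms(2)] del: One_nat_def)

text \<open>
  An equation holds for the inverse map because \<open>\<phi>\<close> is injective and turns it into an equation for \<open>\<phi>\<close>.
\<close>

lemma operad_iso_inverse:
  assumes "operad_iso P Q \<phi>"
  shows "operad_iso Q P (\<lambda>n. inv_into (carr (ops P n)) (\<phi> n))"
proof -
  let ?\<psi> = "\<lambda>n. inv_into (carr (ops P n)) (\<phi> n)"
  interpret P: operad P using assms by (simp add: operad_iso_iff_hom)
  have h: "operad_hom P Q \<phi>" and b: "bij_betw (\<phi> n) (carr (ops P n)) (carr (ops Q n))" for n
    using assms by (simp_all add: operad_iso_iff_hom)
  have c: "?\<psi> n y \<in> carr (ops P n)" "\<phi> n (?\<psi> n y) = y" if "y \<in> carr (ops Q n)" for n y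
    using that b[of n] by (auto simp: bij_betw_def inv_into_into f_inv_into_f)
  have eq: "?\<psi> n (\<phi> n x) = x" if "x \<in> carr (ops P n)" for n x
    using that b[of n] by (auto simp: bij_betw_def)
  have eqI: "?\<psi> n y = x" if "x \<in> carr (ops P n)" "y = \<phi> n x" for n x y
    using that eq by simp
  note M = sn_module.closed[OF P.module]
  have "operad_hom Q P ?\<psi>"
    unfolding operad_hom_def
    by (auto simp: c operad_homD[OF h] M P.unit_closed P.pcomp_closed intro!: eqI
        simp del: One_nat_def)
  then show ?thesis
    using assms b by (simp add: operad_iso_iff_hom bij_betw_inv_into)
qed

lemma operad_iso_comp:
  "\<lbrakk>operad_iso P Q \<phi>; operad_iso Q S \<psi>\<rbrakk> \<Longrightarrow> operad_iso P S (\<lambda>n x. \<psi> n (\<phi> n x))"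
  unfolding operad_iso_iff_hom
  by (auto intro: operad_hom_comp bij_betw_trans[unfolded comp_def])

lemma (in sn_module) scale_0: "x \<in> carr V \<Longrightarrow> vscale V 0 x = vzero V"
  using add_scale[of x 1 "- 1"] by (simp add: scale_one add_uminus)

lemma (in sn_module) minus_eq_zero_iff:
  assumes "x \<in> carr V" "y \<in> carr V"
  shows "vminus V x y = vzero V \<longleftrightarrow> x = y"
proof
  assume "vminus V x y = vzero V"
  then have "vadd V (vminus V x y) y = y" using assms by (simp add: add_zero)
  then show "x = y"
    using assms add_uminus[of y]
    by (simp add: vminus_def add_assoc closed add_commute[of "vscale V (- 1) y"] add_zero_right)
qed (use assms in \<open>simp add: minus_self\<close>)

lemma operad_hom_zero:
  assumes "operad P" "operad Q" "operad_hom P Q \<phi>"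
  shows "\<phi> n (vzero (ops P n)) = vzero (ops Q n)"
proof -
  interpret P: sn_module n "ops P n" by (rule operad.module[OF assms(1)])
  interpret Q: sn_module n "ops Q n" by (rule operad.module[OF assms(2)])
  show ?thesis
    using operad_homD(3)[OF assms(3) P.zero_closed, of 0] operad_homD(1)[OF assms(3) P.zero_closed]
    by (simp add: P.scale_0 P.zero_closed Q.scale_0)
qed

lemma operad_hom_minus:
  assumes "operad P" "operad_hom P Q \<phi>" "x \<in> carr (ops P n)" "y \<in> carr (ops P n)"
  shows "\<phi> n (vminus (ops P n) x y) = vminus (ops Q n) (\<phi> n x) (\<phi> n y)"
  using assms sn_module.closed[OF operad.module[OF assms(1)]]
  by (simp add: vminus_def operad_homD[OF assms(2)])

lemma operad_hom_bicomp:
  assumes "operad P" "operad_hom P Q \<phi>"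
    "p \<in> carr (ops P 2)" "q \<in> carr (ops P a)" "r \<in> carr (ops P b)"
  shows "\<phi> (a + b) (bicomp P a b p q r) = bicomp Q a b (\<phi> 2 p) (\<phi> a q) (\<phi> b r)"
  using operad_homD(6)[OF assms(2), of 1 2 p r b]
    operad_homD(6)[OF assms(2), of 0 "b + 1" "pcomp P 2 b 1 p r" q a]
    operad.pcomp_closed[OF assms(1), of 1 2 p r b] assms(3-)
  by (simp add: bicomp_def add.commute)

lemma operad_hom_span:
  assumes "operad P" "operad_hom P Q \<phi>" "operad Q" "S \<subseteq> carr (ops P n)"
  shows "\<phi> n ` sn_span n (ops P n) S = sn_span n (ops Q n) (\<phi> n ` S)"
proof (intro equalityI subsetI)
  note c = subsetD[OF sn_span_subset[OF operad.module[OF assms(1)] assms(4)]]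
  fix y assume "y \<in> \<phi> n ` sn_span n (ops P n) S"
  then obtain x where "x \<in> sn_span n (ops P n) S" "y = \<phi> n x" by auto
  from this(1) show "y \<in> sn_span n (ops Q n) (\<phi> n ` S)" unfolding \<open>y = _\<close>
  proof induction
    case (base x)
    then show ?case by (intro sn_span.base imageI)
  qed (simp_all add: c operad_homD(2-4)[OF assms(2)] operad_hom_zero[OF assms(1,3,2)] sn_span.zero
      sn_span.add sn_span.scale sn_span.act)
next
  note c = subsetD[OF sn_span_subset[OF operad.module[OF assms(1)] assms(4)]]
  fix y assume "y \<in> sn_span n (ops Q n) (\<phi> n ` S)"
  then show "y \<in> \<phi> n ` sn_span n (ops P n) S"
  proof induction
    case zero
    show ?case using operad_hom_zero[OF assms(1,3,2), of n] by (metis imageI sn_span.zero)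
  next
    case (add x y)
    then show ?case by (auto simp: c simp flip: operad_homD(2)[OF assms(2)] intro!: imageI sn_span.add)
  next
    case (scale x a)
    then show ?case by (auto simp: c simp flip: operad_homD(3)[OF assms(2)] intro!: imageI sn_span.scale)
  next
    case (act s x)
    then show ?case by (auto simp: c simp flip: operad_homD(4)[OF assms(2)] intro!: imageI sn_span.act)
  qed (auto intro: sn_span.base)
qed

text \<open>
  The preimage of an ideal is an ideal, so it contains the ideal generated by \<open>R\<close> as soon as it
  contains \<open>R\<close>. With the zero ideal as \<open>J\<close>, a homomorphism that kills the generators kills the ideal.
\<close>

lemma operad_hom_ideal:
  assumes "operad P" "operad Q" "operad_hom P Q \<phi>" "\<And>n. R n \<subseteq> carr (ops P n)"
    and J: "operad_with_ideal Q J" and "\<And>n x. x \<in> R n \<Longrightarrow> J n (\<phi> n x)"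
    and "operad_ideal P R n x"
  shows "J n (\<phi> n x)"
proof -
  interpret J: operad_with_ideal Q J by (rule J)
  note c = operad_with_ideal.J_carr[OF operad_ideal_ideal[OF assms(1,4)]]
  from assms(7) show ?thesis
    by induction
       (simp_all add: c assms(6) operad_homD[OF assms(3)] operad_hom_zero[OF assms(1-3)]
          J.J_zero J.J_add J.J_scale J.J_act J.J_left J.J_right del: One_nat_def)
qed

lemma operad_zero_ideal:
  fixes P :: "('k::field, 'v) operad_struct"
  assumes "operad P"
  shows "operad_with_ideal P (\<lambda>n x. x = vzero (ops P n))"
proof -
  interpret operad P by fact
  have z: "vscale (ops P n) 0 (vzero (ops P n)) = vzero (ops P n)" for n :: nat
    by (simp add: sn_module.scale_0[OF module] sn_module.closed[OF module])
  note M = sn_module.closed[OF module] and S = sn_module.scale_0[OF module]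
  have sc: "vscale (ops P n) c (vzero (ops P n)) = vzero (ops P n)" for n c
    using sn_module.scale_scale[OF module M(1), of n c 0] by (simp add: z)
  show ?thesis
  proof
    fix m n i :: nat and q assume A: "i < m" "q \<in> carr (ops P n)"
    show "\<And>x. x = vzero (ops P m) \<Longrightarrow> pcomp P m n i x q = vzero (ops P (m + n - 1))"
      using pcomp_scale_left[OF A(1) M(1) A(2), of 0] by (simp add: z S pcomp_closed[OF A(1) M(1) A(2)] del: One_nat_def)
  next
    fix m n i :: nat and p x assume A: "i < m" "p \<in> carr (ops P m)" "x = vzero (ops P n)"
    show "pcomp P m n i p x = vzero (ops P (m + n - 1))"
      using pcomp_scale_right[OF A(1,2) M(1), of n 0] A(3) by (simp add: z S pcomp_closed[OF A(1,2) M(1)] del: One_nat_def)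
  next
    fix n \<sigma> x assume A: "\<sigma> permutes {..<n}" "x = vzero (ops P n)"
    then show "vact (ops P n) \<sigma> x = vzero (ops P n)"
      using sn_module.act_scale[OF module A(1) M(1), of 0] by (simp add: z S M)
  qed (auto simp: M sc sn_module.add_zero[OF module])
qed

lemma (in operad_with_ideal) quotient_hom: "operad_hom P Q cl"
  unfolding operad_hom_def
  by (auto simp: quotient_carr quotient_add quotient_scale quotient_act quotient_unit quotient_pcomp
      simp del: One_nat_def)

text \<open>
  The first isomorphism theorem. The induced map evaluates \<open>\<phi>\<close> on the chosen representative of a coset;
  the second claim says that the choice has no influence.
\<close>

lemma (in operad_with_ideal) quotient_iso:
  assumes S: "operad S" and h: "operad_hom P S \<phi>"
    and surj: "\<And>n. \<phi> n ` carr (ops P n) = carr (ops S n)"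
    and ker: "\<And>n x. x \<in> carr (ops P n) \<Longrightarrow> \<phi> n x = vzero (ops S n) \<longleftrightarrow> J n x"
  shows "operad_iso Q S (\<lambda>n X. \<phi> n (rep X))"
    and "x \<in> carr (ops P n) \<Longrightarrow> \<phi> n (rep (cl n x)) = \<phi> n x"
proof -
  have eq: "\<phi> n x = \<phi> n y \<longleftrightarrow> cl n x = cl n y" if "x \<in> carr (ops P n)" "y \<in> carr (ops P n)" for n x y
  proof -
    interpret M: sn_module n "ops P n" by (rule module)
    interpret S: sn_module n "ops S n" by (rule operad.module[OF S])
    have "\<phi> n x = \<phi> n y \<longleftrightarrow> \<phi> n (vminus (ops P n) x y) = vzero (ops S n)"
      using that by (simp add: operad_hom_minus[OF operad_axioms h] S.minus_eq_zero_iff operad_homD[OF h])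
    then show ?thesis using that by (simp add: ker M.closed cl_eq_iff)
  qed
  show r: "\<phi> n (rep (cl n x)) = \<phi> n x" if "x \<in> carr (ops P n)" for n x
    using that rep_cl[OF that] eq by metis
  note M = sn_module.closed[OF module]
  have "bij_betw (\<lambda>X. \<phi> n (rep X)) (carr (ops Q n)) (carr (ops S n))" for n
    unfolding bij_betw_def surj[symmetric] quotient_carr
    by (auto simp: inj_on_def r eq image_image intro!: image_cong)
  moreover have "operad_hom Q S (\<lambda>n X. \<phi> n (rep X))"
    unfolding operad_hom_def
    by (auto simp: quotient_carr quotient_add quotient_scale quotient_act quotient_unit quotient_pcomp
        r M unit_closed pcomp_closed operad_homD[OF h] simp del: One_nat_def)
  ultimately show "operad_iso Q S (\<lambda>n X. \<phi> n (rep X))"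
    using S operad_quotient by (simp add: operad_iso_iff_hom)
qed

text \<open>
  An isomorphism carries the ideal generated by \<open>R\<close> onto the ideal generated by the image of \<open>R\<close>: one
  inclusion comes from \<open>\<phi>\<close>, the other from its inverse.
\<close>

lemma operad_iso_quotient:
  assumes iso: "operad_iso P Q \<phi>" and R: "\<And>n. R n \<subseteq> carr (ops P n)"
  defines "J \<equiv> operad_ideal P R" and "K \<equiv> operad_ideal Q (\<lambda>n. \<phi> n ` R n)"
  shows "\<exists>\<theta>. operad_iso (quotient_operad P J) (quotient_operad Q K) \<theta> \<and>
    (\<forall>n. \<forall>x\<in>carr (ops P n). \<theta> n (coset P J n x) = coset Q K n (\<phi> n x))"
proof -
  have P: "operad P" and Q: "operad Q" and h: "operad_hom P Q \<phi>"
    and b: "bij_betw (\<phi> n) (carr (ops P n)) (carr (ops Q n))" for n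
    using iso by (simp_all add: operad_iso_iff_hom)
  let ?\<psi> = "\<lambda>n. inv_into (carr (ops P n)) (\<phi> n)"
  have h': "operad_hom Q P ?\<psi>"
    using operad_iso_inverse[OF iso] by (simp add: operad_iso_iff_hom)
  have inv: "?\<psi> n (\<phi> n x) = x" if "x \<in> carr (ops P n)" for n x
    using that b[of n] by (auto simp: bij_betw_def)
  have R': "\<phi> n ` R n \<subseteq> carr (ops Q n)" for n
    using R operad_homD(1)[OF h] by blast
  interpret J: operad_with_ideal P J
    unfolding J_def by (rule operad_ideal_ideal[OF P R])
  interpret K: operad_with_ideal Q K
    unfolding K_def by (rule operad_ideal_ideal[OF Q R'])
  have 1: "K n (\<phi> n x)" if "J n x" for n x
    by (rule operad_hom_ideal[OF P Q h R K.operad_with_ideal_axioms _ that[unfolded J_def]])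
       (auto simp: K_def intro: operad_ideal.base)
  have 2: "J n (?\<psi> n y)" if "K n y" for n y
  proof (rule operad_hom_ideal[OF Q P h' R' J.operad_with_ideal_axioms _ that[unfolded K_def]])
    fix n y assume "y \<in> \<phi> n ` R n"
    then show "J n (?\<psi> n y)" using R by (auto simp: inv subset_eq J_def intro: operad_ideal.base)
  qed
  have JK: "J n x \<longleftrightarrow> K n (\<phi> n x)" if "x \<in> carr (ops P n)" for n x
    using 1 2[of n "\<phi> n x"] inv[OF that] by auto
  have zero: "K.cl n y = vzero (ops K.Q n) \<longleftrightarrow> K n y" if "y \<in> carr (ops Q n)" for n y
  proof -
    interpret M: sn_module n "ops Q n" by (rule operad.module[OF Q])
    have "vminus (ops Q n) y (vzero (ops Q n)) = y"
      using M.minus_swap[of "vzero (ops Q n)" y] that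
      by (simp add: vminus_def M.closed M.add_zero M.scale_scale M.scale_one)
    then show ?thesis using that by (simp add: K.quotient_zero K.cl_eq_iff M.closed)
  qed
  have surj: "(\<lambda>x. K.cl n (\<phi> n x)) ` carr (ops P n) = carr (ops K.Q n)" for n
    using b[of n] by (simp add: bij_betw_def K.quotient_carr flip: image_image)
  have ker: "K.cl n (\<phi> n x) = vzero (ops K.Q n) \<longleftrightarrow> J n x" if "x \<in> carr (ops P n)" for n x
    using that by (simp add: JK zero operad_homD[OF h])
  note q = J.quotient_iso[OF K.operad_quotient operad_hom_comp[OF h K.quotient_hom] surj ker]
  show ?thesis
    using q by blast
qed

text \<open>
  Once a free operad is identified with an operad \<open>S\<close>, the presented operad depends only on the image
  of its relations in \<open>S\<close>.
\<close>

lemma quadratic_operad_iso: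
  assumes E: "sn_module 2 E" and iso: "operad_iso (free_operad E) S \<phi>"
    and R: "R \<subseteq> carr (ops (free_operad E) 3)"
  defines "K \<equiv> operad_ideal S (\<lambda>n. if n = 3 then \<phi> 3 ` R else {})"
  shows "\<exists>\<theta>. operad_iso (quadratic_operad E R) (quotient_operad S K) \<theta> \<and>
    (\<forall>\<mu>\<in>carr E. \<theta> 2 (quadratic_incl E R \<mu>) = coset S K 2 (\<phi> 2 (free_incl E \<mu>)))"
proof -
  have K: "K = operad_ideal S (\<lambda>n. \<phi> n ` (if n = 3 then R else {}))"
    unfolding K_def by (rule arg_cong[where f = "operad_ideal S"]) (auto simp: fun_eq_iff)
  have "(if n = 3 then R else {}) \<subseteq> carr (ops (free_operad E) n)" for n using R by simp
  from operad_iso_quotient[OF iso this]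
  obtain \<theta> where "operad_iso (quadratic_operad E R) (quotient_operad S K) \<theta>"
    "\<forall>n. \<forall>x\<in>carr (ops (free_operad E) n).
      \<theta> n (coset (free_operad E) (quadratic_ideal E R) n x) = coset S K n (\<phi> n x)"
    unfolding K quadratic_operad_def quadratic_ideal_def by blast
  then show ?thesis
    using free_incl_carr[OF E] unfolding quadratic_incl_def by blast
qed

section \<open>Uniqueness of homomorphisms out of the tree operad\<close>

text \<open>
  The tree of the same shape whose leaves are numbered from left to right. Planar trees are the ones that
  can be built from corollas by composition alone; every other tree is a relabelling of a planar one.
\<close>

primrec planar :: "'v tree \<Rightarrow> 'v tree" where
  "planar (Leaf j) = Leaf 0"
| "planar (Vertex \<mu> s t) =
    Vertex \<mu> (planar s) (relabel ((+) (length (leaves s))) (planar t))"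

lemma relabel_Vertex: "relabel h (Vertex \<mu> s t) = Vertex \<mu> (relabel h s) (relabel h t)"
  by (simp add: relabel_def)

lemma leaves_relabel: "leaves (relabel h t) = map h (leaves t)"
  by (simp add: relabel_def leaves_subst concat_map_singleton)

lemma labels_relabel: "labels (relabel h t) = labels t"
  by (simp add: relabel_def labels_subst)

lemma leaves_planar: "leaves (planar t) = [0..<length (leaves t)]"
proof (induction t)
  case (Vertex \<mu> s t)
  then show ?case
    by (intro nth_equalityI) (auto simp: leaves_relabel nth_append)
qed simp

lemma labels_planar: "labels (planar t) = labels t"
  by (induction t) (auto simp: labels_relabel)

lemma planar_trees: "labels t \<subseteq> A \<Longrightarrow> planar t \<in> trees A (length (leaves t))"
  by (auto simp: trees_def leaves_planar labels_planar)

lemma relabel_planar: "relabel (\<lambda>i. leaves t ! i) (planar t) = t"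
proof (induction t)
  case (Vertex \<mu> s t)
  have "relabel (\<lambda>i. (leaves s @ leaves t) ! i) (planar s) = relabel (\<lambda>i. leaves s ! i) (planar s)"
    by (rule relabel_cong) (simp add: leaves_planar nth_append)
  moreover have "relabel (\<lambda>i. (leaves s @ leaves t) ! i) (relabel ((+) (length (leaves s))) (planar t)) =
      relabel (\<lambda>i. leaves t ! i) (planar t)"
    unfolding relabel_relabel by (rule relabel_cong) (simp add: nth_append)
  ultimately show ?case using Vertex by (simp add: relabel_def)
qed (simp add: relabel_def)

text \<open>
  The one-line notation of a permutation, continued by the identity beyond the end of the word.
\<close>

definition word_perm :: "nat list \<Rightarrow> nat \<Rightarrow> nat" where
  "word_perm w i = (if i < length w then w ! i else i)"

lemma word_perm_permutes:
  assumes "distinct w" "set w = {..<length w}"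
  shows "word_perm w permutes {..<length w}"
proof (rule bij_imp_permutes)
  show "bij_betw (word_perm w) {..<length w} {..<length w}"
    using bij_betw_nth[OF assms(1) refl assms(2)[symmetric]]
    by (rule bij_betw_cong[THEN iffD1, rotated]) (simp add: word_perm_def)
qed (simp add: word_perm_def)

lemma length_leaves_trees: "t \<in> trees A n \<Longrightarrow> length (leaves t) = n"
  using distinct_card[of "leaves t"] by (simp add: trees_def)

lemma word_perm_leaves_permutes: "t \<in> trees A n \<Longrightarrow> word_perm (leaves t) permutes {..<n}"
  using word_perm_permutes[of "leaves t"] length_leaves_trees[of t A n] by (auto simp: trees_def)

lemma tree_eq_act_planar:
  assumes "t \<in> trees A n"
  shows "Poly_Mapping.single t 1 = vact (ops (tree_operad A) n) (inv (word_perm (leaves t)))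
    (Poly_Mapping.single (planar t) (1 :: 'k::field))"
proof -
  have "relabel (word_perm (leaves t)) (planar t) = relabel (\<lambda>i. leaves t ! i) (planar t)"
    by (rule relabel_cong) (simp add: leaves_planar word_perm_def)
  then show ?thesis
    using permutes_inv_inv[OF word_perm_leaves_permutes[OF assms]]
    by (simp add: relabel_planar)
qed

lemma graft_Vertex: "graft n i (Vertex \<mu> s t) u = Vertex \<mu> (graft n i s u) (graft n i t u)"
  by (simp add: graft_def)

lemma graft_Leaf: "graft n i (Leaf j) u = (if j = i then relabel ((+) i) u else Leaf (shift n i j))"
  by (simp add: graft_def)

text \<open>
  Composition in the tree operad on basis vectors; it makes structural induction over planar trees
  possible.
\<close>

lemma bicomp_trees:
  "bicomp (tree_operad A) a b (corolla \<mu>) (Poly_Mapping.single s 1) (Poly_Mapping.single t 1) =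
    Poly_Mapping.single (Vertex \<mu> s (relabel ((+) a) t)) (1 :: 'k::field)"
proof -
  have 1: "graft b 1 (Vertex \<mu> (Leaf 0) (Leaf 1)) t = Vertex \<mu> (Leaf 0) (relabel Suc t)"
    by (simp add: graft_Vertex graft_Leaf shift_def) (rule relabel_cong, simp)
  have 2: "graft a 0 (relabel Suc t) s = relabel ((+) a) t"
    unfolding graft_def subst_relabel by (simp add: relabel_def shift_def add.commute)
  have 3: "graft a 0 (Leaf 0) s = s"
    by (simp add: graft_Leaf relabel_ident)
  show ?thesis
    unfolding bicomp_def corolla_def tree_operad_sel pm_extend_single pm_scale_simps 1
    unfolding graft_Vertex 2 3 by simp
qed

lemma pm_span_induct:
  assumes "P 0" "\<And>x y. P x \<Longrightarrow> P y \<Longrightarrow> P (x + y)" "\<And>c a. a \<in> Poly_Mapping.keys p \<Longrightarrow> P (Poly_Mapping.single a c)"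
  shows "P (p :: 'a \<Rightarrow>\<^sub>0 'k::field)"
proof -
  have "P (\<Sum>a\<in>B. Poly_Mapping.single a (Poly_Mapping.lookup p a))" if "B \<subseteq> Poly_Mapping.keys p" for B
    using finite_subset[OF that finite_keys] that
    by (induction B rule: finite_induct) (auto intro: assms)
  from this[OF subset_refl] show ?thesis
    using pm_extend_id[of p] by (simp add: pm_extend_def)
qed

text \<open>
  The uniqueness half of the universal property: corollas and the unit generate the tree operad, because
  a planar tree is an iterated composite of corollas and every tree is a planar one acted on by the
  permutation that its leaves spell out.
\<close>

lemma tree_operad_hom_eqI:
  fixes P :: "('k::field, 'w) operad_struct"
  assumes P: "operad P" and \<phi>: "operad_hom (tree_operad A) P \<phi>" and \<psi>: "operad_hom (tree_operad A) P \<psi>"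
    and eq: "\<And>\<mu>. \<mu> \<in> A \<Longrightarrow> \<phi> 2 (corolla \<mu>) = \<psi> 2 (corolla \<mu>)"
    and x: "x \<in> carr (ops (tree_operad A) n)"
  shows "\<phi> n x = \<psi> n x"
proof -
  let ?T = "tree_operad A :: ('k, 'a tree \<Rightarrow>\<^sub>0 'k) operad_struct"
  have T: "operad ?T" by (rule operad_tree_operad)
  have c: "(Poly_Mapping.single t c :: 'a tree \<Rightarrow>\<^sub>0 'k) \<in> carr (ops ?T m)" if "t \<in> trees A m" for t c m
    using that by auto
  have cor: "(corolla \<mu> :: 'a tree \<Rightarrow>\<^sub>0 'k) \<in> carr (ops ?T 2)" if "\<mu> \<in> A" for \<mu>
    unfolding corolla_def by (rule c) (use that in \<open>auto simp: trees_def\<close>)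
  have pl: "\<phi> (length (leaves t)) (Poly_Mapping.single (planar t) 1) =
      \<psi> (length (leaves t)) (Poly_Mapping.single (planar t) 1)" if "labels t \<subseteq> A" for t
    using that
  proof (induction t)
    case (Leaf j)
    then show ?case using operad_homD(5)[OF \<phi>] operad_homD(5)[OF \<psi>] by simp
  next
    case (Vertex \<mu> s t)
    then have \<mu>: "\<mu> \<in> A" and s: "planar s \<in> trees A (length (leaves s))"
      and t: "planar t \<in> trees A (length (leaves t))"
      by (simp_all add: planar_trees)
    show ?case
      using operad_hom_bicomp[OF T \<phi> cor[OF \<mu>] c[OF s, of 1] c[OF t, of 1]]
        operad_hom_bicomp[OF T \<psi> cor[OF \<mu>] c[OF s, of 1] c[OF t, of 1]] Vertex eq[OF \<mu>]
      by (simp add: bicomp_trees)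
  qed
  have tr: "\<phi> n (Poly_Mapping.single t 1) = \<psi> n (Poly_Mapping.single t 1)" if "t \<in> trees A n" for t
  proof -
    have "labels t \<subseteq> A" using that by (simp add: trees_def)
    then have "planar t \<in> trees A n" using planar_trees length_leaves_trees[OF that] by metis
    then show ?thesis
      unfolding tree_eq_act_planar[OF that]
      using pl[OF \<open>labels t \<subseteq> A\<close>] permutes_inv[OF word_perm_leaves_permutes[OF that]]
      by (simp add: operad_homD(4)[OF \<phi>] operad_homD(4)[OF \<psi>] c length_leaves_trees[OF that]
          del: tree_operad_sel)
  qed
  have "x \<in> carr (ops ?T n) \<and> \<phi> n x = \<psi> n x"
  proof (rule pm_span_induct[of _ x])
    show "0 \<in> carr (ops ?T n) \<and> \<phi> n 0 = \<psi> n 0"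
      using operad_hom_zero[OF T P \<phi>, of n] operad_hom_zero[OF T P \<psi>, of n] by simp
  next
    fix y z assume "y \<in> carr (ops ?T n) \<and> \<phi> n y = \<psi> n y" "z \<in> carr (ops ?T n) \<and> \<phi> n z = \<psi> n z"
    then show "y + z \<in> carr (ops ?T n) \<and> \<phi> n (y + z) = \<psi> n (y + z)"
      using operad_homD(2)[OF \<phi>, of y n z] operad_homD(2)[OF \<psi>, of y n z]
        sn_module.add_closed[OF operad.module[OF T], of y n z] by simp
  next
    fix a k assume "a \<in> Poly_Mapping.keys x"
    then have a: "a \<in> trees A n" using x by auto
    show "Poly_Mapping.single a k \<in> carr (ops ?T n) \<and>
        \<phi> n (Poly_Mapping.single a k) = \<psi> n (Poly_Mapping.single a k)"
      using operad_homD(3)[OF \<phi> c[OF a], of k 1] operad_homD(3)[OF \<psi> c[OF a], of k 1] tr[OF a] c[OF a]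
      by simp
  qed
  then show ?thesis ..
qed

section \<open>Multilinear substitution into trees\<close>

definition pm_vertex :: "'g \<Rightarrow> ('g tree \<Rightarrow>\<^sub>0 'k) \<Rightarrow> ('g tree \<Rightarrow>\<^sub>0 'k) \<Rightarrow> ('g tree \<Rightarrow>\<^sub>0 'k::field)" where
  "pm_vertex g p q = pm_extend (\<lambda>s. pm_extend (\<lambda>t. Poly_Mapping.single (Vertex g s t) 1) q) p"

primrec msubst :: "(nat \<Rightarrow> ('g tree \<Rightarrow>\<^sub>0 'k::field)) \<Rightarrow> 'g tree \<Rightarrow> ('g tree \<Rightarrow>\<^sub>0 'k)" where
  "msubst F (Leaf j) = F j"
| "msubst F (Vertex g s t) = pm_vertex g (msubst F s) (msubst F t)"

lemma pm_vertex_extend: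
  "pm_vertex g (pm_extend f p) (pm_extend h q) =
   pm_extend (\<lambda>s. pm_extend (\<lambda>t. pm_vertex g (f s) (h t)) q) p"
  unfolding pm_vertex_def pm_extend_extend
  by (subst (2) pm_extend_swap) (rule refl)

lemma pm_vertex_single [simp]:
  "pm_vertex g (Poly_Mapping.single s a) (Poly_Mapping.single t b) = Poly_Mapping.single (Vertex g s t) (a * b)"
  by (simp add: pm_vertex_def)

lemma pm_extend_pm_vertex:
  "pm_extend f (pm_vertex g p q) = pm_extend (\<lambda>s. pm_extend (\<lambda>t. f (Vertex g s t)) q) p"
  by (simp add: pm_vertex_def pm_extend_extend)

lemma pm_extend_msubst_vertex:
  "pm_extend (msubst F) (pm_vertex g p q) = pm_vertex g (pm_extend (msubst F) p) (pm_extend (msubst F) q)"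
  by (simp add: pm_extend_pm_vertex pm_vertex_extend)

lemma msubst_single: "msubst (\<lambda>j. Poly_Mapping.single (G j) 1) u = Poly_Mapping.single (subst G u) 1"
  by (induction u) auto

text \<open>
  When only one leaf receives a linear combination, multilinear substitution is linear in it, provided
  that this leaf occurs once. Grafting is of this kind.
\<close>

lemma msubst_one:
  "msubst (\<lambda>j. if j = i then pm_extend (\<lambda>t. Poly_Mapping.single (h t) 1) q else Poly_Mapping.single (G j) 1) u =
   (if i \<in> set (leaves u) then pm_extend (\<lambda>t. Poly_Mapping.single (subst (\<lambda>j. if j = i then h t else G j) u) 1) q
    else Poly_Mapping.single (subst G u) 1)"
  if "distinct (leaves u)"
  using that
proof (induction u)
  case (Vertex g u v)
  have *: "subst (\<lambda>j. if j = i then h t else G j) w = subst G w" if "i \<notin> set (leaves w)" for t w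
    by (rule subst_cong) (use that in auto)
  show ?case
    using Vertex by (auto simp: * pm_vertex_def pm_extend_extend)
qed simp

section \<open>The free operad on a free module\<close>

text \<open>
  A free \<open>S\<^sub>2\<close>-module with finite basis \<open>gn\<close>: \<open>co x g\<close> and \<open>co' x g\<close> are the coordinates of \<open>x\<close> along
  \<open>gn g\<close> and \<open>gn g \<cdot> (0 1)\<close>. Spanning is expressed by the generated submodule, so that identities which
  are linear and equivariant need to be checked on basis vectors only.
\<close>

locale free_S2_module = sn_module 2 E for E :: "('k::field, 'v) sn_mod" +
  fixes gn :: "'g::finite \<Rightarrow> 'v" and co co' :: "'v \<Rightarrow> 'g \<Rightarrow> 'k"
  assumes gn_carr: "gn g \<in> carr E"
    and gn_span: "carr E \<subseteq> sn_span 2 E (range gn)"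
    and co_add: "\<lbrakk>x \<in> carr E; y \<in> carr E\<rbrakk> \<Longrightarrow> co (vadd E x y) g = co x g + co y g"
      "\<lbrakk>x \<in> carr E; y \<in> carr E\<rbrakk> \<Longrightarrow> co' (vadd E x y) g = co' x g + co' y g"
    and co_scale: "x \<in> carr E \<Longrightarrow> co (vscale E c x) g = c * co x g"
      "x \<in> carr E \<Longrightarrow> co' (vscale E c x) g = c * co' x g"
    and co_swap: "x \<in> carr E \<Longrightarrow> co (vact E (transpose 0 1) x) g = co' x g"
      "x \<in> carr E \<Longrightarrow> co' (vact E (transpose 0 1) x) g = co x g"
    and co_gn: "co (gn g) h = (if g = h then 1 else 0)" "co' (gn g) h = 0"
begin

abbreviation A :: "('k, 'v tree \<Rightarrow>\<^sub>0 'k) operad_struct" where "A \<equiv> tree_operad (carr E)"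
abbreviation T :: "('k, 'g tree \<Rightarrow>\<^sub>0 'k) operad_struct" where "T \<equiv> tree_operad UNIV"

text \<open>
  The multilinear expansion of a tree. The coordinate along \<open>gn g \<cdot> (0 1)\<close> comes with exchanged subtrees,
  since \<open>(\<mu> \<cdot> (0 1))(x, y) = \<mu>(y, x)\<close>.
\<close>

primrec expand :: "'v tree \<Rightarrow> ('g tree \<Rightarrow>\<^sub>0 'k)" where
  "expand (Leaf j) = Poly_Mapping.single (Leaf j) 1"
| "expand (Vertex \<mu> s t) = (\<Sum>g\<in>UNIV. pm_scale (co \<mu> g) (pm_vertex g (expand s) (expand t)) +
      pm_scale (co' \<mu> g) (pm_vertex g (expand t) (expand s)))"

lemma expand_subst: "expand (subst F t) = pm_extend (msubst (\<lambda>j. expand (F j))) (expand t)"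
  by (induction t)
     (simp_all add: pm_extend_sum pm_extend_add pm_extend_scale pm_extend_msubst_vertex)

lemma expand_relabel: "expand (relabel h t) = pm_extend (\<lambda>u. Poly_Mapping.single (relabel h u) 1) (expand t)"
  unfolding relabel_def expand_subst by (intro pm_extend_cong refl) (simp add: msubst_single)

text \<open>
  Expansion exchanges subtrees but keeps the set of leaves, so it respects the arity.
\<close>

lemma keys_expand: "u \<in> Poly_Mapping.keys (expand t) \<Longrightarrow>
    set (leaves u) = set (leaves t) \<and> (distinct (leaves t) \<longrightarrow> distinct (leaves u))"
proof (induction t arbitrary: u)
  case (Vertex \<mu> s t)
  have v: "\<exists>a\<in>Poly_Mapping.keys p. \<exists>b\<in>Poly_Mapping.keys q. w = Vertex g a b"
    if w: "w \<in> Poly_Mapping.keys (pm_vertex g p q)" for w g and p q :: "'g tree \<Rightarrow>\<^sub>0 'k"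
  proof -
    obtain a where "a \<in> Poly_Mapping.keys p"
      "w \<in> Poly_Mapping.keys (pm_extend (\<lambda>t. Poly_Mapping.single (Vertex g a t) (1::'k)) q)"
      using w keys_pm_extend[of "\<lambda>s. pm_extend (\<lambda>t. Poly_Mapping.single (Vertex g s t) 1) q" p]
      unfolding pm_vertex_def by blast
    moreover from this(2) obtain b where "b \<in> Poly_Mapping.keys q"
      "w \<in> Poly_Mapping.keys (Poly_Mapping.single (Vertex g a b) (1::'k))"
      using keys_pm_extend[of "\<lambda>t. Poly_Mapping.single (Vertex g a t) (1::'k)" q] by blast
    ultimately show ?thesis by auto
  qed
  from Vertex.prems have "(\<Sum>g\<in>UNIV. Poly_Mapping.lookup (pm_scale (co \<mu> g) (pm_vertex g (expand s) (expand t)) +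
      pm_scale (co' \<mu> g) (pm_vertex g (expand t) (expand s))) u) \<noteq> 0"
    by (simp add: in_keys_iff lookup_sum)
  then obtain g where "Poly_Mapping.lookup (pm_scale (co \<mu> g) (pm_vertex g (expand s) (expand t)) +
      pm_scale (co' \<mu> g) (pm_vertex g (expand t) (expand s))) u \<noteq> 0"
    by (rule sum.not_neutral_contains_not_neutral)
  then have "u \<in> Poly_Mapping.keys (pm_vertex g (expand s) (expand t)) \<or>
      u \<in> Poly_Mapping.keys (pm_vertex g (expand t) (expand s))"
    by (auto simp: lookup_add in_keys_iff)
  then obtain a b where ab: "u = Vertex g a b"
    "a \<in> Poly_Mapping.keys (expand s) \<and> b \<in> Poly_Mapping.keys (expand t) \<or>
     a \<in> Poly_Mapping.keys (expand t) \<and> b \<in> Poly_Mapping.keys (expand s)"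
    by (blast dest: v)
  from ab(2) show ?case
  proof
    assume "a \<in> Poly_Mapping.keys (expand s) \<and> b \<in> Poly_Mapping.keys (expand t)"
    with Vertex.IH(1)[of a] Vertex.IH(2)[of b] show ?thesis by (simp add: ab(1))
  next
    assume "a \<in> Poly_Mapping.keys (expand t) \<and> b \<in> Poly_Mapping.keys (expand s)"
    with Vertex.IH(1)[of b] Vertex.IH(2)[of a] show ?thesis by (auto simp: ab(1))
  qed
qed auto

lemma keys_expand_trees: "t \<in> trees B n \<Longrightarrow> Poly_Mapping.keys (expand t) \<subseteq> trees UNIV n"
  using keys_expand by (auto simp: trees_def)

lemma expand_graft:
  assumes "i < m" "s \<in> trees B m"
  shows "expand (graft n i s t) =
    pm_extend (\<lambda>u. pm_extend (\<lambda>v. Poly_Mapping.single (graft n i u v) 1) (expand t)) (expand s)"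
proof -
  have F: "(\<lambda>j. expand (if j = i then relabel ((+) i) t else Leaf (shift n i j))) =
    (\<lambda>j. if j = i then pm_extend (\<lambda>u. Poly_Mapping.single (relabel ((+) i) u) 1) (expand t)
        else Poly_Mapping.single (Leaf (shift n i j)) 1)"
    by (auto simp: expand_relabel)
  show ?thesis
    unfolding graft_def expand_subst F
    by (rule pm_extend_cong[OF refl], subst msubst_one)
       (use keys_expand_trees[OF assms(2)] assms(1) in \<open>auto simp: trees_def\<close>)
qed

definition exp_hom :: "nat \<Rightarrow> ('v tree \<Rightarrow>\<^sub>0 'k) \<Rightarrow> ('g tree \<Rightarrow>\<^sub>0 'k)" where
  "exp_hom n = pm_extend expand"

lemma exp_hom: "operad_hom A T exp_hom"
  unfolding operad_hom_def
proof (intro conjI allI ballI impI)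
  fix n x assume "x \<in> carr (ops A n)"
  then have "(\<Union>t\<in>Poly_Mapping.keys x. Poly_Mapping.keys (expand t)) \<subseteq> trees UNIV n"
    by (intro UN_least keys_expand_trees) auto
  then show "exp_hom n x \<in> carr (ops T n)"
    using keys_pm_extend[of expand x] by (simp add: exp_hom_def)
next
  fix m n i p q assume A: "p \<in> carr (ops A m)" "q \<in> carr (ops A n)" "i < m"
  have s: "s \<in> trees (carr E) m" if "s \<in> Poly_Mapping.keys p" for s using A(1) that by auto
  show "exp_hom (m + n - 1) (pcomp A m n i p q) = pcomp T m n i (exp_hom m p) (exp_hom n q)"
    unfolding exp_hom_def tree_operad_sel pm_extend_extend pm_extend_single pm_scale_simps
    by (subst (2) pm_extend_swap) (intro pm_extend_cong refl, simp add: expand_graft[OF A(3) s])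
qed (simp_all add: exp_hom_def pm_extend_add pm_extend_scale pm_extend_extend expand_relabel)

text \<open>
  A section of \<open>exp_hom\<close>: a symbol is read as the basis vector with that name.
\<close>

definition sec_hom :: "nat \<Rightarrow> ('g tree \<Rightarrow>\<^sub>0 'k) \<Rightarrow> ('v tree \<Rightarrow>\<^sub>0 'k)" where
  "sec_hom n = pm_extend (\<lambda>t. Poly_Mapping.single (map_tree gn t) 1)"

lemma map_tree_subst: "map_tree gn (subst F t) = subst (\<lambda>j. map_tree gn (F j)) (map_tree gn t)"
  by (induction t) auto

lemma map_tree_relabel: "map_tree gn (relabel h t) = relabel h (map_tree gn t)"
  by (simp add: relabel_def map_tree_subst)

lemma map_tree_graft: "map_tree gn (graft n i s t) = graft n i (map_tree gn s) (map_tree gn t)"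
  unfolding graft_def map_tree_subst by (intro subst_cong) (simp add: map_tree_relabel)

lemma leaves_map_tree: "leaves (map_tree f t) = leaves t"
  by (induction t) auto

lemma labels_map_tree: "labels (map_tree f t) = f ` labels t"
  by (induction t) auto

lemma sec_hom: "operad_hom T A sec_hom"
proof -
  have "map_tree gn t \<in> trees (carr E) n" if "t \<in> trees UNIV n" for t n
    using that gn_carr by (auto simp: trees_def leaves_map_tree labels_map_tree)
  then have "Poly_Mapping.keys (sec_hom n x) \<subseteq> trees (carr E) n"
    if "Poly_Mapping.keys x \<subseteq> trees UNIV n" for n x
    unfolding sec_hom_def by (rule keys_pm_extend_singles) (use that in auto)
  then show ?thesis
    unfolding operad_hom_def
    by (simp add: sec_hom_def pm_extend_add pm_extend_scale pm_extend_extend map_tree_relabel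
        map_tree_graft)
qed

lemma expand_map_tree: "expand (map_tree gn t) = Poly_Mapping.single t 1"
proof (induction t)
  case (Vertex g s t)
  have "(\<Sum>h\<in>UNIV. pm_scale (if g = h then 1 else 0 :: 'k) (Poly_Mapping.single (Vertex h s t) 1)) =
      (\<Sum>h\<in>UNIV. if g = h then Poly_Mapping.single (Vertex g s t) 1 else 0)"
    by (rule sum.cong) auto
  then show ?case using Vertex by (simp add: co_gn)
qed simp

lemma exp_sec: "exp_hom n (sec_hom n x) = x"
  by (simp add: exp_hom_def sec_hom_def pm_extend_extend expand_map_tree pm_extend_id)

lemma expand_corolla: "exp_hom n (corolla \<mu>) = (\<Sum>g\<in>UNIV. Poly_Mapping.single (Vertex g (Leaf 0) (Leaf 1)) (co \<mu> g) +
    Poly_Mapping.single (Vertex g (Leaf 1) (Leaf 0)) (co' \<mu> g))"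
  by (simp add: exp_hom_def corolla_def)

lemma exp_corolla_gn: "exp_hom n (corolla (gn g)) = corolla g"
  using expand_map_tree[of "Vertex g (Leaf 0) (Leaf 1)"] by (simp add: exp_hom_def corolla_def)

lemma E_module: "sn_module 2 E" by (rule sn_module_axioms)

interpretation I: operad_with_ideal A "free_ideal E"
  by (rule operad_free_ideal[OF E_module])

lemma permutes_2: "\<sigma> permutes {..<2::nat} \<longleftrightarrow> \<sigma> = id \<or> \<sigma> = transpose 0 1"
proof -
  have "{..<2::nat} = {0, 1}" by auto
  then show ?thesis by (simp add: permutes_doubleton_iff)
qed

text \<open>
  The free operad was defined so that this inclusion is a homomorphism of \<open>S\<^sub>2\<close>-modules: each defining
  relation is one of the following equations.
\<close>

lemma free_incl_add: "\<lbrakk>x \<in> carr E; y \<in> carr E\<rbrakk> \<Longrightarrow>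
    free_incl E (vadd E x y) = vadd (ops (free_operad E) 2) (free_incl E x) (free_incl E y)"
  and free_incl_scale: "x \<in> carr E \<Longrightarrow>
    free_incl E (vscale E c x) = vscale (ops (free_operad E) 2) c (free_incl E x)"
  and free_incl_act: "\<lbrakk>\<sigma> permutes {..<2}; x \<in> carr E\<rbrakk> \<Longrightarrow>
    free_incl E (vact E \<sigma> x) = vact (ops (free_operad E) 2) \<sigma> (free_incl E x)"
proof -
  note M = sn_module.closed[OF I.module, where n = 2] corolla_carr
  have M': "corolla x + corolla y \<in> carr (ops A 2)" "pm_scale c (corolla x) \<in> carr (ops A 2)"
    if "x \<in> carr E" "y \<in> carr E" for x y c
    using M(2)[OF that[THEN corolla_carr]] M(3)[OF that(1)[THEN corolla_carr], of c] by simp_all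
  have d: "vminus (ops A 2) p q = p - q" for p q
    by (simp add: vminus_def pm_scale_uminus)
  have rel: "free_ideal E 2 r" if "r \<in> free_relations E 2" for r
    unfolding free_ideal_def by (rule operad_ideal.base[where R = "free_relations E", OF that])
  have rels: "\<lbrakk>x \<in> carr E; y \<in> carr E\<rbrakk> \<Longrightarrow> corolla (vadd E x y) - (corolla x + corolla y) \<in> free_relations E 2"
    "x \<in> carr E \<Longrightarrow> corolla (vscale E c x) - pm_scale c (corolla x) \<in> free_relations E 2"
    "\<lbrakk>\<sigma> permutes {..<2}; x \<in> carr E\<rbrakk> \<Longrightarrow>
      corolla (vact E \<sigma> x) - vact (ops A 2) \<sigma> (corolla x) \<in> free_relations E 2" for x y c \<sigma>
    unfolding free_relations_def if_P[OF refl] by blast+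
  show "free_incl E (vadd E x y) = vadd (ops (free_operad E) 2) (free_incl E x) (free_incl E y)"
    if "x \<in> carr E" "y \<in> carr E"
    unfolding free_incl_def free_operad_def I.quotient_add[OF corolla_carr[OF that(1)] corolla_carr[OF that(2)]]
    by (subst I.cl_eq_iff)
       (use that in \<open>simp_all add: M M' closed d rel rels del: tree_operad_sel(1)\<close>)
  show "free_incl E (vscale E c x) = vscale (ops (free_operad E) 2) c (free_incl E x)"
    if "x \<in> carr E"
    unfolding free_incl_def free_operad_def I.quotient_scale[OF corolla_carr[OF that(1)]]
    by (subst I.cl_eq_iff)
       (use that in \<open>simp_all add: M M' closed d rel rels del: tree_operad_sel(1)\<close>)
  show "free_incl E (vact E \<sigma> x) = vact (ops (free_operad E) 2) \<sigma> (free_incl E x)"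
    if "\<sigma> permutes {..<2}" "x \<in> carr E"
    unfolding free_incl_def free_operad_def I.quotient_act[OF corolla_carr[OF that(2)] that(1)]
    by (subst I.cl_eq_iff)
       (use that in \<open>simp_all add: M closed d rel rels del: tree_operad_sel(1,5)\<close>)
qed

lemma exp_corolla_add: "\<lbrakk>x \<in> carr E; y \<in> carr E\<rbrakk> \<Longrightarrow>
    exp_hom n (corolla (vadd E x y)) = exp_hom n (corolla x) + exp_hom n (corolla y)"
  by (simp add: expand_corolla co_add single_add flip: sum.distrib) (simp add: algebra_simps)

lemma exp_corolla_scale: "x \<in> carr E \<Longrightarrow>
    exp_hom n (corolla (vscale E c x)) = pm_scale c (exp_hom n (corolla x))"
  by (simp add: expand_corolla co_scale pm_scale_sum pm_scale_add)

lemma exp_corolla_act: "\<lbrakk>\<sigma> permutes {..<2}; x \<in> carr E\<rbrakk> \<Longrightarrow>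
    exp_hom 2 (corolla (vact E \<sigma> x)) = vact (ops T 2) \<sigma> (exp_hom 2 (corolla x))"
  by (auto simp: permutes_2 act_id pm_extend_id relabel_ident expand_corolla co_swap[unfolded One_nat_def] relabel_Vertex pm_extend_sum
      pm_extend_add add.commute)

lemma exp_ideal: "free_ideal E n x \<Longrightarrow> exp_hom n x = 0"
proof -
  have T: "operad T" by (rule operad_tree_operad)
  have "free_relations E k \<subseteq> carr (ops A k)" for k
    using I.J_carr by (auto simp: free_ideal_def simp del: tree_operad_sel intro: operad_ideal.base)
  moreover have "exp_hom k r = vzero (ops T k)" if "r \<in> free_relations E k" for k r
  proof -
    have m: "exp_hom k (p - q) = exp_hom k p - exp_hom k q" for p q
      using pm_extend_add[of expand "p - q" q] by (simp add: exp_hom_def eq_diff_eq)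
    have k: "k = 2" using that by (auto simp: free_relations_def split: if_splits)
    have a: "exp_hom k (p + q) = exp_hom k p + exp_hom k q" "exp_hom k (pm_scale c p) = pm_scale c (exp_hom k p)" for p q c
      by (simp_all add: exp_hom_def pm_extend_add pm_extend_scale)
    have b: "exp_hom 2 (vact (ops A 2) \<sigma> (corolla \<mu>)) = vact (ops T 2) \<sigma> (exp_hom 2 (corolla \<mu>))"
      if "\<mu> \<in> carr E" "\<sigma> permutes {..<2}" for \<sigma> \<mu>
      using operad_homD(4)[OF exp_hom that(2) corolla_carr[OF that(1)]] .
    show ?thesis
      using that unfolding k free_relations_def
      by (auto simp: m[unfolded k] a[unfolded k] b exp_corolla_add exp_corolla_scale exp_corolla_act
          simp del: tree_operad_sel(5))
  qed
  ultimately show "free_ideal E n x \<Longrightarrow> exp_hom n x = 0"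
    using operad_hom_ideal[OF operad_tree_operad T exp_hom _ operad_zero_ideal[OF T], of "free_relations E" n x]
    by (simp add: free_ideal_def)
qed

text \<open>
  Expanding a tree and reading the result back as a tree over \<open>E\<close> changes nothing modulo the relations of
  the free operad: both sides are homomorphisms into the free operad, and on corollas they are linear and
  equivariant and agree on the basis. Hence an element with zero expansion is zero in the free operad.
\<close>

lemma exp_kernel:
  assumes "x \<in> carr (ops A n)"
  shows "exp_hom n x = vzero (ops T n) \<longleftrightarrow> free_ideal E n x"
proof
  note F = I.operad_quotient
  let ?\<psi> = "\<lambda>n x. I.cl n (sec_hom n (exp_hom n x))"
  have h: "operad_hom A I.Q ?\<psi>"
    by (rule operad_hom_comp[OF operad_hom_comp[OF exp_hom sec_hom] I.quotient_hom])
  have cor: "?\<psi> 2 (corolla \<mu>) = I.cl 2 (corolla \<mu>)" if "\<mu> \<in> carr E" for \<mu>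
  proof -
    have gh: "operad_hom T I.Q (\<lambda>n x. I.cl n (sec_hom n x))"
      by (rule operad_hom_comp[OF sec_hom I.quotient_hom])
    have ecc: "exp_hom 2 (corolla x) \<in> carr (ops T 2)" if "x \<in> carr E" for x
      using operad_homD(1)[OF exp_hom corolla_carr[OF that]] .
    \<comment> \<open>both sides are linear and equivariant in \<open>\<mu>\<close>, so it suffices to compare them on the basis\<close>
    have "\<mu> \<in> sn_span 2 E (range gn)" using that gn_span by blast
    then have "\<mu> \<in> carr E \<and> ?\<psi> 2 (corolla \<mu>) = free_incl E \<mu>"
    proof induction
      case (base x)
      then obtain g where "x = gn g" by auto
      moreover have "sec_hom 2 (corolla g) = corolla (gn g)" by (simp add: sec_hom_def corolla_def)
      ultimately show ?case by (simp add: gn_carr exp_corolla_gn free_incl_def)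
    next
      case zero
      have "vzero E = vscale E 0 (vzero E)" by (simp add: scale_0 zero_closed)
      moreover have "?\<psi> 2 (corolla (vscale E 0 (vzero E))) = vscale (ops I.Q 2) 0 (?\<psi> 2 (corolla (vzero E)))"
        using operad_homD(3)[OF gh ecc[OF zero_closed], of 0] exp_corolla_scale[OF zero_closed, of 2 0]
        by simp
      ultimately show ?case
        using free_incl_scale[OF zero_closed, of 0] operad_homD(1)[OF h corolla_carr[OF zero_closed]]
          free_incl_carr[OF E_module zero_closed]
        by (simp add: free_operad_def zero_closed sn_module.scale_0[OF operad.module[OF F]] del: tree_operad_sel)
    next
      case (add x y)
      then show ?case
        using operad_homD(2)[OF gh ecc[of x] ecc[of y]] free_incl_add[of x y]
        by (simp add: exp_corolla_add closed free_operad_def)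
    next
      case (scale x c)
      then show ?case
        using operad_homD(3)[OF gh ecc[of x]] free_incl_scale[of x c]
        by (simp add: exp_corolla_scale closed free_operad_def)
    next
      case (act \<sigma> x)
      then show ?case
        using operad_homD(4)[OF gh act(1) ecc[of x]] free_incl_act[of \<sigma> x]
        by (simp add: exp_corolla_act closed free_operad_def del: tree_operad_sel)
    qed
    then show ?thesis by (simp add: free_incl_def)
  qed
  assume x: "exp_hom n x = vzero (ops T n)"
  have "I.cl n x = ?\<psi> n x"
    by (rule tree_operad_hom_eqI[OF F I.quotient_hom h cor[symmetric] assms])
  also have "\<dots> = I.cl n 0" unfolding x by (simp add: sec_hom_def)
  finally show "free_ideal E n x"
    using assms by (subst (asm) I.cl_eq_iff) (auto simp: vminus_def)
qed (simp add: exp_ideal)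

text \<open>
  The identification of the free operad on \<open>E\<close> with the operad of trees labelled by symbols.
\<close>

definition gen_iso :: "nat \<Rightarrow> ('v tree \<Rightarrow>\<^sub>0 'k) set \<Rightarrow> ('g tree \<Rightarrow>\<^sub>0 'k)" where
  "gen_iso n X = exp_hom n (rep X)"

lemma gen_iso: "operad_iso (free_operad E) T gen_iso"
  and gen_iso_incl: "gen_iso 2 (free_incl E (gn g)) = corolla g"
proof -
  have surj: "exp_hom n ` carr (ops A n) = carr (ops T n)" for n
    using operad_homD(1)[OF exp_hom] operad_homD(1)[OF sec_hom] exp_sec
    by (metis (no_types, lifting) image_eqI image_subsetI subsetI subset_antisym)
  note q = I.quotient_iso[OF operad_tree_operad exp_hom surj exp_kernel]
  show "operad_iso (free_operad E) T gen_iso"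
    using q(1) by (simp add: free_operad_def gen_iso_def[abs_def])
  show "gen_iso 2 (free_incl E (gn g)) = corolla g"
    using q(2)[OF _ corolla_carr[OF gn_carr]] by (simp add: free_incl_def gen_iso_def exp_corolla_gn)
qed

lemma rep_carr: "X \<in> carr (ops (free_operad E) n) \<Longrightarrow> rep X \<in> carr (ops A n)"
  unfolding free_operad_def I.quotient_carr using I.rep_cl(1) by auto

end

section \<open>Linear functionals on formal linear combinations\<close>

text \<open>
  The linear extension of \<open>h\<close>. Coefficients of expansions and the form on \<open>T(3)\<close> are functionals of this
  kind, so that they can be computed by recursion along a tree.
\<close>

definition pm_eval :: "('a \<Rightarrow> 'k) \<Rightarrow> ('a \<Rightarrow>\<^sub>0 'k) \<Rightarrow> 'k::field" where
  "pm_eval h p = (\<Sum>a\<in>Poly_Mapping.keys p. Poly_Mapping.lookup p a * h a)"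

lemma pm_eval_superset:
  assumes "finite S" "Poly_Mapping.keys p \<subseteq> S"
  shows "pm_eval h p = (\<Sum>a\<in>S. Poly_Mapping.lookup p a * h a)"
  unfolding pm_eval_def by (rule sum.mono_neutral_left) (use assms in \<open>auto simp: in_keys_iff\<close>)

lemma pm_eval_zero [simp]: "pm_eval h 0 = 0"
  by (simp add: pm_eval_def)

lemma pm_eval_single [simp]: "pm_eval h (Poly_Mapping.single a c) = c * h a"
  by (simp add: pm_eval_superset[of "{a}"])

lemma pm_eval_add: "pm_eval h (p + q) = pm_eval h p + pm_eval h q"
proof -
  have "Poly_Mapping.keys (p + q) \<subseteq> Poly_Mapping.keys p \<union> Poly_Mapping.keys q" by (rule keys_add)
  then show ?thesis
    by (simp add: pm_eval_superset[of "Poly_Mapping.keys p \<union> Poly_Mapping.keys q"]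
        lookup_add distrib_right sum.distrib)
qed

lemma pm_eval_scale: "pm_eval h (pm_scale c p) = c * pm_eval h p"
  using keys_pm_scale[of c p]
  by (simp add: pm_eval_superset[of "Poly_Mapping.keys p"] sum_distrib_left mult.assoc)

lemma pm_eval_sum: "pm_eval h (sum f S) = (\<Sum>a\<in>S. pm_eval h (f a))"
  by (induction S rule: infinite_finite_induct) (auto simp: pm_eval_add)

lemma pm_eval_extend: "pm_eval h (pm_extend f p) = pm_eval (\<lambda>a. pm_eval h (f a)) p"
  by (simp add: pm_extend_def pm_eval_sum pm_eval_scale) (simp add: pm_eval_def)

lemma pm_eval_cong: "(\<And>a. a \<in> Poly_Mapping.keys p \<Longrightarrow> f a = g a) \<Longrightarrow> pm_eval f p = pm_eval g p"
  unfolding pm_eval_def by (rule sum.cong) auto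

lemma lookup_pm_extend: "Poly_Mapping.lookup (pm_extend f p) b = pm_eval (\<lambda>a. Poly_Mapping.lookup (f a) b) p"
  by (simp add: pm_extend_def pm_eval_def lookup_sum)

lemma pm_eval_delta: "pm_eval (\<lambda>a. if a = b then c else 0) p = Poly_Mapping.lookup p b * c"
proof -
  have "pm_eval (\<lambda>a. if a = b then c else 0) p =
      (\<Sum>a\<in>Poly_Mapping.keys p. if a = b then Poly_Mapping.lookup p b * c else 0)"
    unfolding pm_eval_def by (rule sum.cong) auto
  then show ?thesis by (simp add: in_keys_iff)
qed

lemma pm_eval_mult: "pm_eval (\<lambda>a. c * f a) p = c * pm_eval f p"
  by (simp add: pm_eval_def sum_distrib_left mult.left_commute)

lemma lookup_pm_vertex [simp]:
  "Poly_Mapping.lookup (pm_vertex g p q) (Leaf j) = 0"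
  "Poly_Mapping.lookup (pm_vertex g p q) (Vertex g' s t) =
    (if g = g' then Poly_Mapping.lookup p s * Poly_Mapping.lookup q t else 0)"
proof -
  show "Poly_Mapping.lookup (pm_vertex g p q) (Leaf j) = 0"
    by (simp add: pm_vertex_def lookup_pm_extend lookup_single) (simp add: pm_eval_def)
  have "pm_eval (\<lambda>a. pm_eval (\<lambda>b. Poly_Mapping.lookup (Poly_Mapping.single (Vertex g a b) 1) (Vertex g' s t)) q) p =
    pm_eval (\<lambda>a. if a = s then (if g = g' then Poly_Mapping.lookup q t else 0) else 0) p"
  proof (rule pm_eval_cong)
    fix a
    have "pm_eval (\<lambda>b. Poly_Mapping.lookup (Poly_Mapping.single (Vertex g a b) 1) (Vertex g' s t)) q =
      pm_eval (\<lambda>b. if b = t then (if g = g' \<and> a = s then 1 else 0) else 0) q"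
      by (rule pm_eval_cong) (auto simp: lookup_single when_def)
    then show "pm_eval (\<lambda>b. Poly_Mapping.lookup (Poly_Mapping.single (Vertex g a b) 1) (Vertex g' s t)) q =
      (if a = s then if g = g' then Poly_Mapping.lookup q t else 0 else 0)"
      unfolding pm_eval_delta by simp
  qed
  then show "Poly_Mapping.lookup (pm_vertex g p q) (Vertex g' s t) =
    (if g = g' then Poly_Mapping.lookup p s * Poly_Mapping.lookup q t else 0)"
    by (simp add: pm_vertex_def lookup_pm_extend pm_eval_delta)
qed

lemma pm_eval_vertex:
  "pm_eval h (pm_vertex g p q) = pm_eval (\<lambda>u. pm_eval (\<lambda>v. h (Vertex g u v)) q) p"
  by (simp add: pm_vertex_def pm_eval_extend)

section \<open>Trees with three leaves and their bilinear form\<close>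

abbreviation "lcomb g h a b c \<equiv> Vertex g (Vertex h (Leaf a) (Leaf b)) (Leaf c)"
abbreviation "rcomb g h a b c \<equiv> Vertex g (Leaf a) (Vertex h (Leaf b) (Leaf c))"

text \<open>
  The words of leaves of the trees with three inputs.
\<close>

definition arr3 :: "nat \<Rightarrow> nat \<Rightarrow> nat \<Rightarrow> bool" where
  "arr3 a b c \<longleftrightarrow> distinct [a, b, c] \<and> {a, b, c} = {..<3}"

lemma arr3_cases:
  "arr3 a b c \<longleftrightarrow> (a, b, c) \<in> {(0,1,2), (0,2,1), (1,0,2), (1,2,0), (2,0,1), (2,1,0)}"
proof
  assume A: "arr3 a b c"
  then have "{a, b, c} = {..<3}" by (simp add: arr3_def)
  then have "a < 3" "b < 3" "c < 3" by blast+
  moreover have "k < 3 \<Longrightarrow> k = 0 \<or> k = 1 \<or> k = 2" for k :: nat by linarith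
  ultimately have "a = 0 \<or> a = 1 \<or> a = 2" "b = 0 \<or> b = 1 \<or> b = 2" "c = 0 \<or> c = 1 \<or> c = 2" by blast+
  moreover have "a \<noteq> b" "a \<noteq> c" "b \<noteq> c" using A by (simp_all add: arr3_def)
  ultimately show "(a, b, c) \<in> {(0,1,2), (0,2,1), (1,0,2), (1,2,0), (2,0,1), (2,1,0)}"
    by (elim disjE) (simp_all)
next
  have eq: "{..<3::nat} = {0,1,2}" by auto
  assume "(a, b, c) \<in> {(0,1,2), (0,2,1), (1,0,2), (1,2,0), (2,0,1), (2,1,0)}"
  then have "distinct [a, b, c] \<and> a \<in> {0,1,2} \<and> b \<in> {0,1,2} \<and> c \<in> {0,1,2} \<and>
      0 \<in> {a,b,c} \<and> 1 \<in> {a,b,c} \<and> 2 \<in> {a,b,c}"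
    by (elim insertE) (simp_all)
  then show "arr3 a b c" unfolding arr3_def eq by blast
qed

lemma arr3_perm: "arr3 a b c \<Longrightarrow> arr3 b a c" "arr3 a b c \<Longrightarrow> arr3 c a b" "arr3 a b c \<Longrightarrow> arr3 a c b"
  by (auto simp: arr3_def)

lemma arr3_permutes: "arr3 a b c \<Longrightarrow> word_perm [a, b, c] permutes {..<3}"
  using word_perm_permutes[of "[a, b, c]"] by (simp add: arr3_def numeral_3_eq_3)

lemma arr3_act: "\<sigma> permutes {..<3} \<Longrightarrow> arr3 a b c \<Longrightarrow> arr3 (\<sigma> a) (\<sigma> b) (\<sigma> c)"
proof -
  assume s: "\<sigma> permutes {..<3}" and a: "arr3 a b c"
  have "\<sigma> ` {a, b, c} = {..<3}" using a permutes_image[OF s] by (simp add: arr3_def)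
  then show ?thesis using a permutes_inj[OF s] by (auto simp: arr3_def inj_eq)
qed

lemma sign_word_perm_swap:
  assumes "arr3 a b c"
  shows "sign (word_perm [b, a, c]) = - sign (word_perm [a, b, c])"
    and "sign (word_perm [a, c, b]) = - sign (word_perm [a, b, c])"
proof -
  have p: "permutation (word_perm [a, b, c])"
    using arr3_permutes[OF assms] by (auto simp: permutation_permutes)
  have "word_perm [b, a, c] = word_perm [a, b, c] \<circ> transpose 0 1"
    "word_perm [a, c, b] = word_perm [a, b, c] \<circ> transpose 1 2"
    by (auto simp: word_perm_def transpose_def fun_eq_iff nth_Cons' less_Suc_eq numeral_3_eq_3)
  then show "sign (word_perm [b, a, c]) = - sign (word_perm [a, b, c])"
    "sign (word_perm [a, c, b]) = - sign (word_perm [a, b, c])"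
    by (simp_all add: sign_compose[OF p] permutation_swap_id sign_swap_id del: One_nat_def)
qed

lemma trees3_cases:
  assumes "t \<in> trees A 3"
  obtains (lcomb) \<mu> \<nu> a b c where "t = lcomb \<mu> \<nu> a b c" "arr3 a b c" "\<mu> \<in> A" "\<nu> \<in> A"
  | (rcomb) \<mu> \<nu> a b c where "t = rcomb \<mu> \<nu> a b c" "arr3 a b c" "\<mu> \<in> A" "\<nu> \<in> A"
proof -
  have pos: "0 < length (leaves s)" for s :: "'a tree" by (induction s) auto
  have one: "length (leaves s) = 1 \<Longrightarrow> \<exists>j. s = Leaf j" for s :: "'a tree"
    using pos by (cases s) (auto simp: add_is_1 neq0_conv[symmetric])
  have two: "length (leaves s) = 2 \<Longrightarrow> \<exists>\<nu> a b. s = Vertex \<nu> (Leaf a) (Leaf b)" for s :: "'a tree"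
  proof (cases s)
    case (Vertex \<nu> u v)
    assume "length (leaves s) = 2"
    then have "length (leaves u) + length (leaves v) = 2" using Vertex by simp
    then have "length (leaves u) = 1" "length (leaves v) = 1"
      using pos[of u] pos[of v] by linarith+
    then show ?thesis using one Vertex by blast
  qed simp
  have l: "length (leaves t) = 3" by (rule length_leaves_trees[OF assms])
  then obtain \<mu> u v where t: "t = Vertex \<mu> u v" by (cases t) auto
  have "length (leaves u) = 1 \<and> length (leaves v) = 2 \<or> length (leaves u) = 2 \<and> length (leaves v) = 1"
  proof -
    have "length (leaves u) + length (leaves v) = 3" using l t by simp
    then show ?thesis using pos[of u] pos[of v] by linarith
  qed
  then show thesis
  proof
    assume "length (leaves u) = 1 \<and> length (leaves v) = 2"
    then obtain a \<nu> b c where "u = Leaf a" "v = Vertex \<nu> (Leaf b) (Leaf c)" using one two by blast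
    then show thesis using rcomb[of \<mu> a \<nu> b c] assms t by (auto simp: trees_def arr3_def)
  next
    assume "length (leaves u) = 2 \<and> length (leaves v) = 1"
    then obtain c \<nu> a b where "v = Leaf c" "u = Vertex \<nu> (Leaf a) (Leaf b)" using one two by blast
    then show thesis using lcomb[of \<mu> \<nu> a b c] assms t by (auto simp: trees_def arr3_def)
  qed
qed

text \<open>
  The opposite signs of the two kinds of combs are those in
  \<open>\<langle>f \<circ> (g, I), \<mu> \<circ> (\<nu>, I)\<rangle> = f(\<mu>) g(\<nu>)\<close> and \<open>\<langle>f \<circ> (I, g), \<mu> \<circ> (I, \<nu>)\<rangle> = - f(\<mu>) g(\<nu>)\<close>. Other
  trees do not occur in arity 3.
\<close>

fun comb_sign :: "'g tree \<Rightarrow> int" where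
  "comb_sign (Vertex g (Vertex h (Leaf a) (Leaf b)) (Leaf c)) = sign (word_perm [a, b, c])"
| "comb_sign (Vertex g (Leaf a) (Vertex h (Leaf b) (Leaf c))) = - sign (word_perm [a, b, c])"
| "comb_sign _ = 0"

text \<open>
  The bilinear form that is diagonal in the basis of trees, with \<open>comb_sign\<close> on the diagonal.
\<close>

definition comb_form :: "('g tree \<Rightarrow>\<^sub>0 'k) \<Rightarrow> ('g tree \<Rightarrow>\<^sub>0 'k) \<Rightarrow> 'k::field" where
  "comb_form p q = pm_eval (\<lambda>u. of_int (comb_sign u) * Poly_Mapping.lookup q u) p"

lemma comb_form_right:
  "comb_form p 0 = 0"
  "comb_form p (q + r) = comb_form p q + comb_form p r"
  "comb_form p (pm_scale c q) = c * comb_form p q"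
  "comb_form p (Poly_Mapping.single u c) = Poly_Mapping.lookup p u * of_int (comb_sign u) * c"
proof -
  show "comb_form p 0 = 0" "comb_form p (pm_scale c q) = c * comb_form p q"
    by (simp_all add: comb_form_def mult.left_commute[of _ c] pm_eval_mult) (simp add: pm_eval_def)
  show "comb_form p (q + r) = comb_form p q + comb_form p r"
    by (simp add: comb_form_def lookup_add pm_eval_def algebra_simps sum.distrib)
  have "comb_form p (Poly_Mapping.single u c) = pm_eval (\<lambda>v. if v = u then of_int (comb_sign u) * c else 0) p"
    unfolding comb_form_def by (rule pm_eval_cong) (auto simp: lookup_single when_def)
  then show "comb_form p (Poly_Mapping.single u c) = Poly_Mapping.lookup p u * of_int (comb_sign u) * c"
    by (simp add: pm_eval_delta)
qed

lemma comb_form_right_sum: "comb_form p (sum f S) = (\<Sum>a\<in>S. comb_form p (f a))"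
  by (induction S rule: infinite_finite_induct) (auto simp: comb_form_right)

lemma comb_form_extend:
  "comb_form (pm_extend F p) (pm_extend G q) =
    (\<Sum>s\<in>Poly_Mapping.keys p. \<Sum>t\<in>Poly_Mapping.keys q.
      Poly_Mapping.lookup p s * Poly_Mapping.lookup q t * comb_form (F s) (G t))"
proof -
  have "comb_form (pm_extend F p) r = (\<Sum>s\<in>Poly_Mapping.keys p. Poly_Mapping.lookup p s * comb_form (F s) r)" for r
    by (simp add: comb_form_def pm_eval_extend) (simp add: pm_eval_def[of _ p])
  then show ?thesis
    by (subst sum.swap) (simp add: pm_extend_def[of G] comb_form_right_sum comb_form_right
        sum_distrib_left mult.assoc mult.left_commute)
qed

section \<open>The dual module and the pairing\<close>

context free_S2_module
begin

abbreviation "dual \<equiv> sn_dual 2 E"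
abbreviation "dual_gn \<equiv> \<lambda>g. \<lambda>x\<in>carr E. co x g"

text \<open>
  Coordinates of a functional with respect to the dual basis. The minus sign in \<open>dual_co'\<close> is the
  signature of the transposition, because \<open>f \<cdot> (0 1)\<close> is the functional \<open>x \<mapsto> - f(x \<cdot> (0 1))\<close>.
\<close>

definition dual_co :: "('v \<Rightarrow> 'k) \<Rightarrow> 'g \<Rightarrow> 'k" where
  "dual_co f g = f (gn g)"

definition dual_co' :: "('v \<Rightarrow> 'k) \<Rightarrow> 'g \<Rightarrow> 'k" where
  "dual_co' f g = - f (vact E (transpose 0 1) (gn g))"

lemma transpose_permutes: "transpose 0 1 permutes {..<2::nat}"
  by (simp add: permutes_2)

lemma swap_swap: "x \<in> carr E \<Longrightarrow> vact E (transpose 0 1) (vact E (transpose 0 1) x) = x"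
  using act_comp[OF transpose_permutes transpose_permutes, of x] by (simp add: act_id)

lemma dual_carrD:
  assumes "f \<in> carr dual"
  shows "\<lbrakk>x \<in> carr E; y \<in> carr E\<rbrakk> \<Longrightarrow> f (vadd E x y) = f x + f y"
    and "x \<in> carr E \<Longrightarrow> f (vscale E c x) = c * f x"
  using assms by (auto simp: sn_dual_def)

lemma dual_swap: "x \<in> carr E \<Longrightarrow> vact dual (transpose 0 1) f x = - f (vact E (transpose 0 1) x)"
  by (simp add: sn_dual_def sign_swap_id inv_swap_id)

text \<open>
  A functional is determined by its values on the basis vectors and on their images under the
  transposition. The induction runs over all functionals at once, as the step for the action replaces
  \<open>f\<close> by \<open>f \<cdot> (0 1)\<close>.
\<close>

lemma dual_expand:
  assumes "f \<in> carr dual" "x \<in> carr E"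
  shows "f x = (\<Sum>g\<in>UNIV. co x g * f (gn g) + co' x g * f (vact E (transpose 0 1) (gn g)))"
proof -
  interpret D: sn_module 2 dual by (rule sn_module_dual[OF E_module])
  have sp: "x \<in> carr E" if "x \<in> sn_span 2 E (range gn)" for x
    using sn_span_subset[OF E_module, of "range gn"] that gn_carr by blast
  have "x \<in> sn_span 2 E (range gn)" using assms(2) gn_span by blast
  then show ?thesis using assms(1)
  proof (induction arbitrary: f)
    case (base x)
    then obtain h where x: "x = gn h" by auto
    have "(\<Sum>g\<in>UNIV. co x g * f (gn g) + co' x g * f (vact E (transpose 0 1) (gn g))) =
        (\<Sum>g\<in>UNIV. if h = g then f (gn h) else 0)"
      unfolding x co_gn by (rule sum.cong) auto
    then show ?case by (simp add: x)
  next
    case zero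
    have z: "vzero E = vscale E 0 (vzero E)" by (simp add: scale_0 zero_closed)
    have "f (vzero E) = 0" "co (vzero E) g = 0" "co' (vzero E) g = 0" for g
      by (subst z, simp add: dual_carrD[OF zero] co_scale zero_closed)+
    then show ?case by simp
  next
    case (add x y)
    show ?case
      using sp[OF add(1)] sp[OF add(2)] add.IH(1)[OF add.prems] add.IH(2)[OF add.prems]
      by (simp add: dual_carrD[OF add.prems] co_add distrib_right sum.distrib)
  next
    case (scale x c)
    show ?case
      using sp[OF scale(1)] scale.IH[OF scale.prems]
      by (simp add: dual_carrD[OF scale.prems] co_scale sum_distrib_left distrib_left mult.assoc)
  next
    case (act \<sigma> x)
    note x = sp[OF act(2)]
    have f': "vact dual (transpose 0 1) f \<in> carr dual"
      by (rule D.act_closed[OF transpose_permutes act.prems])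
    from act(1) consider "\<sigma> = id" | "\<sigma> = transpose 0 1" by (auto simp: permutes_2)
    then show ?case
    proof cases
      case 1
      then show ?thesis using act.IH[OF act.prems] x by (simp add: act_id)
    next
      case 2
      have "- f (vact E (transpose 0 1) x) =
        (\<Sum>g\<in>UNIV. - (co x g * f (vact E (transpose 0 1) (gn g)) + co' x g * f (gn g)))"
        using act.IH[OF f'] x gn_carr
        by (simp add: dual_swap act_closed transpose_permutes swap_swap del: One_nat_def)
      then show ?thesis
        unfolding 2 co_swap[OF x] sum_negf by (simp add: add.commute)
    qed
  qed
qed

lemma dual_gn_carr: "dual_gn g \<in> carr dual"
  by (auto simp: sn_dual_def co_add co_scale closed)

lemma dual_free: "free_S2_module dual dual_gn dual_co dual_co'"
proof -
  interpret D: sn_module 2 dual by (rule sn_module_dual[OF E_module])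
  have cl: "vact E (transpose 0 1) (gn g) \<in> carr E" for g
    by (rule act_closed[OF transpose_permutes gn_carr])
  have span: "carr dual \<subseteq> sn_span 2 dual (range dual_gn)"
  proof
    fix f assume f: "f \<in> carr dual"
    have "(\<lambda>x\<in>carr E. \<Sum>g\<in>S. co x g * f (gn g) + co' x g * f (vact E (transpose 0 1) (gn g)))
        \<in> sn_span 2 dual (range dual_gn)" if "finite S" for S
      using that
    proof (induction S)
      case empty
      have "vzero dual = (\<lambda>x\<in>carr E. 0)" by (simp add: sn_dual_def)
      then show ?case unfolding sum.empty by (metis sn_span.zero)
    next
      case (insert g S)
      let ?a = "vscale dual (f (gn g)) (dual_gn g)"
      let ?b = "vscale dual (- f (vact E (transpose 0 1) (gn g))) (vact dual (transpose 0 1) (dual_gn g))"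
      let ?r = "\<lambda>x\<in>carr E. \<Sum>g\<in>S. co x g * f (gn g) + co' x g * f (vact E (transpose 0 1) (gn g))"
      have "vadd dual (vadd dual ?a ?b) ?r \<in> sn_span 2 dual (range dual_gn)"
        by (intro sn_span.add sn_span.scale sn_span.act[OF transpose_permutes] insert.IH sn_span.base) auto
      moreover have "vadd dual (vadd dual ?a ?b) ?r =
        (\<lambda>x\<in>carr E. \<Sum>g\<in>insert g S. co x g * f (gn g) + co' x g * f (vact E (transpose 0 1) (gn g)))"
        using insert.hyps
        by (auto simp: sn_dual_def sign_swap_id inv_swap_id co_swap act_closed transpose_permutes
            mult.commute simp del: One_nat_def intro!: restrict_ext)
      ultimately show ?case by (simp only:)
    qed
    from this[of UNIV] have "(\<lambda>x\<in>carr E. f x) \<in> sn_span 2 dual (range dual_gn)"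
      using dual_expand[OF f] by (simp cong: restrict_cong)
    moreover have "(\<lambda>x\<in>carr E. f x) = f" using f by (intro extensional_restrict) (simp add: sn_dual_def)
    ultimately show "f \<in> sn_span 2 dual (range dual_gn)" by simp
  qed
  show ?thesis
  proof
    show "dual_gn g \<in> carr dual" for g by (rule dual_gn_carr)
    show "carr dual \<subseteq> sn_span 2 dual (range dual_gn)" by (rule span)
  next
    fix f h g assume "f \<in> carr dual" "h \<in> carr dual"
    show "dual_co (vadd dual f h) g = dual_co f g + dual_co h g"
      "dual_co' (vadd dual f h) g = dual_co' f g + dual_co' h g"
      using gn_carr cl by (simp_all add: dual_co_def dual_co'_def sn_dual_def del: One_nat_def)
  next
    fix f g c assume f: "f \<in> carr dual"
    show "dual_co (vscale dual c f) g = c * dual_co f g" "dual_co' (vscale dual c f) g = c * dual_co' f g"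
      using gn_carr cl by (simp_all add: dual_co_def dual_co'_def sn_dual_def del: One_nat_def)
    show "dual_co (vact dual (transpose 0 1) f) g = dual_co' f g"
      "dual_co' (vact dual (transpose 0 1) f) g = dual_co f g"
      using gn_carr cl by (simp_all add: dual_co_def dual_co'_def dual_swap swap_swap del: One_nat_def)
  next
    fix g h
    show "dual_co (dual_gn g) h = (if g = h then 1 else 0)" "dual_co' (dual_gn g) h = 0"
      using gn_carr cl by (simp_all add: dual_co_def dual_co'_def co_gn co_swap del: One_nat_def)
  qed
qed

text \<open>
  This equation is why rewriting a right comb as a left comb, as in the definition of the pairing, does not
  change the expansion.
\<close>

lemma expand_flip: "\<mu> \<in> carr E \<Longrightarrow> expand (Vertex (vact E (transpose 0 1) \<mu>) s t) = expand (Vertex \<mu> t s)"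
  by (simp add: co_swap add.commute del: One_nat_def)

lemma lookup_expand_Vertex [simp]:
  "Poly_Mapping.lookup (expand (Vertex \<mu> s t)) (Vertex g u v) =
    co \<mu> g * (Poly_Mapping.lookup (expand s) u * Poly_Mapping.lookup (expand t) v) +
    co' \<mu> g * (Poly_Mapping.lookup (expand t) u * Poly_Mapping.lookup (expand s) v)"
  "Poly_Mapping.lookup (expand (Vertex \<mu> s t)) (Leaf j) = 0"
proof -
  have "Poly_Mapping.lookup (expand (Vertex \<mu> s t)) (Vertex g u v) =
    (\<Sum>h\<in>UNIV. if h = g then
      co \<mu> g * (Poly_Mapping.lookup (expand s) u * Poly_Mapping.lookup (expand t) v) +
      co' \<mu> g * (Poly_Mapping.lookup (expand t) u * Poly_Mapping.lookup (expand s) v) else 0)"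
    unfolding expand.simps lookup_sum by (rule sum.cong) (auto simp: lookup_add)
  then show "Poly_Mapping.lookup (expand (Vertex \<mu> s t)) (Vertex g u v) =
    co \<mu> g * (Poly_Mapping.lookup (expand s) u * Poly_Mapping.lookup (expand t) v) +
    co' \<mu> g * (Poly_Mapping.lookup (expand t) u * Poly_Mapping.lookup (expand s) v)" by simp
  show "Poly_Mapping.lookup (expand (Vertex \<mu> s t)) (Leaf j) = 0"
    by (simp add: lookup_sum lookup_add)
qed

lemma pm_eval_expand_Vertex: "pm_eval h (expand (Vertex \<mu> s t)) =
    (\<Sum>g\<in>UNIV. co \<mu> g * pm_eval (\<lambda>u. pm_eval (\<lambda>v. h (Vertex g u v)) (expand t)) (expand s) +
      co' \<mu> g * pm_eval (\<lambda>u. pm_eval (\<lambda>v. h (Vertex g u v)) (expand s)) (expand t))"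
  by (simp add: pm_eval_sum pm_eval_add pm_eval_scale pm_eval_vertex)

lemma left_comb_expand:
  assumes "t \<in> trees (carr E) 3"
  obtains \<mu> \<nu> a b c where "left_comb E t = (\<mu>, \<nu>, a, b, c)" "expand t = expand (lcomb \<mu> \<nu> a b c)"
    "\<mu> \<in> carr E" "\<nu> \<in> carr E" "arr3 a b c"
  using assms
proof (cases rule: trees3_cases)
  case (lcomb \<mu> \<nu> a b c)
  then show ?thesis using that by simp
next
  case (rcomb \<mu> \<nu> a b c)
  have "left_comb E t = (vact E (transpose 0 1) \<mu>, \<nu>, b, c, a)" by (simp add: rcomb)
  moreover have "expand t = expand (lcomb (vact E (transpose 0 1) \<mu>) \<nu> b c a)"
    unfolding expand_flip[OF rcomb(3)] rcomb(1) ..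
  ultimately show ?thesis
    using that rcomb act_closed[OF transpose_permutes rcomb(3)] by (metis arr3_perm(1,2))
qed

interpretation D: free_S2_module dual dual_gn dual_co dual_co'
  by (rule dual_free)

text \<open>
  Each tree expands into four families of combs, with leaf words \<open>abc\<close> and \<open>bac\<close> (left combs) and
  \<open>cab\<close> and \<open>cba\<close> (right combs). Their signs relative to \<open>sign abc\<close> are \<open>+\<close>, \<open>-\<close>, \<open>-\<close>, \<open>+\<close>. The sum
  therefore factors as the product of \<open>\<Sum>\<^sub>i (dual_co f i * co \<mu> i - dual_co' f i * co' \<mu> i)\<close>, which is
  \<open>f \<mu>\<close>, and of the analogous sum for \<open>g \<nu>\<close>.
\<close>

lemma comb_form_lcomb:
  assumes f: "f \<in> carr dual" "g \<in> carr dual" and \<mu>: "\<mu> \<in> carr E" "\<nu> \<in> carr E" and arr: "arr3 a b c"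
  shows "comb_form (D.expand (lcomb f g a b c)) (expand (lcomb \<mu> \<nu> a b c)) =
    of_int (sign (word_perm [a, b, c])) * f \<mu> * g \<nu>"
proof -
  have ne: "a \<noteq> b" "b \<noteq> a" "a \<noteq> c" "c \<noteq> a" "b \<noteq> c" "c \<noteq> b" using arr by (auto simp: arr3_def)
  define \<epsilon> :: 'k where "\<epsilon> = of_int (sign (word_perm [a, b, c]))"
  have s: "sign (word_perm [b, a, c]) = - sign (word_perm [a, b, c])"
    "sign (word_perm [c, a, b]) = sign (word_perm [a, b, c])"
    "sign (word_perm [c, b, a]) = - sign (word_perm [a, b, c])"
    using sign_word_perm_swap[OF arr] sign_word_perm_swap[OF arr3_perm(3)[OF arr]]
      sign_word_perm_swap[OF arr3_perm(2)[OF arr]]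
    by linarith+
  define S where "S = (\<Sum>j\<in>UNIV. dual_co g j * co \<nu> j - dual_co' g j * co' \<nu> j)"
  have inner: "(\<Sum>j\<in>UNIV. dual_co g j * (\<epsilon> * (x * co \<nu> j)) - dual_co' g j * (\<epsilon> * (x * co' \<nu> j))) = \<epsilon> * x * S" for x
    unfolding S_def sum_distrib_left by (rule sum.cong) (simp_all add: algebra_simps)
  have dual: "h x = (\<Sum>i\<in>UNIV. dual_co h i * co x i - dual_co' h i * co' x i)"
    if "h \<in> carr dual" "x \<in> carr E" for h x
    using dual_expand[OF that] by (simp add: dual_co_def dual_co'_def mult.commute del: One_nat_def)
  \<comment> \<open>the coefficient of \<open>u\<close> in the second expansion, weighted by the form\<close>
  define H where "H u = of_int (comb_sign u) * Poly_Mapping.lookup (expand (lcomb \<mu> \<nu> a b c)) u" for u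
  have H: "H (lcomb i j a b c) = \<epsilon> * (co \<mu> i * co \<nu> j)" "H (lcomb i j b a c) = - (\<epsilon> * (co \<mu> i * co' \<nu> j))"
    "H (rcomb i j c a b) = - (\<epsilon> * (co' \<mu> i * co \<nu> j))" "H (rcomb i j c b a) = \<epsilon> * (co' \<mu> i * co' \<nu> j)" for i j
    by (simp_all add: H_def lookup_single when_def ne s \<epsilon>_def del: expand.simps(2))
  have L: "(\<Sum>j\<in>UNIV. dual_co g j * H (lcomb i j a b c) + dual_co' g j * H (lcomb i j b a c)) =
      (\<Sum>j\<in>UNIV. dual_co g j * (\<epsilon> * (co \<mu> i * co \<nu> j)) - dual_co' g j * (\<epsilon> * (co \<mu> i * co' \<nu> j)))" for i
    by (rule sum.cong) (simp_all add: H)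
  have R: "(\<Sum>j\<in>UNIV. dual_co g j * H (rcomb i j c a b) + dual_co' g j * H (rcomb i j c b a)) =
      - (\<Sum>j\<in>UNIV. dual_co g j * (\<epsilon> * (co' \<mu> i * co \<nu> j)) - dual_co' g j * (\<epsilon> * (co' \<mu> i * co' \<nu> j)))" for i
    unfolding sum_negf[symmetric] by (rule sum.cong) (simp_all add: H)
  have "comb_form (D.expand (lcomb f g a b c)) (expand (lcomb \<mu> \<nu> a b c)) =
    (\<Sum>i\<in>UNIV.
      dual_co f i * (\<Sum>j\<in>UNIV. dual_co g j * H (lcomb i j a b c) + dual_co' g j * H (lcomb i j b a c)) +
      dual_co' f i * (\<Sum>j\<in>UNIV. dual_co g j * H (rcomb i j c a b) + dual_co' g j * H (rcomb i j c b a)))"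
    unfolding comb_form_def H_def[symmetric] D.pm_eval_expand_Vertex D.expand.simps(1) pm_eval_single mult_1 ..
  also have "\<dots> = (\<Sum>i\<in>UNIV.
      dual_co f i * (\<Sum>j\<in>UNIV. dual_co g j * (\<epsilon> * (co \<mu> i * co \<nu> j)) - dual_co' g j * (\<epsilon> * (co \<mu> i * co' \<nu> j))) -
      dual_co' f i * (\<Sum>j\<in>UNIV. dual_co g j * (\<epsilon> * (co' \<mu> i * co \<nu> j)) - dual_co' g j * (\<epsilon> * (co' \<mu> i * co' \<nu> j))))"
    by (simp only: L R mult_minus_right add_uminus_conv_diff)
  also have "\<dots> = \<epsilon> * (\<Sum>i\<in>UNIV. dual_co f i * co \<mu> i - dual_co' f i * co' \<mu> i) * S"
    unfolding inner sum_distrib_left sum_distrib_right by (rule sum.cong) (simp_all add: algebra_simps)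
  finally show ?thesis
    using dual[OF f(1) \<mu>(1)] dual[OF f(2) \<mu>(2)] by (simp add: \<epsilon>_def S_def)
qed

text \<open>
  All trees in the expansion of \<open>\<mu>(\<nu>(x\<^sub>a, x\<^sub>b), x\<^sub>c)\<close> have the leaf \<open>c\<close> attached to the root, so for different \<open>c\<close>
  the expansions have no tree in common.
\<close>

lemma comb_form_lcomb_apart:
  "c \<noteq> c' \<Longrightarrow> comb_form (D.expand (lcomb f g a b c)) (expand (lcomb \<mu> \<nu> a' b' c')) = 0"
  unfolding comb_form_def D.pm_eval_expand_Vertex
  by (simp add: lookup_single when_def del: expand.simps(2))

text \<open>
  Two left combs with the same outer leaf have the same inner leaves up to order, and the other order is
  absorbed by acting with the transposition on the inner operation. So everything reduces to two left combs
  with the same word of leaves.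
\<close>

lemma tree_pairing_expand:
  assumes "s \<in> trees (carr dual) 3" "t \<in> trees (carr E) 3"
  shows "tree_pairing E s t = comb_form (D.expand s) (expand t)"
proof -
  obtain f g a b c where s: "left_comb dual s = (f, g, a, b, c)" "D.expand s = D.expand (lcomb f g a b c)"
    and f: "f \<in> carr dual" "g \<in> carr dual" "arr3 a b c"
    using D.left_comb_expand[OF assms(1)] by metis
  obtain \<mu> \<nu> a' b' c' where t: "left_comb E t = (\<mu>, \<nu>, a', b', c')" "expand t = expand (lcomb \<mu> \<nu> a' b' c')"
    and \<mu>: "\<mu> \<in> carr E" "\<nu> \<in> carr E" "arr3 a' b' c'"
    using left_comb_expand[OF assms(2)] by metis
  have w: "(\<lambda>i. if i < 3 then [a, b, c] ! i else i) = word_perm [a, b, c]" for a b c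
    by (simp add: word_perm_def fun_eq_iff)
  have \<nu>': "vact E (transpose 0 1) \<nu> \<in> carr E" by (rule act_closed[OF transpose_permutes \<mu>(2)])
  consider "c \<noteq> c'" | "c = c'" "a = a'" "b = b'" | "c = c'" "a \<noteq> a'" "a' = b" "b' = a"
    using f(3) \<mu>(3) by (auto simp: arr3_cases)
  then show ?thesis
  proof cases
    case 1
    then show ?thesis
      by (simp add: tree_pairing_def s t comb_form_lcomb_apart del: expand.simps D.expand.simps)
  next
    case 2
    then show ?thesis
      using comb_form_lcomb[OF f(1,2) \<mu>(1,2) f(3)]
      by (simp add: tree_pairing_def s t w del: expand.simps D.expand.simps)
  next
    case 3
    have "expand (lcomb \<mu> \<nu> b a c) = expand (lcomb \<mu> (vact E (transpose 0 1) \<nu>) a b c)"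
      by (simp only: expand.simps(2)[of \<mu>] expand_flip[OF \<mu>(2)])
    then show ?thesis
      using comb_form_lcomb[OF f(1,2) \<mu>(1) \<nu>' f(3)] 3
      by (simp add: tree_pairing_def s t w del: expand.simps D.expand.simps)
  qed
qed

lemma pairing_eq_comb_form:
  assumes "X \<in> carr (ops (free_operad dual) 3)" "Y \<in> carr (ops (free_operad E) 3)"
  shows "pairing E X Y = comb_form (D.gen_iso 3 X) (gen_iso 3 Y)"
proof -
  have "s \<in> trees (carr dual) 3" if "s \<in> Poly_Mapping.keys (rep X)" for s
    using D.rep_carr[OF assms(1)] that by auto
  moreover have "t \<in> trees (carr E) 3" if "t \<in> Poly_Mapping.keys (rep Y)" for t
    using rep_carr[OF assms(2)] that by auto
  ultimately show ?thesis
    unfolding pairing_def gen_iso_def D.gen_iso_def exp_hom_def D.exp_hom_def comb_form_extend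
    by (intro sum.cong refl) (simp add: tree_pairing_expand)
qed

lemma annihilator_image:
  assumes "R \<subseteq> carr (ops (free_operad E) 3)"
  shows "D.gen_iso 3 ` annihilator E R = {x \<in> carr (ops T 3). \<forall>y\<in>gen_iso 3 ` R. comb_form x y = 0}"
proof -
  have "D.gen_iso 3 ` carr (ops (free_operad dual) 3) = carr (ops T 3)"
    using D.gen_iso by (simp add: operad_iso_iff_hom bij_betw_def)
  moreover have "annihilator E R = {X \<in> carr (ops (free_operad dual) 3).
      \<forall>y\<in>gen_iso 3 ` R. comb_form (D.gen_iso 3 X) y = 0}"
    using assms by (auto simp: annihilator_def pairing_eq_comb_form subset_eq)
  ultimately show ?thesis by (auto simp: image_iff)
qed

end

section \<open>Orthogonal complements of matchings between combs\<close>

abbreviation tree_ops :: "nat \<Rightarrow> ('k::field, 'g tree \<Rightarrow>\<^sub>0 'k) sn_mod" where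
  "tree_ops n \<equiv> ops (tree_operad UNIV) n"

definition left_op :: "'g \<times> 'g \<Rightarrow> 'g tree \<Rightarrow>\<^sub>0 'k::field" where
  "left_op = (\<lambda>(g, h). Poly_Mapping.single (lcomb g h 0 1 2) 1)"

definition right_op :: "'g \<times> 'g \<Rightarrow> 'g tree \<Rightarrow>\<^sub>0 'k::field" where
  "right_op = (\<lambda>(g, h). Poly_Mapping.single (rcomb g h 0 1 2) 1)"

text \<open>
  A set \<open>m\<close> of pairs \<open>((g, h), (g', h'))\<close> is read as the set of relations
  \<open>g \<circ> (h, I) = g' \<circ> (I, h')\<close>.
\<close>

definition match_relations :: "(('g \<times> 'g) \<times> ('g \<times> 'g)) set \<Rightarrow> ('g tree \<Rightarrow>\<^sub>0 'k::field) set" where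
  "match_relations m = (\<lambda>(l, r). left_op l - right_op r) ` m"

definition dual_match_relations :: "(('g \<times> 'g) \<times> ('g \<times> 'g)) set \<Rightarrow> ('g tree \<Rightarrow>\<^sub>0 'k::field) set" where
  "dual_match_relations m =
    match_relations m \<union> left_op ` (- Domain m) \<union> right_op ` (- Range m)"

text \<open>
  The linear equations that describe both the orthogonal complement of the relations of \<open>m\<close> and the span
  of the dual relations.
\<close>

definition antisym_coeffs :: "(('g \<times> 'g) \<times> ('g \<times> 'g)) set \<Rightarrow> ('g tree \<Rightarrow>\<^sub>0 'k::field) set" where
  "antisym_coeffs m = {p \<in> carr (tree_ops 3). \<forall>g h g' h' a b c. ((g, h), (g', h')) \<in> m \<longrightarrow> arr3 a b c \<longrightarrow>
    Poly_Mapping.lookup p (lcomb g h a b c) + Poly_Mapping.lookup p (rcomb g' h' a b c) = 0}"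

lemma tree_module: "sn_module n (tree_ops n)"
  by (rule operad.module[OF operad_tree_operad])

lemma lookup_act:
  fixes p :: "'v tree \<Rightarrow>\<^sub>0 'k::field"
  assumes "\<sigma> permutes {..<n}"
  shows "Poly_Mapping.lookup (vact (ops (tree_operad A) n) \<sigma> p) u = Poly_Mapping.lookup p (relabel \<sigma> u)"
proof -
  have "relabel (inv \<sigma>) t = u \<longleftrightarrow> t = relabel \<sigma> u" for t
    using permutes_inv_o[OF assms] by (auto simp: relabel_relabel relabel_ident)
  then have "pm_eval (\<lambda>a. Poly_Mapping.lookup (Poly_Mapping.single (relabel (inv \<sigma>) a) (1::'k)) u) p =
    pm_eval (\<lambda>a. if a = relabel \<sigma> u then 1 else 0) p"
    by (intro pm_eval_cong) (simp add: lookup_single when_def)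
  then show ?thesis by (simp add: lookup_pm_extend pm_eval_delta)
qed

lemma comb_sign_act:
  assumes "\<sigma> permutes {..<3}" "u \<in> trees A 3"
  shows "comb_sign (relabel \<sigma> u) = sign \<sigma> * comb_sign u"
proof -
  have w: "sign (word_perm [\<sigma> a, \<sigma> b, \<sigma> c]) = sign \<sigma> * sign (word_perm [a, b, c])" if "arr3 a b c" for a b c
  proof -
    have "\<sigma> i = i" if "\<not> i < 3" for i using assms(1) that by (simp add: permutes_def)
    then have "word_perm [\<sigma> a, \<sigma> b, \<sigma> c] = \<sigma> \<circ> word_perm [a, b, c]"
      by (auto simp: word_perm_def fun_eq_iff nth_Cons' numeral_3_eq_3)
    then show ?thesis
      using assms(1) arr3_permutes[OF that] by (auto simp: permutation_permutes intro!: sign_compose)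
  qed
  from assms(2) show ?thesis
    by (cases rule: trees3_cases) (simp_all add: relabel_Vertex w)
qed

text \<open>
  The form is invariant up to the signature, so that orthogonality to a set of relations entails
  orthogonality to the submodule generated by it.
\<close>

lemma comb_form_act:
  fixes p :: "'g tree \<Rightarrow>\<^sub>0 'k::field"
  assumes \<sigma>: "\<sigma> permutes {..<3}" and p: "p \<in> carr (tree_ops 3)"
  shows "comb_form (vact (tree_ops 3) \<sigma> p) (vact (tree_ops 3) \<sigma> q) = of_int (sign \<sigma>) * comb_form p q"
proof -
  have L: "comb_form (vact (tree_ops 3) \<sigma> p) r =
      pm_eval (\<lambda>u. of_int (comb_sign (relabel (inv \<sigma>) u)) * Poly_Mapping.lookup r (relabel (inv \<sigma>) u)) p" for r
    by (simp add: comb_form_def pm_eval_extend)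
  have s: "comb_sign (relabel (inv \<sigma>) u) = sign \<sigma> * comb_sign u" if "u \<in> Poly_Mapping.keys p" for u
  proof -
    have "permutation \<sigma>" using \<sigma> by (auto simp: permutation_permutes)
    moreover have "u \<in> trees UNIV 3" using p that by auto
    ultimately show ?thesis using comb_sign_act[OF permutes_inv[OF \<sigma>]] by (metis sign_inverse)
  qed
  have i: "relabel \<sigma> (relabel (inv \<sigma>) u) = u" for u :: "'g tree"
    by (simp add: relabel_relabel permutes_inv_o[OF \<sigma>] relabel_ident)
  show ?thesis
    unfolding L lookup_act[OF \<sigma>] i unfolding comb_form_def pm_eval_mult[symmetric]
    by (rule pm_eval_cong) (simp add: s mult.assoc)
qed

lemma comb_trees: "arr3 a b c \<Longrightarrow> lcomb g h a b c \<in> trees UNIV 3" "arr3 a b c \<Longrightarrow> rcomb g h a b c \<in> trees UNIV 3"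
  by (auto simp: trees_def arr3_def)

lemma arr3_012: "arr3 0 1 2"
  by (simp add: arr3_cases)

lemma comb_carr: "left_op l \<in> carr (tree_ops 3)" "right_op l \<in> carr (tree_ops 3)"
  using comb_trees[OF arr3_012] by (auto simp: left_op_def right_op_def split: prod.split)

lemma minus_carr: "p \<in> carr (tree_ops 3) \<Longrightarrow> q \<in> carr (tree_ops 3) \<Longrightarrow> p - q \<in> carr (tree_ops 3)"
  using sn_module.minus_closed[OF tree_module, of p 3 q] by (simp add: vminus_def pm_scale_uminus)

lemma match_relations_carr: "match_relations m \<subseteq> carr (tree_ops 3)"
  "dual_match_relations m \<subseteq> carr (tree_ops 3)"
  by (auto simp: match_relations_def dual_match_relations_def simp del: tree_operad_sel
      intro!: minus_carr comb_carr)

text \<open>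
  Up to the action of \<open>S\<^sub>3\<close> there is one left comb and one right comb for each pair of symbols.
\<close>

lemma act_combs:
  assumes "arr3 a b c"
  shows "vact (tree_ops 3) (inv (word_perm [a, b, c])) (left_op (g, h)) = Poly_Mapping.single (lcomb g h a b c) 1"
    and "vact (tree_ops 3) (inv (word_perm [a, b, c])) (right_op (g, h)) = Poly_Mapping.single (rcomb g h a b c) 1"
  using permutes_inv_inv[OF arr3_permutes[OF assms]]
  by (simp_all add: left_op_def right_op_def relabel_Vertex) (simp_all add: word_perm_def)

lemma act_minus: "vact (tree_ops n) \<sigma> (p - q) = vact (tree_ops n) \<sigma> p - vact (tree_ops n) \<sigma> q"
  using pm_extend_add[of "\<lambda>t. Poly_Mapping.single (relabel (inv \<sigma>) t) 1" "p - q" q]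
  by (simp add: eq_diff_eq)

lemma comb_in_span:
  assumes "arr3 a b c"
  shows "((g, h), (g', h')) \<in> m \<Longrightarrow> Poly_Mapping.single (lcomb g h a b c) 1 - Poly_Mapping.single (rcomb g' h' a b c) 1
      \<in> sn_span 3 (tree_ops 3) (match_relations m)"
    and "((g, h), (g', h')) \<in> m \<Longrightarrow> Poly_Mapping.single (lcomb g h a b c) 1 - Poly_Mapping.single (rcomb g' h' a b c) 1
      \<in> sn_span 3 (tree_ops 3) (dual_match_relations m)"
    and "(g, h) \<notin> Domain m \<Longrightarrow> Poly_Mapping.single (lcomb g h a b c) 1 \<in> sn_span 3 (tree_ops 3) (dual_match_relations m)"
    and "(g, h) \<notin> Range m \<Longrightarrow> Poly_Mapping.single (rcomb g h a b c) 1 \<in> sn_span 3 (tree_ops 3) (dual_match_relations m)"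
  unfolding act_combs[OF assms, symmetric] act_minus[symmetric]
  by (intro sn_span.act[OF permutes_inv[OF arr3_permutes[OF assms]]] sn_span.base;
      force simp: match_relations_def dual_match_relations_def)+

lemma span_sum:
  assumes "\<And>a. a \<in> S \<Longrightarrow> f a \<in> sn_span n (tree_ops n) R"
  shows "(\<Sum>a\<in>S. pm_scale (c a) (f a)) \<in> sn_span n (tree_ops n) R"
  using assms
proof (induction S rule: infinite_finite_induct)
  case (insert a S)
  then have "vadd (tree_ops n) (vscale (tree_ops n) (c a) (f a)) (\<Sum>a\<in>S. pm_scale (c a) (f a)) \<in> sn_span n (tree_ops n) R"
    by (intro sn_span.add sn_span.scale) auto
  then show ?case using insert by simp
qed (use sn_span.zero[where V = "tree_ops n" and n = n and S = R] in simp_all)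

text \<open>
  The equations cut out a submodule. A generator satisfies them because a comb occurs in one pair of \<open>m\<close>
  at most; this is where the matching condition enters.
\<close>

lemma antisym_coeffs_submodule:
  assumes "single_valued m" "single_valued (m\<inverse>)"
  shows "sn_span 3 (tree_ops 3) (dual_match_relations m) \<subseteq> antisym_coeffs m"
proof
  fix p :: "'a tree \<Rightarrow>\<^sub>0 'b" assume "p \<in> sn_span 3 (tree_ops 3) (dual_match_relations m)"
  then show "p \<in> antisym_coeffs m"
  proof induction
    case (base p)
    then have "p \<in> carr (tree_ops 3)" using match_relations_carr by blast
    moreover have "Poly_Mapping.lookup p (lcomb g h a b c) + Poly_Mapping.lookup p (rcomb g' h' a b c) = 0"
      if "((g, h), (g', h')) \<in> m" for g h g' h' a b c
      using base that assms
      by (auto simp: dual_match_relations_def match_relations_def left_op_def right_op_def lookup_minus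
          lookup_single when_def single_valued_def)
    ultimately show ?case by (simp add: antisym_coeffs_def)
  next
    case (add p q)
    then have "vadd (tree_ops 3) p q \<in> carr (tree_ops 3)"
      by (intro sn_module.add_closed[OF tree_module]) (auto simp: antisym_coeffs_def)
    then show ?case using add.IH
      by (auto simp: antisym_coeffs_def lookup_add add_ac)
  next
    case (scale p c)
    then have "vscale (tree_ops 3) c p \<in> carr (tree_ops 3)"
      by (intro sn_module.scale_closed[OF tree_module]) (auto simp: antisym_coeffs_def)
    then show ?case using scale.IH by (auto simp: antisym_coeffs_def simp flip: distrib_left)
  next
    case (act \<sigma> p)
    then have "vact (tree_ops 3) \<sigma> p \<in> carr (tree_ops 3)"
      by (intro sn_module.act_closed[OF tree_module]) (auto simp: antisym_coeffs_def)
    then show ?case using act.IH arr3_act[OF act(1)]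
      by (simp add: antisym_coeffs_def lookup_act[OF act(1)] relabel_Vertex del: tree_operad_sel)
  qed (simp add: antisym_coeffs_def)
qed

lemma of_int_sign_nonzero: "of_int (sign \<sigma>) \<noteq> (0 :: 'k::field)"
  by (simp add: sign_def)

text \<open>
  Pairing with \<open>g(h(x\<^sub>a, x\<^sub>b), x\<^sub>c) - g'(x\<^sub>a, h'(x\<^sub>b, x\<^sub>c))\<close> gives, up to the sign of the word \<open>abc\<close>, the
  sum of the coefficients of the two combs: the minus sign of the relation cancels that of \<open>comb_sign\<close>.
\<close>

lemma antisym_coeffs_orthogonal:
  fixes p :: "'g tree \<Rightarrow>\<^sub>0 'k::field"
  shows "(\<forall>q\<in>sn_span 3 (tree_ops 3) (match_relations m). comb_form p q = 0) \<and> p \<in> carr (tree_ops 3)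
    \<longleftrightarrow> p \<in> antisym_coeffs m"
proof safe
  assume p: "\<forall>q\<in>sn_span 3 (tree_ops 3) (match_relations m). comb_form p q = 0" "p \<in> carr (tree_ops 3)"
  have "Poly_Mapping.lookup p (lcomb g h a b c) + Poly_Mapping.lookup p (rcomb g' h' a b c) = 0"
    if "((g, h), (g', h')) \<in> m" "arr3 a b c" for g h g' h' a b c
  proof -
    let ?l = "Poly_Mapping.single (lcomb g h a b c) 1" and ?r = "Poly_Mapping.single (rcomb g' h' a b c) 1"
    have "0 = comb_form p (?l - ?r)"
      by (rule p(1)[rule_format, OF comb_in_span(1)[OF that(2,1)], symmetric])
    also have "\<dots> = comb_form p ?l - comb_form p ?r"
      using comb_form_right(2)[of p "?l - ?r" ?r] by (simp add: eq_diff_eq)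
    also have "\<dots> = of_int (sign (word_perm [a, b, c])) *
        (Poly_Mapping.lookup p (lcomb g h a b c) + Poly_Mapping.lookup p (rcomb g' h' a b c))"
      by (simp add: comb_form_right algebra_simps)
    finally show ?thesis by (simp add: of_int_sign_nonzero)
  qed
  then show "p \<in> antisym_coeffs m" using p(2) by (auto simp: antisym_coeffs_def)
next
  fix q :: "'g tree \<Rightarrow>\<^sub>0 'k" assume p: "p \<in> antisym_coeffs m" and "q \<in> sn_span 3 (tree_ops 3) (match_relations m)"
  from this(2,1) show "comb_form p q = 0"
  proof (induction arbitrary: p)
    case (base q)
    then obtain g h g' h' where m: "((g, h), (g', h')) \<in> m"
      and q: "q = left_op (g, h) - right_op (g', h')" by (auto simp: match_relations_def)
    have "comb_form p q = comb_form p (left_op (g, h)) - comb_form p (right_op (g', h'))"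
      using comb_form_right(2)[of p q "right_op (g', h')"] by (simp add: q eq_diff_eq)
    also have "\<dots> = of_int (sign (word_perm [0, 1, 2])) *
        (Poly_Mapping.lookup p (lcomb g h 0 1 2) + Poly_Mapping.lookup p (rcomb g' h' 0 1 2))"
      by (simp add: left_op_def right_op_def comb_form_right algebra_simps)
    also have "\<dots> = 0" using base(2) m arr3_012 unfolding antisym_coeffs_def by force
    finally show ?case .
  next
    case (act \<sigma> q)
    \<comment> \<open>move the action to the first argument, which stays in the solution set of the equations\<close>
    let ?p = "vact (tree_ops 3) (inv \<sigma>) p"
    note i = permutes_inv[OF act(1)]
    have pc: "p \<in> carr (tree_ops 3)" using act.prems by (simp add: antisym_coeffs_def)
    have pc': "?p \<in> carr (tree_ops 3)" by (rule sn_module.act_closed[OF tree_module i pc])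
    then have "?p \<in> antisym_coeffs m"
      using act.prems arr3_act[OF i]
      by (simp add: antisym_coeffs_def lookup_act[OF i] relabel_Vertex del: tree_operad_sel)
    moreover have "vact (tree_ops 3) \<sigma> ?p = p"
      using sn_module.act_comp[OF tree_module i act(1) pc] sn_module.act_id[OF tree_module pc]
        permutes_inv_o(2)[OF act(1)] by simp
    ultimately show ?case
      using comb_form_act[OF act(1) pc', of q] act.IH by simp
  qed (simp_all add: comb_form_right)
qed (simp add: antisym_coeffs_def)

text \<open>
  The contribution of a comb to an element with antisymmetric coefficients: a matched left comb is
  completed to the relation that contains it, and a matched right comb contributes nothing, as it is already
  accounted for by its partner.
\<close>

fun match_expand :: "(('g \<times> 'g) \<times> ('g \<times> 'g)) set \<Rightarrow> 'g tree \<Rightarrow> ('g tree \<Rightarrow>\<^sub>0 'k::field)" where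
  "match_expand m (Vertex g (Vertex h (Leaf a) (Leaf b)) (Leaf c)) =
    (if (g, h) \<in> Domain m then
       Poly_Mapping.single (lcomb g h a b c) 1 -
         (let (g', h') = (THE r. ((g, h), r) \<in> m) in Poly_Mapping.single (rcomb g' h' a b c) 1)
     else Poly_Mapping.single (lcomb g h a b c) 1)"
| "match_expand m (Vertex g (Leaf a) (Vertex h (Leaf b) (Leaf c))) =
    (if (g, h) \<in> Range m then 0 else Poly_Mapping.single (rcomb g h a b c) 1)"
| "match_expand m _ = 0"

lemma match_expand_matched:
  assumes "single_valued m" "((g, h), (g', h')) \<in> m"
  shows "match_expand m (lcomb g h a b c) =
    Poly_Mapping.single (lcomb g h a b c) 1 - Poly_Mapping.single (rcomb g' h' a b c) 1"
proof -
  have "(THE r. ((g, h), r) \<in> m) = (g', h')"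
    using assms by (auto simp: single_valued_def)
  then show ?thesis using assms(2) by (auto simp: Domain.simps)
qed

text \<open>
  Replacing each comb of \<open>p\<close> by its \<open>match_expand\<close> gives back \<open>p\<close>: the coefficient of a matched right
  comb becomes minus that of its partner, which is the right value by antisymmetry. Every
  \<open>match_expand\<close> is a translate of a generator or zero.
\<close>

lemma antisym_coeffs_subset_span:
  assumes "single_valued m" "single_valued (m\<inverse>)"
  shows "antisym_coeffs m \<subseteq> sn_span 3 (tree_ops 3) (dual_match_relations m)"
proof
  fix p :: "'a tree \<Rightarrow>\<^sub>0 'b" assume p: "p \<in> antisym_coeffs m"
  then have pt: "t \<in> trees UNIV 3" if "t \<in> Poly_Mapping.keys p" for t
    using that by (auto simp: antisym_coeffs_def)
  have "pm_extend (match_expand m) p = p"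
  proof (rule poly_mapping_eqI)
    fix u
    \<comment> \<open>only a matched right comb receives its coefficient from another comb\<close>
    consider (matched) g h g' h' a b c where "u = rcomb g' h' a b c" "((g, h), (g', h')) \<in> m" "arr3 a b c"
      | (other) "\<And>g h g' h' a b c. ((g, h), (g', h')) \<in> m \<Longrightarrow> arr3 a b c \<Longrightarrow> u \<noteq> rcomb g' h' a b c"
      by blast
    then show "Poly_Mapping.lookup (pm_extend (match_expand m) p) u = Poly_Mapping.lookup p u"
    proof cases
      case matched
      have "Poly_Mapping.lookup (match_expand m t) u = (if t = lcomb g h a b c then - 1 else 0 :: 'b)"
        if "t \<in> Poly_Mapping.keys p" for t
        using pt[OF that]
      proof (cases rule: trees3_cases)
        case (lcomb k l x y z)
        show ?thesis
        proof (cases "(k, l) \<in> Domain m")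
          case True
          then obtain k' l' where kl: "((k, l), (k', l')) \<in> m" by auto
          have "(k', l') = (g', h') \<longleftrightarrow> (k, l) = (g, h)"
            using assms kl matched(2) unfolding single_valued_def by blast
          then show ?thesis
            unfolding lcomb(1) match_expand_matched[OF assms(1) kl]
            by (auto simp: matched(1) lookup_minus lookup_single when_def)
        next
          case False
          then show ?thesis
            using matched(2) by (auto simp: lcomb(1) matched(1) lookup_single when_def Domain.simps)
        qed
      next
        case (rcomb k l x y z)
        then show ?thesis using matched(2) by (auto simp: matched(1) lookup_single when_def Range.simps)
      qed
      then have "Poly_Mapping.lookup (pm_extend (match_expand m) p) u = pm_eval (\<lambda>t. if t = lcomb g h a b c then - 1 else 0) p"
        unfolding lookup_pm_extend by (rule pm_eval_cong)
      moreover have "Poly_Mapping.lookup p (lcomb g h a b c) + Poly_Mapping.lookup p u = 0"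
        using p matched unfolding antisym_coeffs_def by blast
      ultimately show ?thesis by (simp add: pm_eval_delta add_eq_0_iff)
    next
      case other
      have "Poly_Mapping.lookup (match_expand m t) u = (if t = u then 1 else 0 :: 'b)"
        if "t \<in> Poly_Mapping.keys p" for t
        using pt[OF that]
      proof (cases rule: trees3_cases)
        case (lcomb k l x y z)
        show ?thesis
        proof (cases "(k, l) \<in> Domain m")
          case True
          then obtain k' l' where kl: "((k, l), (k', l')) \<in> m" by auto
          show ?thesis
            using other[OF kl lcomb(2)]
            unfolding lcomb(1) match_expand_matched[OF assms(1) kl]
            by (auto simp: lookup_minus lookup_single when_def)
        qed (auto simp: lcomb(1) lookup_single when_def)
      next
        case (rcomb k l x y z)
        show ?thesis
        proof (cases "(k, l) \<in> Range m")
          case True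
          then obtain g h where "((g, h), (k, l)) \<in> m" by auto
          from other[OF this rcomb(2)] show ?thesis using True by (auto simp: rcomb(1))
        qed (auto simp: rcomb(1) lookup_single when_def)
      qed
      then have "Poly_Mapping.lookup (pm_extend (match_expand m) p) u = pm_eval (\<lambda>t. if t = u then 1 else 0) p"
        unfolding lookup_pm_extend by (rule pm_eval_cong)
      then show ?thesis by (simp add: pm_eval_delta)
    qed
  qed
  moreover have "match_expand m t \<in> sn_span 3 (tree_ops 3) (dual_match_relations m)"
    if "t \<in> Poly_Mapping.keys p" for t
    using pt[OF that]
  proof (cases rule: trees3_cases)
    case (lcomb k l x y z)
    show ?thesis
    proof (cases "(k, l) \<in> Domain m")
      case True
      then obtain k' l' where kl: "((k, l), (k', l')) \<in> m" by auto
      show ?thesis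
        unfolding lcomb(1) match_expand_matched[OF assms(1) kl] by (rule comb_in_span(2)[OF lcomb(2) kl])
    qed (simp add: lcomb(1) comb_in_span(3)[OF lcomb(2)])
  next
    case (rcomb k l x y z)
    then show ?thesis
      using comb_in_span(4)[OF rcomb(2), of k l m]
        sn_span.zero[where n = 3 and V = "tree_ops 3" and S = "dual_match_relations m"] by auto
  qed
  then have "pm_extend (match_expand m) p \<in> sn_span 3 (tree_ops 3) (dual_match_relations m)"
    unfolding pm_extend_def by (rule span_sum)
  ultimately show "p \<in> sn_span 3 (tree_ops 3) (dual_match_relations m)" by simp
qed

theorem annihilator_match_relations:
  assumes "single_valued m" "single_valued (m\<inverse>)"
  shows "{p \<in> carr (tree_ops 3). \<forall>q\<in>sn_span 3 (tree_ops 3) (match_relations m). comb_form p q = 0} =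
    sn_span 3 (tree_ops 3) (dual_match_relations m)"
  using antisym_coeffs_orthogonal[of m] antisym_coeffs_submodule[OF assms] antisym_coeffs_subset_span[OF assms]
  by blast

section \<open>The bigraft operad and its Koszul dual\<close>

instance gen :: finite
proof
  have "(UNIV :: gen set) = {M, Succ, Prec}" using gen.exhaust by blast
  then show "finite (UNIV :: gen set)" by (metis finite.simps)
qed

definition bg_co :: "'k::field gen_vec \<Rightarrow> gen \<Rightarrow> 'k" where
  "bg_co x g = Poly_Mapping.lookup x (g, id)"
definition bg_co' :: "'k::field gen_vec \<Rightarrow> gen \<Rightarrow> 'k" where
  "bg_co' x g = Poly_Mapping.lookup x (g, transpose 0 1)"

lemma lookup_free_act:
  assumes "\<sigma> permutes {..<n}"
  shows "Poly_Mapping.lookup (vact (free_sn n) \<sigma> x) (g, \<tau>) = Poly_Mapping.lookup x (g, \<tau> \<circ> inv \<sigma>)"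
proof -
  have iff: "\<rho> \<circ> \<sigma> = \<tau> \<longleftrightarrow> \<rho> = \<tau> \<circ> inv \<sigma>" for \<rho> :: "nat \<Rightarrow> nat"
    using permutes_inv_o[OF assms] by (auto simp: comp_assoc)
  have "pm_eval (\<lambda>a. Poly_Mapping.lookup (case a of (h, \<rho>) \<Rightarrow> Poly_Mapping.single (h, \<rho> \<circ> \<sigma>) 1) (g, \<tau>)) x =
    pm_eval (\<lambda>a. if a = (g, \<tau> \<circ> inv \<sigma>) then 1 else 0) x"
  proof (intro pm_eval_cong)
    fix a
    show "Poly_Mapping.lookup (case a of (h, \<rho>) \<Rightarrow> Poly_Mapping.single (h, \<rho> \<circ> \<sigma>) 1) (g, \<tau>) =
        (if a = (g, \<tau> \<circ> inv \<sigma>) then 1 else 0)"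
      by (cases a) (simp add: lookup_single when_def iff)
  qed
  then show ?thesis by (simp add: free_sn_def lookup_pm_extend pm_eval_delta)
qed

lemma free_sn_span: "carr (free_sn n) \<subseteq> sn_span n (free_sn n) (range free_gen)"
proof
  fix x :: "'a \<times> (nat \<Rightarrow> nat) \<Rightarrow>\<^sub>0 'b" assume x: "x \<in> carr (free_sn n)"
  show "x \<in> sn_span n (free_sn n) (range free_gen)"
  proof (rule pm_span_induct)
    show "0 \<in> sn_span n (free_sn n) (range free_gen)"
      using sn_span.zero[where V = "free_sn n" and n = n and S = "range free_gen"] by (simp add: free_sn_def)
  next
    fix y z :: "'a \<times> (nat \<Rightarrow> nat) \<Rightarrow>\<^sub>0 'b"
    assume "y \<in> sn_span n (free_sn n) (range free_gen)" "z \<in> sn_span n (free_sn n) (range free_gen)"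
    from sn_span.add[OF this] show "y + z \<in> sn_span n (free_sn n) (range free_gen)"
      by (simp add: free_sn_def)
  next
    fix c :: 'b and a assume a: "a \<in> Poly_Mapping.keys x"
    obtain g \<sigma> where g: "a = (g, \<sigma>)" by (cases a)
    have \<sigma>: "\<sigma> permutes {..<n}" using x a g by (auto simp: free_sn_def)
    have "vscale (free_sn n) c (vact (free_sn n) \<sigma> (free_gen g)) \<in> sn_span n (free_sn n) (range free_gen)"
      by (intro sn_span.scale sn_span.act[OF \<sigma>] sn_span.base) auto
    then show "Poly_Mapping.single a c \<in> sn_span n (free_sn n) (range free_gen)"
      by (simp add: free_sn_def free_gen_def g)
  qed
qed

lemma bg_free: "free_S2_module (bg_E :: ('k::field, 'k gen_vec) sn_mod) free_gen bg_co bg_co'"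
proof -
  interpret sn_module 2 "bg_E :: ('k, 'k gen_vec) sn_mod" unfolding bg_E_def by (rule sn_module_free)
  have "{..<2::nat} = {0, 1}" by auto
  then have t: "transpose 0 1 permutes {..<2::nat}" by (simp add: permutes_swap_id)
  have ne: "(id :: nat \<Rightarrow> nat) \<noteq> transpose 0 1" by (metis id_apply transpose_apply_first zero_neq_one)
  show ?thesis
  proof
    show "free_gen g \<in> carr (bg_E :: ('k, 'k gen_vec) sn_mod)" for g
      by (simp add: free_gen_def bg_E_def free_sn_def permutes_id)
    show "carr (bg_E :: ('k, 'k gen_vec) sn_mod) \<subseteq> sn_span 2 bg_E (range free_gen)"
      unfolding bg_E_def by (rule free_sn_span)
    show "bg_co (vact bg_E (transpose 0 1) x) g = bg_co' x g"
      "bg_co' (vact bg_E (transpose 0 1) x) g = bg_co x g" for x :: "'k gen_vec" and g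
      unfolding bg_E_def bg_co_def bg_co'_def lookup_free_act[OF t] by (simp_all add: inv_swap_id del: One_nat_def)
    show "bg_co (free_gen g :: 'k gen_vec) h = (if g = h then 1 else 0)" for g h
      by (simp add: free_gen_def bg_co_def lookup_single when_def)
    show "bg_co' (free_gen g :: 'k gen_vec) h = 0" for g h
      using ne by (simp add: free_gen_def bg_co'_def lookup_single when_def)
  qed (simp_all add: bg_E_def free_sn_def bg_co_def bg_co'_def lookup_add)
qed

interpretation bg: free_S2_module "bg_E :: ('k::field, 'k gen_vec) sn_mod" free_gen bg_co bg_co'
  by (rule bg_free)

lemma dual_gen_eq: "dual_gen g = bg.dual_gn g"
  by (simp add: dual_gen_def bg_co_def)

interpretation bgd: free_S2_module "sn_dual 2 (bg_E :: ('k::field, 'k gen_vec) sn_mod)" bg.dual_gn bg.dual_co bg.dual_co'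
  by (rule bg.dual_free)

definition bg_match :: "((gen \<times> gen) \<times> (gen \<times> gen)) set" where
  "bg_match = {((Succ, M), (Succ, Succ)), ((M, Succ), (Succ, M)), ((Prec, Prec), (Prec, M)),
    ((Prec, M), (M, Prec)), ((Prec, Succ), (Succ, Prec)), ((M, M), (M, M))}"

lemma bg_hom: "operad_hom (free_operad bg_E) (tree_operad UNIV) bg.gen_iso"
  by (rule bg.gen_iso[unfolded operad_iso_iff_hom, THEN conjunct2, THEN conjunct2, THEN conjunct1])

lemma free_operad_bg: "operad (free_operad bg_E)"
  by (rule operad_free_operad[OF bg.E_module])

lemma gen_iso_gen_op: "bg.gen_iso 2 (gen_op g) = corolla g"
  by (simp add: gen_op_def bg.gen_iso_incl)

lemma gen_op_carr: "gen_op g \<in> carr (ops (free_operad bg_E) 2)"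
  unfolding gen_op_def by (rule free_incl_carr[OF bg.E_module bg.gn_carr])

lemma gen_iso_comp:
  "bg.gen_iso 3 (compL g h) = left_op (g, h)"
  "bg.gen_iso 3 (compR g h) = right_op (g, h)"
  "bg.gen_iso 3 (comp_diff g h g' h') = left_op (g, h) - right_op (g', h')"
proof -
  note u = operad.unit_closed[OF free_operad_bg] operad_homD(5)[OF bg_hom]
  have three: "2 + 1 = (3::nat)" "1 + 2 = (3::nat)" by simp_all
  have L: "bg.gen_iso 3 (compL g h) = left_op (g, h)" for g h
  proof -
    have "bg.gen_iso 3 (compL g h) =
        bicomp (tree_operad UNIV) 2 1 (corolla g) (corolla h) (Poly_Mapping.single (Leaf 0) 1)"
      using operad_hom_bicomp[OF free_operad_bg bg_hom gen_op_carr gen_op_carr u(1), of g h]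
      unfolding compL_def gen_iso_gen_op u(2) tree_operad_sel(6) three .
    then show ?thesis unfolding corolla_def[of h] bicomp_trees by (simp add: left_op_def)
  qed
  have R: "bg.gen_iso 3 (compR g h) = right_op (g, h)" for g h
  proof -
    have "bg.gen_iso 3 (compR g h) =
        bicomp (tree_operad UNIV) 1 2 (corolla g) (Poly_Mapping.single (Leaf 0) 1) (corolla h)"
      using operad_hom_bicomp[OF free_operad_bg bg_hom gen_op_carr u(1) gen_op_carr, of g h]
      unfolding compR_def gen_iso_gen_op u(2) tree_operad_sel(6) three .
    then show ?thesis unfolding corolla_def[of h] bicomp_trees
      by (simp add: right_op_def relabel_Vertex numeral_2_eq_2)
  qed
  show "bg.gen_iso 3 (compL g h) = left_op (g, h)" "bg.gen_iso 3 (compR g h) = right_op (g, h)"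
    by (rule L R)+
  show "bg.gen_iso 3 (comp_diff g h g' h') = left_op (g, h) - right_op (g', h')"
    unfolding comp_diff_def operad_hom_minus[OF free_operad_bg bg_hom bg_carr(1,2)] L R
    by (simp add: vminus_def pm_scale_uminus)
qed

lemma bg_relations_image:
  "bg.gen_iso 3 ` (bg_relations :: ('k::field gen_vec tree \<Rightarrow>\<^sub>0 'k) set set) =
    sn_span 3 (tree_ops 3) (match_relations bg_match)"
proof -
  let ?S = "{comp_diff Succ M Succ Succ, comp_diff M Succ Succ M, comp_diff Prec Prec Prec M,
     comp_diff Prec M M Prec, comp_diff Prec Succ Succ Prec, comp_diff M M M M}
     :: ('k gen_vec tree \<Rightarrow>\<^sub>0 'k) set set"
  have "?S \<subseteq> carr (ops (free_operad bg_E) 3)" by (simp add: bg_carr)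
  moreover have "bg.gen_iso 3 ` ?S = match_relations bg_match"
    by (simp add: gen_iso_comp match_relations_def bg_match_def)
  ultimately show ?thesis
    unfolding bg_relations_def by (simp only: operad_hom_span[OF free_operad_bg bg_hom operad_tree_operad])
qed

lemma dual_relations_image:
  "bg.gen_iso 3 ` (dual_relations :: ('k::field gen_vec tree \<Rightarrow>\<^sub>0 'k) set set) =
    sn_span 3 (tree_ops 3) (dual_match_relations bg_match)"
proof -
  let ?S = "{comp_diff Succ M Succ Succ, compL Succ Succ, comp_diff M Succ Succ M, compL Succ Prec,
     comp_diff Prec Prec Prec M, compL M Prec, comp_diff Prec M M Prec, compR Prec Prec,
     comp_diff Prec Succ Succ Prec, compR Prec Succ, comp_diff M M M M, compR M Succ}
     :: ('k gen_vec tree \<Rightarrow>\<^sub>0 'k) set set"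
  have c: "?S \<subseteq> carr (ops (free_operad bg_E) 3)" by (simp add: bg_carr)
  have D: "- Domain bg_match = {(Succ, Succ), (Succ, Prec), (M, Prec)}"
  proof (rule set_eqI)
    fix x :: "gen \<times> gen"
    obtain g h where "x = (g, h)" by (cases x)
    then show "x \<in> - Domain bg_match \<longleftrightarrow> x \<in> {(Succ, Succ), (Succ, Prec), (M, Prec)}"
      by (cases g; cases h) (simp_all add: bg_match_def)
  qed
  have R: "- Range bg_match = {(Prec, Prec), (Prec, Succ), (M, Succ)}"
  proof (rule set_eqI)
    fix x :: "gen \<times> gen"
    obtain g h where "x = (g, h)" by (cases x)
    then show "x \<in> - Range bg_match \<longleftrightarrow> x \<in> {(Prec, Prec), (Prec, Succ), (M, Succ)}"
      by (cases g; cases h) (simp_all add: bg_match_def)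
  qed
  have "bg.gen_iso 3 ` ?S = dual_match_relations bg_match"
    unfolding dual_match_relations_def D R
    by (auto simp: gen_iso_comp match_relations_def bg_match_def)
  then show ?thesis
    unfolding dual_relations_def by (simp only: operad_hom_span[OF free_operad_bg bg_hom operad_tree_operad c])
qed

lemma bg_relations_carr: "bg_relations \<subseteq> carr (ops (free_operad bg_E) 3)"
  "dual_relations \<subseteq> carr (ops (free_operad bg_E) 3)"
  unfolding bg_relations_def dual_relations_def
  by (intro sn_span_subset[OF operad.module[OF free_operad_bg]]; simp add: bg_carr)+

lemma annihilator_image_bg:
  "bgd.gen_iso 3 ` annihilator bg_E bg_relations = bg.gen_iso 3 ` dual_relations"
  unfolding bg.annihilator_image[OF bg_relations_carr(1)] bg_relations_image dual_relations_image
  by (rule annihilator_match_relations) (auto simp: bg_match_def single_valued_def)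

theorem theorem42:
  shows "\<exists>\<phi>. operad_iso
      (bigraft_dual :: ('k::field, (('k gen_vec \<Rightarrow> 'k) tree \<Rightarrow>\<^sub>0 'k) set set) operad_struct)
      (quadratic_operad bg_E dual_relations) \<phi> \<and>
    (\<forall>g. \<phi> 2 (quadratic_incl (sn_dual 2 bg_E) (annihilator bg_E bg_relations) (dual_gen g)) =
         quadratic_incl bg_E dual_relations (free_gen g))"
proof -
  let ?E = "bg_E :: ('k, 'k gen_vec) sn_mod" and ?E' = "sn_dual 2 (bg_E :: ('k, 'k gen_vec) sn_mod)"
  let ?R = "dual_relations :: ('k gen_vec tree \<Rightarrow>\<^sub>0 'k) set set" and ?R' = "annihilator ?E bg_relations"
  let ?T = "tree_operad UNIV :: ('k, gen tree \<Rightarrow>\<^sub>0 'k) operad_struct"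
  define K where "K = operad_ideal ?T (\<lambda>n. if n = 3 then bg.gen_iso 3 ` ?R else {})"
  have R': "?R' \<subseteq> carr (ops (free_operad ?E') 3)" by (auto simp: annihilator_def)
  obtain \<theta> where \<theta>: "operad_iso (quadratic_operad ?E ?R) (quotient_operad ?T K) \<theta>"
    "\<forall>\<mu>\<in>carr ?E. \<theta> 2 (quadratic_incl ?E ?R \<mu>) = coset ?T K 2 (bg.gen_iso 2 (free_incl ?E \<mu>))"
    using quadratic_operad_iso[OF bg.E_module bg.gen_iso bg_relations_carr(2)] unfolding K_def by blast
  obtain \<theta>' where \<theta>': "operad_iso (quadratic_operad ?E' ?R') (quotient_operad ?T K) \<theta>'"
    "\<forall>\<mu>\<in>carr ?E'. \<theta>' 2 (quadratic_incl ?E' ?R' \<mu>) = coset ?T K 2 (bgd.gen_iso 2 (free_incl ?E' \<mu>))"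
    using quadratic_operad_iso[OF bgd.E_module bgd.gen_iso R']
    unfolding K_def annihilator_image_bg by blast
  let ?inv = "\<lambda>n. inv_into (carr (ops (quadratic_operad ?E ?R) n)) (\<theta> n)"
  show ?thesis
  proof (intro exI conjI allI)
    show "operad_iso bigraft_dual (quadratic_operad ?E ?R) (\<lambda>n x. ?inv n (\<theta>' n x))"
      unfolding bigraft_dual_def koszul_dual_def
      by (rule operad_iso_comp[OF \<theta>'(1) operad_iso_inverse[OF \<theta>(1)]])
    fix g
    have d: "dual_gen g \<in> carr ?E'" unfolding dual_gen_eq by (rule bg.dual_gn_carr)
    have "\<theta>' 2 (quadratic_incl ?E' ?R' (dual_gen g)) = coset ?T K 2 (corolla g)"
      using \<theta>'(2) d by (simp add: dual_gen_eq bgd.gen_iso_incl)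
    also have "\<dots> = \<theta> 2 (quadratic_incl ?E ?R (free_gen g))"
      by (simp add: bspec[OF \<theta>(2) bg.gn_carr] bg.gen_iso_incl)
    finally have e: "\<theta>' 2 (quadratic_incl ?E' ?R' (dual_gen g)) = \<theta> 2 (quadratic_incl ?E ?R (free_gen g))" .
    have "quadratic_incl ?E ?R (free_gen g) \<in> carr (ops (quadratic_operad ?E ?R) 2)"
      unfolding quadratic_incl_def quadratic_operad_def
        operad_with_ideal.quotient_carr[OF operad_quadratic_ideal[OF bg.E_module bg_relations_carr(2)]]
      by (intro imageI free_incl_carr[OF bg.E_module bg.gn_carr])
    moreover have "inj_on (\<theta> 2) (carr (ops (quadratic_operad ?E ?R) 2))"
      using \<theta>(1) by (simp add: operad_iso_iff_hom bij_betw_def)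
    ultimately show "?inv 2 (\<theta>' 2 (quadratic_incl ?E' ?R' (dual_gen g))) = quadratic_incl ?E ?R (free_gen g)"
      unfolding e by simp
  qed
qed

end
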